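(* Let $(M^{4n},Q,\omega)$, $n>1$, be a quaternionic skew-Hermitian manifold (i.e. $T^{Q,\omega}=0$) and let $N^{4k}\subset M^{4n}$, $k<n$, be an almost quaternionic submanifold of $(M^{4n},Q)$, with $\hat Q=Q|_{TN}$ and induced 2-form $\hat\omega=\iota^*\omega$. Suppose that $\hat\omega$ is non-degenerate (and hence a symplectic form on $N^{4k}$). Then $N^{4k}$ admits a torsion-free $\mathrm{SO}^*(2k)\mathrm{Sp}(1)$-structure defined by the pair $(\hat Q,\hat\omega)$. In particular, $(N^{4k},\hat Q,\hat\omega)$ is a quaternionic skew-Hermitian manifold whose unique minimal adapted connection $\nabla^{\hat Q,\hat\omega}$ satisfies $$\nabla^{\hat Q,\hat\omega}=\nabla^{Q,\omega}|_{TN}=\nabla^{Q,\mathrm{vol}}|_{TN}.$$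
   Context: An almost quaternionic structure on $M^{4n}$ ($n>1$) is a rank-3 subbundle $Q\subset\mathrm{End}(TM)$ locally spanned by an admissible basis $J_1,J_2,J_3$, i.e. $J_a^2=-\mathrm{Id}$, $J_1J_2=J_3=-J_2J_1$. An almost quaternionic skew-Hermitian (qs-H) manifold $(M^{4n},Q,\omega)$ is such a manifold with a non-degenerate 2-form $\omega$ satisfying $\omega(J_aX,J_aY)=\omega(X,Y)$ for every admissible basis; equivalently, an $\mathrm{SO}^*(2n)\mathrm{Sp}(1)$-structure on $M$. Minimal adapted connection. $N_J(X,Y)=[JX,JY]-J[JX,Y]-J[X,JY]-[X,Y]$. The Obata connection $\nabla^H$ of an admissible basis $H=\{J_a\}$ is the unique connection with $\nabla^HJ_a=0$ and torsion $T^H=\frac16\sum_aN_{J_a}$. With $\mathrm{vol}=\omega^{2n}$, the unimodular Oproiu connection $\nabla^{Q,\mathrm{vol}}$ is the unique connection preserving $Q$ and $\mathrm{vol}$ whose torsion is, for any admissible basis, $T^Q=T^H+\sum_a\partial(\tau_a\otimes J_a)$, where $\tau_a(X)=\frac1{4n-2}\mathrm{tr}(J_aT^H_X)$ and $\partial(\tau\otimes J)(X,Y)=\tau(X)JY-\tau(Y)JX$. Then the minimal adapted connection is $\nabla^{Q,\omega}=\nabla^{Q,\mathrm{vol}}+A$ with $\omega(A(X,Y),Z)=\frac12(\nabla^{Q,\mathrm{vol}}_X\omega)(Y,Z)$; it preserves $Q$ and $\omega$, and $T^{Q,\omega}$ is its torsion. It is torsion-free iff $T^Q=0$ and $\nabla^{Q,\mathrm{vol}}\omega=0$;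 in that case $(M,Q,\omega)$ is called a quaternionic skew-Hermitian manifold, and $d\omega=0$. $\nabla^{\hat Q,\hat\omega}$ is the same construction applied to $(\hat Q,\hat\omega)$ on $N^{4k}$. An almost quaternionic submanifold $\iota:N^{4k}\to M^{4n}$ ($k<n$) is a submanifold with $J T_xN=T_xN$ for all $x\in N$ and all almost complex structures $J\in Q_x$. Restriction of a connection to $TN$ means $(X,Y)\mapsto\nabla_XY$ for $X,Y\in\Gamma(TN)$ (which takes values in $TN$). *)

theory Defs
  imports
    "HOL-Analysis.Analysis"
    "HOL-Library.Function_Algebras"
    "HOL-Combinatorics.Permutations"
begin

text \<open>Pointwise real vector space structure on functions, completing \<^theory>\<open>HOL-Library.Function_Algebras\<close>.
  It is used for tangent vectors (functionals) and for endomorphisms of tangent spaces.\<close>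

instantiation "fun" :: (type, scaleR) scaleR
begin

definition scaleR_fun :: "real \<Rightarrow> ('a \<Rightarrow> 'b) \<Rightarrow> 'a \<Rightarrow> 'b" where
  "scaleR_fun c f = (\<lambda>x. c *\<^sub>R f x)"

instance ..

end

instance "fun" :: (type, real_vector) real_vector
  by standard (simp_all add: scaleR_fun_def fun_eq_iff algebra_simps)


section \<open>Smooth manifolds\<close>

text \<open>Smoothness is only used on open sets of Euclidean spaces, where the existence and
  continuity of all iterated directional derivatives of Frechet differentiable functions is
  the usual notion.\<close>

primrec Ck_on :: "nat \<Rightarrow> 'a::real_normed_vector set \<Rightarrow> ('a \<Rightarrow> 'b::real_normed_vector) \<Rightarrow> bool" where
  "Ck_on 0 S f \<longleftrightarrow> continuous_on S f"
| "Ck_on (Suc k) S f \<longleftrightarrow>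
     (\<forall>x\<in>S. f differentiable (at x)) \<and> (\<forall>v. Ck_on k S (\<lambda>x. frechet_derivative f (at x) v))"

definition smooth_on :: "'a::real_normed_vector set \<Rightarrow> ('a \<Rightarrow> 'b::real_normed_vector) \<Rightarrow> bool" where
  "smooth_on S f \<longleftrightarrow> (\<forall>k. Ck_on k S f)"

type_synonym ('m, 'a) atlas = "('m set \<times> ('m \<Rightarrow> 'a)) set"

text \<open>The underlying topological space is the whole type \<open>'m\<close>; the dimension of the
  manifold is that of the Euclidean model space \<open>'a\<close>.  The atlas need not be maximal.\<close>

definition smooth_manifold ::
  "('m::{t2_space,second_countable_topology}, 'a::euclidean_space) atlas \<Rightarrow> bool" where
  "smooth_manifold A \<longleftrightarrow>
     (\<forall>(U, \<phi>)\<in>A. open U \<and> open (\<phi> ` U) \<and> homeomorphism U (\<phi> ` U) \<phi> (inv_into U \<phi>)) \<and>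
     (\<Union>(U, \<phi>)\<in>A. U) = UNIV \<and>
     (\<forall>(U, \<phi>)\<in>A. \<forall>(V, \<psi>)\<in>A. smooth_on (\<phi> ` (U \<inter> V)) (\<psi> \<circ> inv_into U \<phi>))"

definition smooth_fun_on ::
  "('m::topological_space, 'a::euclidean_space) atlas \<Rightarrow> 'm set \<Rightarrow> ('m \<Rightarrow> real) \<Rightarrow> bool" where
  "smooth_fun_on A W f \<longleftrightarrow>
     open W \<and> (\<forall>(U, \<phi>)\<in>A. smooth_on (\<phi> ` (U \<inter> W)) (f \<circ> inv_into U \<phi>))"

definition smooth_near ::
  "('m::topological_space, 'a::euclidean_space) atlas \<Rightarrow> 'm \<Rightarrow> ('m \<Rightarrow> real) set" where
  "smooth_near A p = {f. \<exists>W. p \<in> W \<and> smooth_fun_on A W f}"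

definition smooth_map ::
  "('n::topological_space, 'b::euclidean_space) atlas \<Rightarrow>
   ('m::topological_space, 'a::euclidean_space) atlas \<Rightarrow> ('n \<Rightarrow> 'm) \<Rightarrow> bool" where
  "smooth_map B A h \<longleftrightarrow>
     continuous_on UNIV h \<and>
     (\<forall>(U, \<phi>)\<in>B. \<forall>(V, \<psi>)\<in>A. smooth_on (\<phi> ` (U \<inter> h -` V)) (\<psi> \<circ> h \<circ> inv_into U \<phi>))"


section \<open>Tangent vectors and vector fields\<close>

type_synonym 'm tvec = "('m \<Rightarrow> real) \<Rightarrow> real"
type_synonym 'm vfield = "'m \<Rightarrow> 'm tvec"
type_synonym 'm endo = "'m tvec \<Rightarrow> 'm tvec"

text \<open>Tangent vectors are derivations at \<open>p\<close> of the functions that are smooth near \<open>p\<close>;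
  on other functions they are \<open>0\<close>, so that equality of tangent vectors is equality of
  functionals.\<close>

definition tangent_space ::
  "('m::topological_space, 'a::euclidean_space) atlas \<Rightarrow> 'm \<Rightarrow> 'm tvec set" where
  "tangent_space A p = {v.
     (\<forall>f\<in>smooth_near A p. \<forall>g\<in>smooth_near A p. v (\<lambda>q. f q + g q) = v f + v g) \<and>
     (\<forall>f\<in>smooth_near A p. \<forall>c. v (\<lambda>q. c * f q) = c * v f) \<and>
     (\<forall>f\<in>smooth_near A p. \<forall>g\<in>smooth_near A p. v (\<lambda>q. f q * g q) = f p * v g + g p * v f) \<and>
     (\<forall>f. f \<notin> smooth_near A p \<longrightarrow> v f = 0)}"

definition vector_field_on ::
  "('m::topological_space, 'a::euclidean_space) atlas \<Rightarrow> 'm set \<Rightarrow> 'm vfield \<Rightarrow> bool" where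
  "vector_field_on A W X \<longleftrightarrow>
     open W \<and> (\<forall>p\<in>W. X p \<in> tangent_space A p) \<and>
     (\<forall>W' f. W' \<subseteq> W \<longrightarrow> smooth_fun_on A W' f \<longrightarrow> smooth_fun_on A W' (\<lambda>p. X p f))"

definition fields_near ::
  "('m::topological_space, 'a::euclidean_space) atlas \<Rightarrow> 'm \<Rightarrow> 'm vfield set" where
  "fields_near A p = {X. \<exists>W. p \<in> W \<and> vector_field_on A W X}"

definition lie_bracket ::
  "('m::topological_space, 'a::euclidean_space) atlas \<Rightarrow> 'm vfield \<Rightarrow> 'm vfield \<Rightarrow> 'm vfield" where
  "lie_bracket A X Y p =
     (\<lambda>f. if f \<in> smooth_near A p then X p (\<lambda>q. Y q f) - Y p (\<lambda>q. X q f) else 0)"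

text \<open>Endomorphisms of a tangent space are extended by \<open>0\<close> to all functionals.\<close>

definition tangent_endos ::
  "('m::topological_space, 'a::euclidean_space) atlas \<Rightarrow> 'm \<Rightarrow> 'm endo set" where
  "tangent_endos A p = {F.
     (\<forall>v\<in>tangent_space A p. F v \<in> tangent_space A p) \<and>
     (\<forall>v\<in>tangent_space A p. \<forall>w\<in>tangent_space A p. F (v + w) = F v + F w) \<and>
     (\<forall>v\<in>tangent_space A p. \<forall>c. F (c *\<^sub>R v) = c *\<^sub>R F v) \<and>
     (\<forall>v. v \<notin> tangent_space A p \<longrightarrow> F v = 0)}"

definition apply_endo :: "('m \<Rightarrow> 'm endo) \<Rightarrow> 'm vfield \<Rightarrow> 'm vfield" where
  "apply_endo J X = (\<lambda>p. J p (X p))"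

definition endo_field_on ::
  "('m::topological_space, 'a::euclidean_space) atlas \<Rightarrow> 'm set \<Rightarrow> ('m \<Rightarrow> 'm endo) \<Rightarrow> bool" where
  "endo_field_on A W J \<longleftrightarrow>
     open W \<and> (\<forall>p\<in>W. J p \<in> tangent_endos A p) \<and>
     (\<forall>W' X. W' \<subseteq> W \<longrightarrow> vector_field_on A W' X \<longrightarrow> vector_field_on A W' (apply_endo J X))"

definition trace_on :: "'v::real_vector set \<Rightarrow> ('v \<Rightarrow> 'v) \<Rightarrow> real" where
  "trace_on S F =
     (let B = (SOME B. B \<subseteq> S \<and> independent B \<and> S \<subseteq> span B)
      in \<Sum>b\<in>B. representation B (F b) b)"

text \<open>Value at \<open>v, w\<close> of the tensor field given by an operation \<open>F\<close> on local vector
  fields whose value at \<open>p\<close> depends only on the values of its arguments at \<open>p\<close>.\<close>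

definition tensor_at ::
  "('m::topological_space, 'a::euclidean_space) atlas \<Rightarrow>
   ('m vfield \<Rightarrow> 'm vfield \<Rightarrow> 'm vfield) \<Rightarrow> 'm \<Rightarrow> 'm tvec \<Rightarrow> 'm tvec \<Rightarrow> 'm tvec" where
  "tensor_at A F p v w = (THE u. \<forall>X\<in>fields_near A p. \<forall>Y\<in>fields_near A p.
     X p = v \<longrightarrow> Y p = w \<longrightarrow> F X Y p = u)"


section \<open>Differential forms\<close>

type_synonym 'm form2 = "'m \<Rightarrow> 'm tvec \<Rightarrow> 'm tvec \<Rightarrow> real"

definition two_form ::
  "('m::topological_space, 'a::euclidean_space) atlas \<Rightarrow> 'm form2 \<Rightarrow> bool" where
  "two_form A \<omega> \<longleftrightarrow>
     (\<forall>p. \<forall>u\<in>tangent_space A p. \<forall>v\<in>tangent_space A p. \<forall>w\<in>tangent_space A p. \<forall>c.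
        \<omega> p (u + v) w = \<omega> p u w + \<omega> p v w \<and>
        \<omega> p (c *\<^sub>R v) w = c * \<omega> p v w \<and>
        \<omega> p v w = - \<omega> p w v) \<and>
     (\<forall>W X Y. vector_field_on A W X \<longrightarrow> vector_field_on A W Y \<longrightarrow>
        smooth_fun_on A W (\<lambda>p. \<omega> p (X p) (Y p)))"

definition nondegenerate ::
  "('m::topological_space, 'a::euclidean_space) atlas \<Rightarrow> 'm form2 \<Rightarrow> bool" where
  "nondegenerate A \<omega> \<longleftrightarrow>
     (\<forall>p. \<forall>v\<in>tangent_space A p. (\<forall>w\<in>tangent_space A p. \<omega> p v w = 0) \<longrightarrow> v = 0)"

definition closed_form ::
  "('m::topological_space, 'a::euclidean_space) atlas \<Rightarrow> 'm form2 \<Rightarrow> bool" where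
  "closed_form A \<omega> \<longleftrightarrow>
     (\<forall>p. \<forall>X\<in>fields_near A p. \<forall>Y\<in>fields_near A p. \<forall>Z\<in>fields_near A p.
        X p (\<lambda>q. \<omega> q (Y q) (Z q)) - Y p (\<lambda>q. \<omega> q (X q) (Z q)) + Z p (\<lambda>q. \<omega> q (X q) (Y q))
        - \<omega> p (lie_bracket A X Y p) (Z p) + \<omega> p (lie_bracket A X Z p) (Y p)
        - \<omega> p (lie_bracket A Y Z p) (X p) = 0)"

text \<open>The \<open>m\<close>-fold wedge power of \<open>\<omega>\<close>, evaluated on \<open>vs 0, ..., vs (2 m - 1)\<close>.\<close>

definition wedge_power :: "'m form2 \<Rightarrow> nat \<Rightarrow> 'm \<Rightarrow> (nat \<Rightarrow> 'm tvec) \<Rightarrow> real" where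
  "wedge_power \<omega> m p vs =
     (\<Sum>\<sigma> | \<sigma> permutes {..<2 * m}.
        of_int (sign \<sigma>) * (\<Prod>i<m. \<omega> p (vs (\<sigma> (2 * i))) (vs (\<sigma> (2 * i + 1))))) / 2 ^ m"


section \<open>Connections\<close>

text \<open>\<open>D p v Y\<close> is the covariant derivative at \<open>p\<close> of a local vector field \<open>Y\<close> in the
  direction \<open>v\<close>.  Locality in \<open>Y\<close> follows from the Leibniz rule, because functions
  that are smooth only near \<open>p\<close> are admitted there.\<close>

type_synonym 'm conn = "'m \<Rightarrow> 'm tvec \<Rightarrow> 'm vfield \<Rightarrow> 'm tvec"

definition connection ::
  "('m::topological_space, 'a::euclidean_space) atlas \<Rightarrow> 'm conn \<Rightarrow> bool" where
  "connection A D \<longleftrightarrow>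
     (\<forall>p. \<forall>v\<in>tangent_space A p. \<forall>Y\<in>fields_near A p.
        D p v Y \<in> tangent_space A p \<and>
        (\<forall>w\<in>tangent_space A p. D p (v + w) Y = D p v Y + D p w Y) \<and>
        (\<forall>c. D p (c *\<^sub>R v) Y = c *\<^sub>R D p v Y) \<and>
        (\<forall>Z\<in>fields_near A p. D p v (\<lambda>q. Y q + Z q) = D p v Y + D p v Z) \<and>
        (\<forall>f\<in>smooth_near A p. D p v (\<lambda>q. f q *\<^sub>R Y q) = v f *\<^sub>R Y p + f p *\<^sub>R D p v Y)) \<and>
     (\<forall>W X Y. vector_field_on A W X \<longrightarrow> vector_field_on A W Y \<longrightarrow>
        vector_field_on A W (\<lambda>p. D p (X p) Y))"

definition connection_eq ::
  "('m::topological_space, 'a::euclidean_space) atlas \<Rightarrow> 'm conn \<Rightarrow> 'm conn \<Rightarrow> bool" where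
  "connection_eq A D D' \<longleftrightarrow>
     (\<forall>p. \<forall>v\<in>tangent_space A p. \<forall>Y\<in>fields_near A p. D p v Y = D' p v Y)"

definition torsion ::
  "('m::topological_space, 'a::euclidean_space) atlas \<Rightarrow> 'm conn \<Rightarrow>
   'm vfield \<Rightarrow> 'm vfield \<Rightarrow> 'm vfield" where
  "torsion A D X Y = (\<lambda>p. D p (X p) Y - D p (Y p) X - lie_bracket A X Y p)"

definition torsion_free ::
  "('m::topological_space, 'a::euclidean_space) atlas \<Rightarrow> 'm conn \<Rightarrow> bool" where
  "torsion_free A D \<longleftrightarrow>
     (\<forall>p. \<forall>X\<in>fields_near A p. \<forall>Y\<in>fields_near A p. torsion A D X Y p = 0)"

definition cov_deriv_form2 ::
  "'m conn \<Rightarrow> 'm form2 \<Rightarrow> 'm \<Rightarrow> 'm tvec \<Rightarrow> 'm vfield \<Rightarrow> 'm vfield \<Rightarrow> real" where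
  "cov_deriv_form2 D \<omega> p v Y Z =
     v (\<lambda>q. \<omega> q (Y q) (Z q)) - \<omega> p (D p v Y) (Z p) - \<omega> p (Y p) (D p v Z)"

definition preserves_form2 ::
  "('m::topological_space, 'a::euclidean_space) atlas \<Rightarrow> 'm form2 \<Rightarrow> 'm conn \<Rightarrow> bool" where
  "preserves_form2 A \<omega> D \<longleftrightarrow>
     (\<forall>p. \<forall>v\<in>tangent_space A p. \<forall>Y\<in>fields_near A p. \<forall>Z\<in>fields_near A p.
        cov_deriv_form2 D \<omega> p v Y Z = 0)"

definition preserves_vol ::
  "('m::topological_space, 'a::euclidean_space) atlas \<Rightarrow>
   ('m \<Rightarrow> (nat \<Rightarrow> 'm tvec) \<Rightarrow> real) \<Rightarrow> 'm conn \<Rightarrow> bool" where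
  "preserves_vol A vol D \<longleftrightarrow>
     (\<forall>p. \<forall>v\<in>tangent_space A p. \<forall>Y. (\<forall>i<DIM('a). Y i \<in> fields_near A p) \<longrightarrow>
        v (\<lambda>q. vol q (\<lambda>i. Y i q)) =
        (\<Sum>i<DIM('a). vol p ((\<lambda>j. Y j p)(i := D p v (Y i)))))"


section \<open>Almost quaternionic skew-Hermitian structures\<close>

text \<open>\<open>Q p\<close> is the fibre at \<open>p\<close> of the subbundle of the endomorphism bundle.\<close>

definition admissible_basis ::
  "('m::topological_space, 'a::euclidean_space) atlas \<Rightarrow> ('m \<Rightarrow> 'm endo set) \<Rightarrow>
   'm set \<Rightarrow> (nat \<Rightarrow> 'm \<Rightarrow> 'm endo) \<Rightarrow> bool" where
  "admissible_basis A Q W J \<longleftrightarrow>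
     (\<forall>a\<in>{1,2,3}. endo_field_on A W (J a)) \<and>
     (\<forall>p\<in>W. Q p = span {J 1 p, J 2 p, J 3 p} \<and>
        (\<forall>v\<in>tangent_space A p.
           (\<forall>a\<in>{1,2,3}. J a p (J a p v) = - v) \<and>
           J 1 p (J 2 p v) = J 3 p v \<and> J 2 p (J 1 p v) = - J 3 p v))"

definition almost_quaternionic ::
  "('m::topological_space, 'a::euclidean_space) atlas \<Rightarrow> ('m \<Rightarrow> 'm endo set) \<Rightarrow> bool" where
  "almost_quaternionic A Q \<longleftrightarrow> (\<forall>p. \<exists>W J. p \<in> W \<and> admissible_basis A Q W J)"

definition almost_qsH ::
  "('m::topological_space, 'a::euclidean_space) atlas \<Rightarrow> ('m \<Rightarrow> 'm endo set) \<Rightarrow>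
   'm form2 \<Rightarrow> bool" where
  "almost_qsH A Q \<omega> \<longleftrightarrow>
     almost_quaternionic A Q \<and> two_form A \<omega> \<and> nondegenerate A \<omega> \<and>
     (\<forall>W J. admissible_basis A Q W J \<longrightarrow>
        (\<forall>p\<in>W. \<forall>v\<in>tangent_space A p. \<forall>w\<in>tangent_space A p. \<forall>a\<in>{1,2,3}.
           \<omega> p (J a p v) (J a p w) = \<omega> p v w))"

text \<open>For every local section \<open>J\<close> of \<open>Q\<close>, the endomorphism \<open>\<nabla>\<^sub>v J\<close>,
  \<open>Y \<mapsto> \<nabla>\<^sub>v (J Y) - J (\<nabla>\<^sub>v Y)\<close>, lies in \<open>Q\<close>.\<close>

definition preserves_Q ::
  "('m::topological_space, 'a::euclidean_space) atlas \<Rightarrow> ('m \<Rightarrow> 'm endo set) \<Rightarrow>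
   'm conn \<Rightarrow> bool" where
  "preserves_Q A Q D \<longleftrightarrow>
     (\<forall>W J. endo_field_on A W J \<longrightarrow> (\<forall>p\<in>W. J p \<in> Q p) \<longrightarrow>
        (\<forall>p\<in>W. \<forall>v\<in>tangent_space A p. \<exists>K\<in>Q p. \<forall>Y\<in>fields_near A p.
           D p v (apply_endo J Y) - J p (D p v Y) = K (Y p)))"

definition nijenhuis ::
  "('m::topological_space, 'a::euclidean_space) atlas \<Rightarrow> ('m \<Rightarrow> 'm endo) \<Rightarrow>
   'm vfield \<Rightarrow> 'm vfield \<Rightarrow> 'm vfield" where
  "nijenhuis A J X Y = (\<lambda>p.
     lie_bracket A (apply_endo J X) (apply_endo J Y) p
     - J p (lie_bracket A (apply_endo J X) Y p)
     - J p (lie_bracket A X (apply_endo J Y) p)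
     - lie_bracket A X Y p)"

text \<open>The torsion \<open>T\<^sup>H\<close> of the Obata connection of the admissible basis \<open>H = (J 1, J 2, J 3)\<close>,
  which is prescribed in terms of Nijenhuis tensors.\<close>

definition obata_torsion ::
  "('m::topological_space, 'a::euclidean_space) atlas \<Rightarrow> (nat \<Rightarrow> 'm \<Rightarrow> 'm endo) \<Rightarrow>
   'm vfield \<Rightarrow> 'm vfield \<Rightarrow> 'm vfield" where
  "obata_torsion A J X Y = (\<lambda>p. (1 / 6) *\<^sub>R (\<Sum>a\<in>{1,2,3}. nijenhuis A (J a) X Y p))"

text \<open>\<open>DIM('a)\<close> is the dimension \<open>4 n\<close> of the manifold.\<close>

definition oproiu_form ::
  "('m::topological_space, 'a::euclidean_space) atlas \<Rightarrow> (nat \<Rightarrow> 'm \<Rightarrow> 'm endo) \<Rightarrow>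
   nat \<Rightarrow> 'm \<Rightarrow> 'm tvec \<Rightarrow> real" where
  "oproiu_form A J a p v =
     trace_on (tangent_space A p) (\<lambda>w. J a p (tensor_at A (obata_torsion A J) p v w))
     / (real DIM('a) - 2)"

definition oproiu_torsion ::
  "('m::topological_space, 'a::euclidean_space) atlas \<Rightarrow> (nat \<Rightarrow> 'm \<Rightarrow> 'm endo) \<Rightarrow>
   'm vfield \<Rightarrow> 'm vfield \<Rightarrow> 'm vfield" where
  "oproiu_torsion A J X Y = (\<lambda>p. obata_torsion A J X Y p +
     (\<Sum>a\<in>{1,2,3}. oproiu_form A J a p (X p) *\<^sub>R J a p (Y p)
                  - oproiu_form A J a p (Y p) *\<^sub>R J a p (X p)))"

definition unimodular_oproiu ::
  "('m::topological_space, 'a::euclidean_space) atlas \<Rightarrow> ('m \<Rightarrow> 'm endo set) \<Rightarrow>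
   ('m \<Rightarrow> (nat \<Rightarrow> 'm tvec) \<Rightarrow> real) \<Rightarrow> 'm conn \<Rightarrow> bool" where
  "unimodular_oproiu A Q vol D \<longleftrightarrow>
     connection A D \<and> preserves_Q A Q D \<and> preserves_vol A vol D \<and>
     (\<forall>W J. admissible_basis A Q W J \<longrightarrow>
        (\<forall>p\<in>W. \<forall>X\<in>fields_near A p. \<forall>Y\<in>fields_near A p.
           torsion A D X Y p = oproiu_torsion A J X Y p))"

text \<open>The volume form \<open>\<omega>^(2n)\<close> of a \<open>4n\<close>-dimensional manifold.\<close>

definition vol_form ::
  "('m::topological_space, 'a::euclidean_space) atlas \<Rightarrow> 'm form2 \<Rightarrow>
   'm \<Rightarrow> (nat \<Rightarrow> 'm tvec) \<Rightarrow> real" where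
  "vol_form A \<omega> = wedge_power \<omega> (DIM('a) div 2)"

definition minimal_adapted ::
  "('m::topological_space, 'a::euclidean_space) atlas \<Rightarrow> ('m \<Rightarrow> 'm endo set) \<Rightarrow>
   'm form2 \<Rightarrow> 'm conn \<Rightarrow> bool" where
  "minimal_adapted A Q \<omega> D \<longleftrightarrow>
     connection A D \<and>
     (\<exists>D0. unimodular_oproiu A Q (vol_form A \<omega>) D0 \<and>
        (\<forall>p. \<forall>v\<in>tangent_space A p. \<forall>Y\<in>fields_near A p. \<forall>Z\<in>fields_near A p.
           \<omega> p (D p v Y - D0 p v Y) (Z p) = cov_deriv_form2 D0 \<omega> p v Y Z / 2))"

definition qsH_manifold ::
  "('m::topological_space, 'a::euclidean_space) atlas \<Rightarrow> ('m \<Rightarrow> 'm endo set) \<Rightarrow>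
   'm form2 \<Rightarrow> bool" where
  "qsH_manifold A Q \<omega> \<longleftrightarrow>
     almost_qsH A Q \<omega> \<and> (\<exists>D. minimal_adapted A Q \<omega> D \<and> torsion_free A D)"

text \<open>An \<open>SO\<^sup>*(2n)Sp(1)\<close>-structure is a pair \<open>(Q, \<omega>)\<close>; it is torsion-free if it admits a
  torsion-free adapted connection.\<close>

definition torsion_free_structure ::
  "('m::topological_space, 'a::euclidean_space) atlas \<Rightarrow> ('m \<Rightarrow> 'm endo set) \<Rightarrow>
   'm form2 \<Rightarrow> bool" where
  "torsion_free_structure A Q \<omega> \<longleftrightarrow>
     almost_qsH A Q \<omega> \<and>
     (\<exists>D. connection A D \<and> preserves_Q A Q D \<and> preserves_form2 A \<omega> D \<and> torsion_free A D)"


section \<open>Almost quaternionic submanifolds\<close>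

definition differential ::
  "('m::topological_space, 'a::euclidean_space) atlas \<Rightarrow> ('n \<Rightarrow> 'm) \<Rightarrow>
   'n \<Rightarrow> 'n tvec \<Rightarrow> 'm tvec" where
  "differential A h p v = (\<lambda>f. if f \<in> smooth_near A (h p) then v (f \<circ> h) else 0)"

definition submanifold ::
  "('n::topological_space, 'b::euclidean_space) atlas \<Rightarrow>
   ('m::topological_space, 'a::euclidean_space) atlas \<Rightarrow> ('n \<Rightarrow> 'm) \<Rightarrow> bool" where
  "submanifold B A h \<longleftrightarrow>
     smooth_map B A h \<and> inj h \<and> (\<forall>p. inj_on (differential A h p) (tangent_space B p))"

definition almost_quaternionic_submanifold ::
  "('n::topological_space, 'b::euclidean_space) atlas \<Rightarrow>
   ('m::topological_space, 'a::euclidean_space) atlas \<Rightarrow> ('n \<Rightarrow> 'm) \<Rightarrow>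
   ('m \<Rightarrow> 'm endo set) \<Rightarrow> bool" where
  "almost_quaternionic_submanifold B A h Q \<longleftrightarrow>
     submanifold B A h \<and>
     (\<forall>p. \<forall>J\<in>Q (h p). (\<forall>v\<in>tangent_space A (h p). J (J v) = - v) \<longrightarrow>
        J ` (differential A h p ` tangent_space B p) = differential A h p ` tangent_space B p)"

definition induced_Q ::
  "('n::topological_space, 'b::euclidean_space) atlas \<Rightarrow>
   ('m::topological_space, 'a::euclidean_space) atlas \<Rightarrow> ('n \<Rightarrow> 'm) \<Rightarrow>
   ('m \<Rightarrow> 'm endo set) \<Rightarrow> 'n \<Rightarrow> 'n endo set" where
  "induced_Q B A h Q p =
     {F \<in> tangent_endos B p. \<exists>J\<in>Q (h p). \<forall>v\<in>tangent_space B p.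
        differential A h p (F v) = J (differential A h p v)}"

definition pullback_form2 ::
  "('m::topological_space, 'a::euclidean_space) atlas \<Rightarrow> ('n \<Rightarrow> 'm) \<Rightarrow>
   'm form2 \<Rightarrow> 'n form2" where
  "pullback_form2 A h \<omega> p v w = \<omega> (h p) (differential A h p v) (differential A h p w)"

text \<open>\<open>D'\<close> is the restriction of \<open>D\<close> to the submanifold: \<open>D'\<^sub>v Y\<close> is the derivative of any
  local extension \<open>Z\<close> of \<open>Y\<close> to the ambient manifold.  For an immersion such an extension exists
  near every point of the submanifold.  In particular \<open>D\<close> takes values in the tangent
  spaces of the submanifold.\<close>

definition restricts_to ::
  "('n::topological_space, 'b::euclidean_space) atlas \<Rightarrow>
   ('m::topological_space, 'a::euclidean_space) atlas \<Rightarrow> ('n \<Rightarrow> 'm) \<Rightarrow>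
   'm conn \<Rightarrow> 'n conn \<Rightarrow> bool" where
  "restricts_to B A h D D' \<longleftrightarrow>
     (\<forall>p. \<forall>v\<in>tangent_space B p. \<forall>Y\<in>fields_near B p. \<forall>Z\<in>fields_near A (h p).
        (\<forall>\<^sub>F q in nhds p. Z (h q) = differential A h q (Y q)) \<longrightarrow>
        D (h p) (differential A h p v) Z = differential A h p (D' p v Y))"

end

theory Submission
  imports Defs
begin

text \<open>A connection \<open>\<nabla>\<close> that is torsion-free and preserves \<open>Q\<close> expresses the Nijenhuis tensors of an
  admissible basis through \<open>\<nabla> J\<^sub>a\<close>; the sum of these tensors has the form
  \<open>\<Sum>\<^sub>a \<partial>(\<theta>\<^sub>a \<otimes> J\<^sub>a)\<close>, and taking traces shows that Oproiu's correction cancels it, so that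
  \<open>T\<^sup>Q = 0\<close>.  Trace-free endomorphisms commuting with \<open>Q\<close> up to \<open>Q\<close> have no first prolongation,
  and the power of \<open>\<omega>\<close> defining \<open>vol\<close> vanishes nowhere.  Hence a torsion-free connection
  preserving \<open>Q\<close> and \<open>\<omega>\<close> is the only unimodular Oproiu connection and the only minimal
  adapted one.

  On the submanifold, the second fundamental form is symmetric and, modulo tangent vectors of \<open>N\<close>,
  commutes with \<open>J\<^sub>1, J\<^sub>2, J\<^sub>3\<close>.  So it changes sign when some \<open>J\<^sub>a\<close> is applied to both arguments,
  which is inconsistent with \<open>J\<^sub>3 = J\<^sub>1 J\<^sub>2\<close> unless it vanishes.  The ambient connection therefore restricts
  to a torsion-free connection on \<open>N\<close> preserving the induced structure, and the uniqueness
  statement on \<open>N\<close> identifies it with the minimal adapted connection.\<close>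

section \<open>Functions of class $C^k$ on open sets\<close>

text \<open>Two constants decide the algebra. In the traces that define Oproiu's forms,
  \<open>\<theta>\<^sub>a\<close> occurs with the dimension 4n, with -1 from a rank one part, and
  with another -1 because forms built from a skew matrix of connection forms satisfy
  \<open>\<theta>\<^sub>1 (J\<^sub>1 v) + \<theta>\<^sub>2 (J\<^sub>2 v) + \<theta>\<^sub>3
  (J\<^sub>3 v) = 0\<close>; this is the denominator 4n - 2. A symmetric tensor whose endomorphisms
  normalise \<open>Q\<close> is a quaternionic projective change given by one covector \<beta>; its
  trace is (4n + 4) \<beta>, so a preserved volume forces \<beta> to vanish. The analytic obstacle
  is that a field along the submanifold is not an ambient field, and that tangent vectors are
  derivations. Hadamard's lemma supplies coordinate frames, and the ambient connection is pulled
  back by expanding fields along the immersion in such frames. Smoothness on the submanifold is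
  recovered from smoothness of the image under the differential by solving an injective linear
  system over germs, in place of slice charts.\<close>

lemma Ck_on_cong:
  assumes "open S" "\<And>x. x \<in> S \<Longrightarrow> f x = g x"
  shows "Ck_on k S f \<longleftrightarrow> Ck_on k S g"
  using assms(2)
proof (induction k arbitrary: f g)
  case 0
  then show ?case by (simp cong: continuous_on_cong)
next
  case (Suc k)
  have d: "(f has_derivative D) (at x) \<longleftrightarrow> (g has_derivative D) (at x)" if "x \<in> S" for x D
    using has_derivative_transform_within_open[OF _ assms(1) that, of f D UNIV g]
      has_derivative_transform_within_open[OF _ assms(1) that, of g D UNIV f] Suc.prems by auto
  then have "frechet_derivative f (at x) = frechet_derivative g (at x)" if "x \<in> S" for x
    using that by (simp add: frechet_derivative_def)
  then have "Ck_on k S (\<lambda>x. frechet_derivative f (at x) v)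
      \<longleftrightarrow> Ck_on k S (\<lambda>x. frechet_derivative g (at x) v)" for v
    by (intro Suc.IH) simp
  moreover have "f differentiable (at x) \<longleftrightarrow> g differentiable (at x)" if "x \<in> S" for x
    using d that by (simp add: differentiable_def)
  ultimately show ?case by auto
qed

lemma Ck_on_subset: "Ck_on k S f \<Longrightarrow> T \<subseteq> S \<Longrightarrow> Ck_on k T f"
  by (induction k arbitrary: f) (auto intro: continuous_on_subset)

text \<open>Admits an explicit derivative where \<open>Ck_on\<close> speaks of the chosen
  \<open>frechet_derivative\<close>; most closure lemmas below enter through it.\<close>

lemma Ck_on_SucI:
  assumes "open S" "\<And>x. x \<in> S \<Longrightarrow> (f has_derivative f' x) (at x)"
    "\<And>v. Ck_on k S (\<lambda>x. f' x v)"
  shows "Ck_on (Suc k) S f"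
proof -
  have "frechet_derivative f (at x) = f' x" if "x \<in> S" for x
    using frechet_derivative_at[OF assms(2)[OF that]] by simp
  then have "Ck_on k S (\<lambda>x. frechet_derivative f (at x) v)" for v
    using Ck_on_cong[OF assms(1), of "\<lambda>x. frechet_derivative f (at x) v" "\<lambda>x. f' x v"] assms(3) by simp
  then show ?thesis using assms(2) by (auto simp: differentiable_def)
qed

lemma Ck_on_SucD:
  assumes "Ck_on (Suc k) S f"
  shows "x \<in> S \<Longrightarrow> (f has_derivative frechet_derivative f (at x)) (at x)"
    "Ck_on k S (\<lambda>x. frechet_derivative f (at x) v)"
  using assms by (auto simp: frechet_derivative_works)

lemma Ck_on_Suc_imp: "Ck_on (Suc k) S f \<Longrightarrow> Ck_on k S f"
proof (induction k arbitrary: f)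
  case 0
  then show ?case
    by (auto intro!: continuous_at_imp_continuous_on differentiable_imp_continuous_within)
next
  case (Suc k)
  then show ?case by (metis Ck_on.simps(2))
qed

lemma Ck_on_imp_continuous_on: "Ck_on k S f \<Longrightarrow> continuous_on S f"
  by (induction k) (auto dest: Ck_on_Suc_imp simp del: Ck_on.simps(2))

lemma Ck_on_local:
  assumes "\<And>x. x \<in> S \<Longrightarrow> \<exists>T. open T \<and> x \<in> T \<and> Ck_on k T f"
  shows "Ck_on k S f"
  using assms
proof (induction k arbitrary: f)
  case 0
  then show ?case
    by (auto intro!: continuous_at_imp_continuous_on)
       (metis at_within_open continuous_on_eq_continuous_within)
next
  case (Suc k)
  show ?case
    unfolding Ck_on.simps
  proof (intro conjI ballI allI)
    fix x assume "x \<in> S"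
    then show "f differentiable at x" using Suc.prems by fastforce
  next
    fix v show "Ck_on k S (\<lambda>x. frechet_derivative f (at x) v)"
      using Suc.prems by (intro Suc.IH) fastforce
  qed
qed

lemma Ck_on_const: "open S \<Longrightarrow> Ck_on k S (\<lambda>x. c)"
proof (induction k arbitrary: c)
  case (Suc k)
  then show ?case by (intro Ck_on_SucI[where f' = "\<lambda>x v. 0"]) auto
qed auto

lemma Ck_on_bounded_linear: "open S \<Longrightarrow> bounded_linear L \<Longrightarrow> Ck_on k S L"
proof (cases k)
  case (Suc k)
  assume "open S" "bounded_linear L"
  then show ?thesis unfolding Suc
    by (intro Ck_on_SucI[where f' = "\<lambda>x. L"]) (auto intro: Ck_on_const bounded_linear_imp_has_derivative)
qed (auto intro: linear_continuous_on)

lemma Ck_on_add: "open S \<Longrightarrow> Ck_on k S f \<Longrightarrow> Ck_on k S g \<Longrightarrow> Ck_on k S (\<lambda>x. f x + g x)"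
proof (induction k arbitrary: f g)
  case (Suc k)
  show ?case
    using Suc Ck_on_SucD[OF Suc.prems(2)] Ck_on_SucD[OF Suc.prems(3)]
    by (intro Ck_on_SucI[where f' = "\<lambda>x v. frechet_derivative f (at x) v + frechet_derivative g (at x) v"])
       (auto intro!: derivative_eq_intros)
qed (auto intro: continuous_on_add)

lemma Ck_on_linear_comp:
  "open S \<Longrightarrow> bounded_linear L \<Longrightarrow> Ck_on k S f \<Longrightarrow> Ck_on k S (\<lambda>x. L (f x))"
proof (induction k arbitrary: f)
  case (Suc k)
  show ?case
    using Suc Ck_on_SucD[OF Suc.prems(3)]
    by (intro Ck_on_SucI[where f' = "\<lambda>x v. L (frechet_derivative f (at x) v)"])
       (auto intro: bounded_linear.has_derivative)
qed (auto intro: bounded_linear.continuous_on)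

lemma Ck_on_mult:
  fixes f g :: "'a::real_normed_vector \<Rightarrow> real"
  shows "open S \<Longrightarrow> Ck_on k S f \<Longrightarrow> Ck_on k S g \<Longrightarrow> Ck_on k S (\<lambda>x. f x * g x)"
proof (induction k arbitrary: f g)
  case (Suc k)
  show ?case
    using Suc.prems Ck_on_SucD[OF Suc.prems(2)] Ck_on_SucD[OF Suc.prems(3)]
      Ck_on_Suc_imp[OF Suc.prems(2)] Ck_on_Suc_imp[OF Suc.prems(3)]
    by (intro Ck_on_SucI[where f' = "\<lambda>x v. f x * frechet_derivative g (at x) v + frechet_derivative f (at x) v * g x"])
       (auto intro!: derivative_eq_intros Ck_on_add Suc.IH)
qed (auto intro: continuous_on_mult)

lemma Ck_on_sum:
  "open S \<Longrightarrow> (\<And>i. i \<in> I \<Longrightarrow> Ck_on k S (f i)) \<Longrightarrow> Ck_on k S (\<lambda>x. \<Sum>i\<in>I. f i x)"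
  by (induction I rule: infinite_finite_induct) (auto intro: Ck_on_const Ck_on_add)

lemma Ck_on_inverse:
  fixes f :: "'a::real_normed_vector \<Rightarrow> real"
  assumes "open S" "\<And>x. x \<in> S \<Longrightarrow> f x \<noteq> 0"
  shows "Ck_on k S f \<Longrightarrow> Ck_on k S (\<lambda>x. inverse (f x))"
proof (induction k)
  case (Suc k)
  have m: "Ck_on k S (\<lambda>x. -1 * (inverse (f x) * frechet_derivative f (at x) v * inverse (f x)))" for v
    using assms Suc.IH[OF Ck_on_Suc_imp[OF Suc.prems]] Ck_on_SucD[OF Suc.prems]
    by (intro Ck_on_mult Ck_on_const)
  show ?case
    using assms Ck_on_SucD[OF Suc.prems] m
    by (intro Ck_on_SucI[where f' = "\<lambda>x v. - (inverse (f x) * frechet_derivative f (at x) v * inverse (f x))"])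
       (auto intro!: derivative_eq_intros)
qed (use assms in \<open>auto intro: continuous_on_inverse\<close>)

text \<open>The derivative \<open>Df (g x) (Dg x v)\<close> varies in base point and direction at
  once. Expanding the direction in \<open>Basis\<close> turns it into a sum of products of scalar
  functions, so that the induction hypothesis applies to the partial derivatives of
  \<open>f\<close>.\<close>

lemma Ck_on_compose:
  fixes f :: "'a::euclidean_space \<Rightarrow> real" and g :: "'c::real_normed_vector \<Rightarrow> 'a"
  assumes S: "open S" "\<And>x. x \<in> S \<Longrightarrow> g x \<in> T"
  shows "Ck_on k T f \<Longrightarrow> Ck_on k S g \<Longrightarrow> Ck_on k S (\<lambda>x. f (g x))"
proof (induction k arbitrary: f)
  case 0
  then show ?case using S by (auto intro: continuous_on_compose2)
next
  case (Suc k)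
  let ?f' = "\<lambda>x. frechet_derivative f (at x)" and ?g' = "\<lambda>x. frechet_derivative g (at x)"
  note f = Ck_on_SucD[OF Suc.prems(1)] and g = Ck_on_SucD[OF Suc.prems(2)]
  have exp: "?f' (g x) (?g' x v) = (\<Sum>b\<in>Basis. (?g' x v \<bullet> b) * ?f' (g x) b)" if "x \<in> S" for x v
  proof -
    interpret linear "?f' (g x)" using f(1) S(2) that has_derivative_linear by blast
    have "?f' (g x) (?g' x v) = ?f' (g x) (\<Sum>b\<in>Basis. (?g' x v \<bullet> b) *\<^sub>R b)" by (simp only: euclidean_representation)
    then show ?thesis by (simp only: sum scale real_scaleR_def)
  qed
  have "Ck_on k S (\<lambda>x. \<Sum>b\<in>Basis. (?g' x v \<bullet> b) * ?f' (g x) b)" for v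
    using S(1) g(2) Suc.IH[OF f(2) Ck_on_Suc_imp[OF Suc.prems(2)]]
    by (intro Ck_on_sum Ck_on_mult Ck_on_linear_comp[OF _ bounded_linear_inner_left])
  then have "Ck_on k S (\<lambda>x. ?f' (g x) (?g' x v))" for v
    using Ck_on_cong[OF S(1), of "\<lambda>x. ?f' (g x) (?g' x v)"
        "\<lambda>x. \<Sum>b\<in>Basis. (?g' x v \<bullet> b) * ?f' (g x) b" k] exp by simp
  moreover have "((\<lambda>x. f (g x)) has_derivative (\<lambda>v. ?f' (g x) (?g' x v))) (at x)" if "x \<in> S" for x
    using has_derivative_compose[OF g(1)[OF that]] f(1) S(2) that by blast
  ultimately show ?case using S(1) by (intro Ck_on_SucI)
qed

text \<open>Differentiating under the integral replaces \<open>F\<close> by a directional derivative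
  and, by the chain rule, brings out one more factor \<open>t\<close>. The power
  \<open>t ^ j\<close> makes the statement stable under this step; Hadamard's lemma takes
  \<open>j = 0\<close>.\<close>

lemma Ck_on_radial_integral:
  fixes F :: "'a::euclidean_space \<Rightarrow> real"
  assumes "open S" "convex S" "x0 \<in> S"
  shows "Ck_on k S F \<Longrightarrow> Ck_on k S (\<lambda>x. integral (cbox 0 1) (\<lambda>t. t ^ j * F (x0 + t *\<^sub>R (x - x0))))"
proof (induction k arbitrary: F j)
  have inS: "x0 + t *\<^sub>R (x - x0) \<in> S" if "x \<in> S" "t \<in> cbox 0 1" for x and t :: real
    using that assms convexD_alt[OF assms(2,3) that(1), of t] by (auto simp: algebra_simps)
  have cont: "continuous_on (S \<times> cbox 0 1) (\<lambda>(x, t). t ^ j * F (x0 + t *\<^sub>R (x - x0)))"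
    if "continuous_on S F" for F :: "'a \<Rightarrow> real" and j
    unfolding split_beta using inS
    by (intro continuous_intros continuous_on_compose2[OF that]) auto
  {
    case 0
    then show ?case using integral_continuous_on_param[OF cont] by simp
  next
    case (Suc k)
    note F = Ck_on_SucD[OF Suc.prems]
    let ?F' = "\<lambda>x. frechet_derivative F (at x)"
    \<comment> \<open>\<open>leibniz_rule\<close> asks for the derivative as a bounded linear
      function that depends continuously on both variables, hence \<open>Blinfun\<close>.\<close>
    define fx where "fx x t = Blinfun (\<lambda>v. t ^ Suc j * ?F' (x0 + t *\<^sub>R (x - x0)) v)" for x t
    have bl: "bounded_linear (\<lambda>v. t ^ Suc j * ?F' (x0 + t *\<^sub>R (x - x0)) v)" if "x \<in> S" "t \<in> cbox 0 1" for x t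
      using has_derivative_bounded_linear[OF F(1)[OF inS[OF that]]] by (rule bounded_linear_mult_right[THEN bounded_linear_compose])
    have app: "blinfun_apply (fx x t) = (\<lambda>v. t ^ Suc j * ?F' (x0 + t *\<^sub>R (x - x0)) v)" if "x \<in> S" "t \<in> cbox 0 1" for x t
      unfolding fx_def using bounded_linear_Blinfun_apply[OF bl[OF that]] .
    have der: "((\<lambda>x. t ^ j * F (x0 + t *\<^sub>R (x - x0))) has_derivative blinfun_apply (fx x t)) (at x within S)"
      if "x \<in> S" "t \<in> cbox 0 1" for x t
    proof -
      have l: "linear (?F' (x0 + t *\<^sub>R (x - x0)))" using has_derivative_linear[OF F(1)[OF inS[OF that]]] .
      have "((\<lambda>x. F (x0 + t *\<^sub>R (x - x0))) has_derivative (\<lambda>v. ?F' (x0 + t *\<^sub>R (x - x0)) (t *\<^sub>R v))) (at x)"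
        by (rule has_derivative_compose[where f = "\<lambda>x. x0 + t *\<^sub>R (x - x0)" and g = F,
              OF _ F(1)[OF inS[OF that]]]) (auto intro!: derivative_eq_intros)
      then have "((\<lambda>x. t ^ j * F (x0 + t *\<^sub>R (x - x0))) has_derivative
          (\<lambda>v. t ^ j * ?F' (x0 + t *\<^sub>R (x - x0)) (t *\<^sub>R v))) (at x)"
        by (rule has_derivative_mult_right)
      then show ?thesis using app[OF that] linear_cmul[OF l]
        by (simp add: has_derivative_at_withinI ac_simps)
    qed
    have cfx: "continuous_on (S \<times> cbox 0 1) (\<lambda>(x, t). fx x t)"
    proof (rule continuous_on_blinfun_componentwise)
      fix i :: 'a
      have "continuous_on (S \<times> cbox 0 1) (\<lambda>(x, t). t ^ Suc j * ?F' (x0 + t *\<^sub>R (x - x0)) i)"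
        using cont[OF Ck_on_imp_continuous_on[OF F(2)]] .
      then show "continuous_on (S \<times> cbox 0 1) (\<lambda>x. blinfun_apply (case x of (x, t) \<Rightarrow> fx x t) i)"
        by (rule continuous_on_eq) (auto simp: app)
    qed
    have int: "(\<lambda>t. t ^ j * F (x0 + t *\<^sub>R (x - x0))) integrable_on cbox 0 1" if "x \<in> S" for x
      using cont[OF Ck_on_imp_continuous_on[OF Suc.prems], of j] that
      by (intro integrable_continuous) (rule continuous_on_compose2[where g = "\<lambda>(x,t). t ^ j * F (x0 + t *\<^sub>R (x - x0))" and f = "\<lambda>t. (x,t)", simplified], auto intro!: continuous_intros)
    have intf: "fx x integrable_on cbox 0 1" if "x \<in> S" for x
      using that
      by (intro integrable_continuous) (rule continuous_on_compose2[OF cfx, where f = "\<lambda>t. (x,t)", simplified], auto intro!: continuous_intros)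
    have hd: "((\<lambda>x. integral (cbox 0 1) (\<lambda>t. t ^ j * F (x0 + t *\<^sub>R (x - x0)))) has_derivative
        blinfun_apply (integral (cbox 0 1) (fx x))) (at x)" if "x \<in> S" for x
      using leibniz_rule[OF der int cfx that assms(2)] at_within_open[OF that assms(1)] by simp
    have ap: "blinfun_apply (integral (cbox 0 1) (fx x)) v =
      integral (cbox 0 1) (\<lambda>t. t ^ Suc j * ?F' (x0 + t *\<^sub>R (x - x0)) v)" if "x \<in> S" for x v
    proof -
      have "blinfun_apply (integral (cbox 0 1) (fx x)) v = integral (cbox 0 1) (\<lambda>t. blinfun_apply (fx x t) v)"
        using integral_linear[OF intf[OF that] blinfun.bounded_linear_left, of v] by (simp add: o_def)
      also have "\<dots> = integral (cbox 0 1) (\<lambda>t. t ^ Suc j * ?F' (x0 + t *\<^sub>R (x - x0)) v)"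
        using app[OF that] by (intro integral_cong) simp
      finally show ?thesis .
    qed
    have "((\<lambda>x. integral (cbox 0 1) (\<lambda>t. t ^ j * F (x0 + t *\<^sub>R (x - x0)))) has_derivative
       (\<lambda>v. integral (cbox 0 1) (\<lambda>t. t ^ Suc j * ?F' (x0 + t *\<^sub>R (x - x0)) v))) (at x)" if "x \<in> S" for x
      using has_derivative_eq_rhs[OF hd[OF that] ext[OF ap[OF that]]] .
    then show ?case
      using Suc.IH[OF F(2), of "Suc j"] assms(1) by (intro Ck_on_SucI)
  }
qed

section \<open>Smoothness at a point of a Euclidean space\<close>

definition smooth_at :: "'a::real_normed_vector \<Rightarrow> ('a \<Rightarrow> 'b::real_normed_vector) \<Rightarrow> bool" where
  "smooth_at x f \<longleftrightarrow> (\<exists>T. open T \<and> x \<in> T \<and> smooth_on T f)"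

lemma smooth_on_subset: "smooth_on S f \<Longrightarrow> T \<subseteq> S \<Longrightarrow> smooth_on T f"
  unfolding smooth_on_def by (blast intro: Ck_on_subset)

lemma smooth_on_iff: "open S \<Longrightarrow> smooth_on S f \<longleftrightarrow> (\<forall>x\<in>S. smooth_at x f)"
  unfolding smooth_at_def
proof
  assume "\<forall>x\<in>S. \<exists>T. open T \<and> x \<in> T \<and> smooth_on T f"
  then have "\<exists>T. open T \<and> x \<in> T \<and> Ck_on k T f" if "x \<in> S" for x k
    using that unfolding smooth_on_def by blast
  then show "smooth_on S f" unfolding smooth_on_def using Ck_on_local by metis
qed blast

lemma smooth_at_eventually: "smooth_at x f \<Longrightarrow> \<forall>\<^sub>F y in nhds x. smooth_at y f"
  unfolding smooth_at_def eventually_nhds by blast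

lemma smooth_at_cong:
  assumes "smooth_at x f" "\<forall>\<^sub>F y in nhds x. f y = g y"
  shows "smooth_at x g"
proof -
  obtain T U where "open T" "x \<in> T" "smooth_on T f" "open U" "x \<in> U" "\<And>y. y \<in> U \<Longrightarrow> f y = g y"
    using assms unfolding smooth_at_def eventually_nhds by blast
  then have "open (T \<inter> U)" "x \<in> T \<inter> U" "smooth_on (T \<inter> U) f" "\<And>y. y \<in> T \<inter> U \<Longrightarrow> f y = g y"
    by (auto intro: smooth_on_subset)
  then show ?thesis unfolding smooth_at_def smooth_on_def by (metis Ck_on_cong)
qed

lemma smooth_at_Int:
  assumes "smooth_at x f" "smooth_at x g"
  obtains T where "open T" "x \<in> T" "smooth_on T f" "smooth_on T g"
  using assms unfolding smooth_at_def
  by (metis IntI inf.cobounded1 inf.cobounded2 open_Int smooth_on_subset)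

lemma smooth_at_const: "smooth_at x (\<lambda>x. c)"
  unfolding smooth_at_def smooth_on_def using Ck_on_const open_UNIV by blast

lemma smooth_at_bounded_linear: "bounded_linear L \<Longrightarrow> smooth_at x L"
  unfolding smooth_at_def smooth_on_def using Ck_on_bounded_linear open_UNIV by blast

lemma smooth_at_add: "smooth_at x f \<Longrightarrow> smooth_at x g \<Longrightarrow> smooth_at x (\<lambda>x. f x + g x)"
  by (erule (1) smooth_at_Int) (auto simp: smooth_at_def smooth_on_def intro!: Ck_on_add)

lemma smooth_at_mult:
  fixes f g :: "'a::real_normed_vector \<Rightarrow> real"
  shows "smooth_at x f \<Longrightarrow> smooth_at x g \<Longrightarrow> smooth_at x (\<lambda>x. f x * g x)"
  by (erule (1) smooth_at_Int) (auto simp: smooth_at_def smooth_on_def intro!: Ck_on_mult)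

lemma smooth_at_differentiable: "smooth_at x f \<Longrightarrow> f differentiable (at x)"
  unfolding smooth_at_def smooth_on_def by (metis Ck_on.simps(2))

lemma smooth_at_isCont: "smooth_at x f \<Longrightarrow> isCont f x"
  using smooth_at_differentiable differentiable_imp_continuous_within by blast

lemma smooth_at_derivative: "smooth_at x f \<Longrightarrow> smooth_at x (\<lambda>x. frechet_derivative f (at x) v)"
  unfolding smooth_at_def smooth_on_def by (metis Ck_on.simps(2))

lemma smooth_at_inverse:
  fixes f :: "'a::real_normed_vector \<Rightarrow> real"
  assumes "smooth_at x f" "f x \<noteq> 0"
  shows "smooth_at x (\<lambda>x. inverse (f x))"
proof -
  obtain T where T: "open T" "x \<in> T" "smooth_on T f" using assms unfolding smooth_at_def by blast
  have "\<forall>\<^sub>F y in nhds x. f y \<noteq> 0"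
    using smooth_at_isCont[OF assms(1)] assms(2) by (simp add: continuous_within tendsto_imp_eventually_ne eventually_nhds_conv_at)
  then obtain U where "open U" "x \<in> U" "\<And>y. y \<in> U \<Longrightarrow> f y \<noteq> 0" unfolding eventually_nhds by blast
  then have "open (T \<inter> U)" "x \<in> T \<inter> U" "smooth_on (T \<inter> U) (\<lambda>x. inverse (f x))"
    using T unfolding smooth_on_def by (auto intro!: Ck_on_inverse intro: Ck_on_subset)
  then show ?thesis unfolding smooth_at_def by blast
qed

lemma smooth_at_compose:
  fixes f :: "'a::euclidean_space \<Rightarrow> real" and g :: "'c::real_normed_vector \<Rightarrow> 'a"
  assumes "smooth_at (g x) f" "smooth_at x g"
  shows "smooth_at x (\<lambda>x. f (g x))"
proof -
  obtain T where T: "open T" "g x \<in> T" "smooth_on T f" using assms unfolding smooth_at_def by blast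
  obtain U where U: "open U" "x \<in> U" "smooth_on U g" using assms unfolding smooth_at_def by blast
  have "\<forall>\<^sub>F y in nhds x. g y \<in> T"
    using smooth_at_isCont[OF assms(2)] T by (simp add: continuous_within topological_tendstoD eventually_nhds_conv_at)
  then obtain V where V: "open V" "x \<in> V" "\<And>y. y \<in> V \<Longrightarrow> g y \<in> T" unfolding eventually_nhds by blast
  have "Ck_on k (U \<inter> V) (\<lambda>x. f (g x))" for k
  proof (rule Ck_on_compose[where T = T])
    show "open (U \<inter> V)" using U V by blast
    show "g y \<in> T" if "y \<in> U \<inter> V" for y using that V by blast
    show "Ck_on k T f" using T unfolding smooth_on_def by blast
    show "Ck_on k (U \<inter> V) g" using U unfolding smooth_on_def by (metis Ck_on_subset inf_le1)
  qed
  then have "open (U \<inter> V)" "x \<in> U \<inter> V" "smooth_on (U \<inter> V) (\<lambda>x. f (g x))"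
    using U V unfolding smooth_on_def by blast+
  then show ?thesis unfolding smooth_at_def by blast
qed

text \<open>The functions \<open>g b\<close> are \<open>\<integral>\<^sub>0\<^sup>1 \<partial>\<^sub>b f (x0 + t (x - x0)) dt\<close>.\<close>

lemma smooth_at_Hadamard:
  fixes f :: "'a::euclidean_space \<Rightarrow> real"
  assumes "smooth_at x0 f"
  shows "\<exists>g. (\<forall>b. smooth_at x0 (g b) \<and> g b x0 = frechet_derivative f (at x0) b) \<and>
    (\<forall>\<^sub>F x in nhds x0. f x = f x0 + (\<Sum>b\<in>Basis. ((x - x0) \<bullet> b) * g b x))"
proof -
  obtain T where T: "open T" "x0 \<in> T" "smooth_on T f" using assms unfolding smooth_at_def by blast
  then obtain e where e: "e > 0" "ball x0 e \<subseteq> T" using open_contains_ball by blast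
  let ?S = "ball x0 e"
  have S: "smooth_on ?S f" using T e smooth_on_subset by blast
  have C1: "Ck_on (Suc 0) ?S f" using S unfolding smooth_on_def by blast
  note F = Ck_on_SucD[OF C1]
  define g where "g b x = integral (cbox 0 1) (\<lambda>t::real. frechet_derivative f (at (x0 + t *\<^sub>R (x - x0))) b)" for b x
  have "Ck_on k ?S (g b)" for k b
  proof -
    have "Ck_on k ?S (\<lambda>x. frechet_derivative f (at x) b)"
      using S unfolding smooth_on_def by (metis Ck_on.simps(2))
    from Ck_on_radial_integral[OF _ _ _ this, of x0 0] e show ?thesis unfolding g_def by simp
  qed
  then have g1: "smooth_at x0 (g b)" for b
    unfolding smooth_at_def smooth_on_def using e open_ball centre_in_ball by metis
  have g2: "g b x0 = frechet_derivative f (at x0) b" for b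
    unfolding g_def by simp
  have "f x = f x0 + (\<Sum>b\<in>Basis. ((x - x0) \<bullet> b) * g b x)" if x: "x \<in> ?S" for x
  proof -
    have inS: "x0 + t *\<^sub>R (x - x0) \<in> ?S" if "t \<in> {0..1}" for t :: real
      using that x e convexD_alt[OF convex_ball[of x0 e] centre_in_ball[THEN iffD2] x, of t] by (auto simp: algebra_simps)
    let ?f' = "\<lambda>t. frechet_derivative f (at (x0 + t *\<^sub>R (x - x0)))"
    have "((\<lambda>t. f (x0 + t *\<^sub>R (x - x0))) has_vector_derivative ?f' t (x - x0)) (at t within {0..1})"
      if "t \<in> {0..1}" for t :: real
    proof -
      have "((\<lambda>t. f (x0 + t *\<^sub>R (x - x0))) has_derivative (\<lambda>s. ?f' t (s *\<^sub>R (x - x0)))) (at t)"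
        by (rule has_derivative_compose[where f = "\<lambda>t. x0 + t *\<^sub>R (x - x0)" and g = f, OF _ F(1)[OF inS[OF that]]])
          (auto intro!: derivative_eq_intros)
      then show ?thesis
        using linear_cmul[OF has_derivative_linear[OF F(1)[OF inS[OF that]]]]
        unfolding has_vector_derivative_def by (simp add: has_derivative_at_withinI)
    qed
    from fundamental_theorem_of_calculus[OF _ this]
    have "((\<lambda>t. ?f' t (x - x0)) has_integral f x - f x0) (cbox 0 1)" by simp
    moreover have "((\<lambda>t. \<Sum>b\<in>Basis. ((x - x0) \<bullet> b) * ?f' t b) has_integral (\<Sum>b\<in>Basis. ((x - x0) \<bullet> b) * g b x)) (cbox 0 1)"
    proof (intro has_integral_sum finite_Basis has_integral_mult_right)
      fix b :: 'a assume "b \<in> Basis"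
      have "continuous_on {0..1} (\<lambda>t. ?f' t b)"
        using inS by (intro continuous_on_compose2[OF Ck_on_imp_continuous_on[OF F(2)]]) (auto intro!: continuous_intros)
      then show "((\<lambda>t. ?f' t b) has_integral g b x) (cbox 0 1)"
        unfolding g_def by (auto intro!: integrable_integral integrable_continuous_interval)
    qed
    then have "((\<lambda>t. ?f' t (x - x0)) has_integral (\<Sum>b\<in>Basis. ((x - x0) \<bullet> b) * g b x)) (cbox 0 1)"
    proof (rule has_integral_eq[rotated])
      fix t :: real assume "t \<in> cbox 0 1"
      then have l: "linear (?f' t)" using inS[of t] F(1) has_derivative_linear by auto
      have "?f' t (x - x0) = ?f' t (\<Sum>b\<in>Basis. ((x - x0) \<bullet> b) *\<^sub>R b)" by (simp only: euclidean_representation)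
      also have "\<dots> = (\<Sum>b\<in>Basis. ((x - x0) \<bullet> b) * ?f' t b)"
        using l by (simp only: linear_sum linear_cmul real_scaleR_def)
      finally show "(\<Sum>b\<in>Basis. ((x - x0) \<bullet> b) * ?f' t b) = ?f' t (x - x0)" by simp
    qed
    ultimately have "f x - f x0 = (\<Sum>b\<in>Basis. ((x - x0) \<bullet> b) * g b x)" by (rule has_integral_unique)
    then show ?thesis by simp
  qed
  then have "\<forall>\<^sub>F x in nhds x0. f x = f x0 + (\<Sum>b\<in>Basis. ((x - x0) \<bullet> b) * g b x)"
    using eventually_nhds_in_open[OF open_ball centre_in_ball[THEN iffD2, OF e(1)]] by (rule eventually_mono[rotated])
  with g1 g2 show ?thesis by blast
qed

section \<open>Germs of functions, derivations and vector fields\<close>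

locale manifold =
  fixes A :: "('m::{t2_space,second_countable_topology}, 'a::euclidean_space) atlas"
  assumes mfd: "smooth_manifold A"
begin

abbreviation "\<C> \<equiv> smooth_near A"
abbreviation "\<T> \<equiv> tangent_space A"
abbreviation "\<X> \<equiv> fields_near A"

lemma chart_at: obtains U \<phi> where "(U, \<phi>) \<in> A" "p \<in> U"
  using mfd unfolding smooth_manifold_def by blast

context
  fixes U \<phi> assumes chart: "(U, \<phi>) \<in> A"
begin

lemma chart_open: "open U" "open (\<phi> ` U)"
  using mfd chart unfolding smooth_manifold_def by blast+

lemma chart_homeo: "homeomorphism U (\<phi> ` U) \<phi> (inv_into U \<phi>)"
  using mfd chart unfolding smooth_manifold_def by blast

lemma chart_inv: "q \<in> U \<Longrightarrow> inv_into U \<phi> (\<phi> q) = q"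
  using chart_homeo by (simp add: homeomorphism_def)

lemma chart_tendsto:
  assumes "p \<in> U"
  shows "filterlim \<phi> (nhds (\<phi> p)) (nhds p)" "filterlim (inv_into U \<phi>) (nhds p) (nhds (\<phi> p))"
proof -
  have "isCont \<phi> p" "isCont (inv_into U \<phi>) (\<phi> p)"
    using chart_homeo chart_open assms
    by (auto simp: homeomorphism_def continuous_on_eq_continuous_at)
  then have "(\<phi> \<longlongrightarrow> \<phi> p) (nhds p)" "(inv_into U \<phi> \<longlongrightarrow> inv_into U \<phi> (\<phi> p)) (nhds (\<phi> p))"
    by (simp_all only: isCont_def tendsto_at_iff_tendsto_nhds)
  then show "filterlim \<phi> (nhds (\<phi> p)) (nhds p)" "filterlim (inv_into U \<phi>) (nhds p) (nhds (\<phi> p))"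
    using chart_inv[OF assms] by simp_all
qed

lemma chart_eventually:
  assumes "p \<in> U"
  shows "(\<forall>\<^sub>F y in nhds (\<phi> p). P (inv_into U \<phi> y)) \<longleftrightarrow> (\<forall>\<^sub>F q in nhds p. P q)"
proof
  assume "\<forall>\<^sub>F y in nhds (\<phi> p). P (inv_into U \<phi> y)"
  then have "\<forall>\<^sub>F q in nhds p. P (inv_into U \<phi> (\<phi> q))"
    using chart_tendsto(1)[OF assms] unfolding filterlim_iff by blast
  moreover have "\<forall>\<^sub>F q in nhds p. q \<in> U" using chart_open assms eventually_nhds_in_open by blast
  ultimately show "\<forall>\<^sub>F q in nhds p. P q" by eventually_elim (simp add: chart_inv)
qed (use chart_tendsto(2)[OF assms] in \<open>simp add: filterlim_iff\<close>)

lemma open_chart_image: assumes "open W" shows "open (\<phi> ` (U \<inter> W))"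
proof -
  have "openin (top_of_set (\<phi> ` U)) (\<phi> ` (U \<inter> W))"
    using homeomorphism_imp_open_map[OF chart_homeo] chart_open assms by blast
  then show ?thesis using chart_open openin_open_trans by blast
qed

text \<open>\<open>smooth_near\<close> tests every chart of the atlas. One chart around
  \<open>p\<close> suffices, because smoothness at a point spreads to a neighbourhood and the
  transition maps carry it to the other charts.\<close>

lemma smooth_near_chart:
  assumes "p \<in> U"
  shows "f \<in> \<C> p \<longleftrightarrow> smooth_at (\<phi> p) (f \<circ> inv_into U \<phi>)"
proof
  assume "f \<in> \<C> p"
  then obtain W where "p \<in> W" "open W" "smooth_on (\<phi> ` (U \<inter> W)) (f \<circ> inv_into U \<phi>)"
    using chart unfolding smooth_near_def smooth_fun_on_def by blast
  then show "smooth_at (\<phi> p) (f \<circ> inv_into U \<phi>)"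
    unfolding smooth_at_def using open_chart_image assms by blast
next
  assume "smooth_at (\<phi> p) (f \<circ> inv_into U \<phi>)"
  then have "\<forall>\<^sub>F q in nhds p. smooth_at (\<phi> q) (f \<circ> inv_into U \<phi>)"
    using smooth_at_eventually chart_tendsto(1)[OF assms] unfolding filterlim_iff by blast
  then have "\<forall>\<^sub>F q in nhds p. q \<in> U \<and> smooth_at (\<phi> q) (f \<circ> inv_into U \<phi>)"
    using chart_open assms eventually_nhds_in_open eventually_conj by blast
  then obtain W where W: "open W" "p \<in> W" "W \<subseteq> U" "\<And>q. q \<in> W \<Longrightarrow> smooth_at (\<phi> q) (f \<circ> inv_into U \<phi>)"
    unfolding eventually_nhds by blast
  have "smooth_on (\<psi> ` (V' \<inter> W)) (f \<circ> inv_into V' \<psi>)" if c': "(V', \<psi>) \<in> A" for V' \<psi>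
  proof -
    have inv: "inv_into V' \<psi> (\<psi> q) = q" if "q \<in> V'" for q
      using mfd c' that unfolding smooth_manifold_def homeomorphism_def by blast
    have op: "open (\<psi> ` (V' \<inter> X))" if "open X" for X
    proof -
      have "homeomorphism V' (\<psi> ` V') \<psi> (inv_into V' \<psi>)" "open (\<psi> ` V')" "open V'"
        using mfd c' unfolding smooth_manifold_def by blast+
      then show ?thesis
        using homeomorphism_imp_open_map[of V' "\<psi> ` V'" \<psi> "inv_into V' \<psi>" "V' \<inter> X"] that openin_open_trans by blast
    qed
    have trans: "smooth_on (\<psi> ` (V' \<inter> U)) (\<phi> \<circ> inv_into V' \<psi>)"
      using mfd c' chart unfolding smooth_manifold_def by blast
    have "smooth_at y (f \<circ> inv_into V' \<psi>)" if y: "y \<in> \<psi> ` (V' \<inter> W)" for y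
    proof -
      obtain q where q: "q \<in> V'" "q \<in> W" "y = \<psi> q" using y by blast
      have 1: "smooth_at y (\<phi> \<circ> inv_into V' \<psi>)"
        using trans op[OF chart_open(1)] smooth_on_iff q W(3) by blast
      have "smooth_at y (\<lambda>z. (f \<circ> inv_into U \<phi>) ((\<phi> \<circ> inv_into V' \<psi>) z))"
        by (rule smooth_at_compose[OF _ 1]) (use W(4)[OF q(2)] q(3) inv[OF q(1)] in \<open>simp add: comp_def\<close>)
      moreover have "\<forall>\<^sub>F z in nhds y. z \<in> \<psi> ` (V' \<inter> W)"
        using op[OF W(1)] y eventually_nhds_in_open by blast
      then have "\<forall>\<^sub>F z in nhds y. (f \<circ> inv_into U \<phi>) ((\<phi> \<circ> inv_into V' \<psi>) z) = (f \<circ> inv_into V' \<psi>) z"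
        using W(3) by (auto elim!: eventually_mono simp: inv chart_inv subset_iff)
      ultimately show ?thesis by (rule smooth_at_cong)
    qed
    then show ?thesis using smooth_on_iff op W(1) by blast
  qed
  then show "f \<in> \<C> p" using W unfolding smooth_near_def smooth_fun_on_def by blast
qed

end

lemma smooth_fun_on_iff: "smooth_fun_on A W f \<longleftrightarrow> open W \<and> (\<forall>p\<in>W. f \<in> \<C> p)"
proof
  assume r: "open W \<and> (\<forall>p\<in>W. f \<in> \<C> p)"
  have "smooth_on (\<phi> ` (U \<inter> W)) (f \<circ> inv_into U \<phi>)" if "(U, \<phi>) \<in> A" for U \<phi>
    using smooth_on_iff[OF open_chart_image[OF that]] smooth_near_chart[OF that] r by blast
  with r show "smooth_fun_on A W f" unfolding smooth_fun_on_def by blast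
qed (auto simp: smooth_near_def smooth_fun_on_def)

lemma C_eventually: "f \<in> \<C> p \<Longrightarrow> \<forall>\<^sub>F q in nhds p. f \<in> \<C> q"
  unfolding smooth_near_def eventually_nhds smooth_fun_on_def by blast

lemma C_cong: assumes "f \<in> \<C> p" "\<forall>\<^sub>F q in nhds p. f q = g q" shows "g \<in> \<C> p"
proof -
  obtain U \<phi> where c: "(U, \<phi>) \<in> A" "p \<in> U" using chart_at .
  show ?thesis
    using assms smooth_at_cong chart_eventually[OF c, of "\<lambda>q. f q = g q"]
    unfolding smooth_near_chart[OF c] by fastforce
qed

lemma C_const [simp]: "(\<lambda>q. c) \<in> \<C> p"
  by (rule chart_at[of p]) (simp add: smooth_near_chart comp_def smooth_at_const)

lemma C_add: "f \<in> \<C> p \<Longrightarrow> g \<in> \<C> p \<Longrightarrow> (\<lambda>q. f q + g q) \<in> \<C> p"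
  by (rule chart_at[of p]) (simp add: smooth_near_chart comp_def smooth_at_add)

lemma C_mult: "f \<in> \<C> p \<Longrightarrow> g \<in> \<C> p \<Longrightarrow> (\<lambda>q. f q * g q) \<in> \<C> p"
  by (rule chart_at[of p]) (simp add: smooth_near_chart comp_def smooth_at_mult)

lemma C_inverse: "f \<in> \<C> p \<Longrightarrow> f p \<noteq> 0 \<Longrightarrow> (\<lambda>q. inverse (f q)) \<in> \<C> p"
  by (rule chart_at[of p]) (simp add: smooth_near_chart comp_def smooth_at_inverse chart_inv)

lemma C_minus: "f \<in> \<C> p \<Longrightarrow> (\<lambda>q. - f q) \<in> \<C> p"
  using C_mult[OF C_const[of "-1"]] by fastforce

lemma C_diff: "f \<in> \<C> p \<Longrightarrow> g \<in> \<C> p \<Longrightarrow> (\<lambda>q. f q - g q) \<in> \<C> p"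
  using C_add[OF _ C_minus, of f p g] by simp

lemma C_divide: "f \<in> \<C> p \<Longrightarrow> g \<in> \<C> p \<Longrightarrow> g p \<noteq> 0 \<Longrightarrow> (\<lambda>q. f q / g q) \<in> \<C> p"
  using C_mult[OF _ C_inverse, of f p g] by (simp add: divide_inverse)

lemma C_sum: "(\<And>i. i \<in> I \<Longrightarrow> f i \<in> \<C> p) \<Longrightarrow> (\<lambda>q. \<Sum>i\<in>I. f i q) \<in> \<C> p"
  by (induction I rule: infinite_finite_induct) (auto intro: C_add)

lemma C_prod: "(\<And>i. i \<in> I \<Longrightarrow> f i \<in> \<C> p) \<Longrightarrow> (\<lambda>q. \<Prod>i\<in>I. f i q) \<in> \<C> p"
  by (induction I rule: infinite_finite_induct) (auto intro: C_mult)

lemma C_isCont: assumes "f \<in> \<C> p" shows "isCont f p"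
proof -
  obtain U \<phi> where c: "(U, \<phi>) \<in> A" "p \<in> U" using chart_at .
  have "((f \<circ> inv_into U \<phi>) \<longlongrightarrow> (f \<circ> inv_into U \<phi>) (\<phi> p)) (nhds (\<phi> p))"
    using assms smooth_at_isCont unfolding smooth_near_chart[OF c] isCont_def tendsto_at_iff_tendsto_nhds
    by blast
  then have "((\<lambda>q. (f \<circ> inv_into U \<phi>) (\<phi> q)) \<longlongrightarrow> f p) (nhds p)"
    using filterlim_compose[OF _ chart_tendsto(1)[OF c]] chart_inv[OF c] by fastforce
  then have "(f \<longlongrightarrow> f p) (nhds p)"
    by (rule filterlim_mono_eventually) (use c chart_open eventually_nhds_in_open in
      \<open>auto intro!: eventually_mono[OF eventually_nhds_in_open[OF chart_open(1)[OF c(1)] c(2)]] simp: chart_inv\<close>)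
  then show ?thesis by (simp add: isCont_def tendsto_at_iff_tendsto_nhds)
qed

lemma C_nonzero: assumes "f \<in> \<C> p" "f p \<noteq> 0" shows "\<forall>\<^sub>F q in nhds p. f q \<noteq> 0"
  using C_isCont[OF assms(1)] assms(2)
  by (simp add: isCont_def tendsto_at_iff_tendsto_nhds tendsto_imp_eventually_ne)

section \<open>Tangent vectors as derivations of germs\<close>

lemma T_add: "v \<in> \<T> p \<Longrightarrow> f \<in> \<C> p \<Longrightarrow> g \<in> \<C> p \<Longrightarrow> v (\<lambda>q. f q + g q) = v f + v g"
  and T_cmult: "v \<in> \<T> p \<Longrightarrow> f \<in> \<C> p \<Longrightarrow> v (\<lambda>q. c * f q) = c * v f"
  and T_mult: "v \<in> \<T> p \<Longrightarrow> f \<in> \<C> p \<Longrightarrow> g \<in> \<C> p \<Longrightarrow> v (\<lambda>q. f q * g q) = f p * v g + g p * v f"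
  and T_outside: "v \<in> \<T> p \<Longrightarrow> f \<notin> \<C> p \<Longrightarrow> v f = 0"
  unfolding tangent_space_def by blast+

lemma T_const: assumes "v \<in> \<T> p" shows "v (\<lambda>q. c) = 0"
proof -
  have "v (\<lambda>q. 1) = 0" using T_mult[OF assms C_const C_const, of 1 1] by simp
  then show ?thesis using T_cmult[OF assms C_const, of c 1] by simp
qed

text \<open>The usual bump function is replaced by the indicator \<open>u\<close> of the set where
  \<open>f\<close> and \<open>g\<close> agree. It is 1 near \<open>p\<close>, hence smooth there,
  and \<open>u f = u g\<close> everywhere; the product rule then gives \<open>v f = v g\<close>, the
  terms with \<open>v u\<close> being equal because \<open>f p = g p\<close>.\<close>

lemma T_cong:
  assumes v: "v \<in> \<T> p" and fg: "\<forall>\<^sub>F q in nhds p. f q = g q"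
  shows "v f = v g"
proof (cases "f \<in> \<C> p")
  case True
  then have g: "g \<in> \<C> p" using C_cong fg by blast
  define u where "u q = (if f q = g q then 1 else 0 :: real)" for q
  have "u \<in> \<C> p"
    using fg by (intro C_cong[OF C_const[of 1]]) (auto simp: u_def elim: eventually_mono)
  have e: "u p = 1" "f p = g p" using eventually_nhds_x_imp_x[OF fg] by (simp_all add: u_def)
  have "(\<lambda>q. u q * f q) = (\<lambda>q. u q * g q)" by (auto simp: u_def)
  moreover have "v (\<lambda>q. u q * f q) = u p * v f + f p * v u" "v (\<lambda>q. u q * g q) = u p * v g + g p * v u"
    using T_mult[OF v \<open>u \<in> \<C> p\<close>] True g by blast+
  ultimately show ?thesis using e by simp
next
  case False
  moreover have "g \<notin> \<C> p" using False C_cong[of g p f] fg by (auto simp: eq_commute)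
  ultimately show ?thesis using T_outside[OF v] by simp
qed

lemma T_minus: "v \<in> \<T> p \<Longrightarrow> f \<in> \<C> p \<Longrightarrow> v (\<lambda>q. - f q) = - v f"
  using T_cmult[of v p f "-1"] by simp

lemma T_diff: "v \<in> \<T> p \<Longrightarrow> f \<in> \<C> p \<Longrightarrow> g \<in> \<C> p \<Longrightarrow> v (\<lambda>q. f q - g q) = v f - v g"
  using T_add[of v p f "\<lambda>q. - g q"] T_minus[of v p g] C_minus[of g p] by simp

lemma T_sum:
  assumes "v \<in> \<T> p" "\<And>i. i \<in> I \<Longrightarrow> f i \<in> \<C> p"
  shows "v (\<lambda>q. \<Sum>i\<in>I. f i q) = (\<Sum>i\<in>I. v (f i))"
  using assms(2)
  by (induction I rule: infinite_finite_induct) (auto simp: T_const[OF assms(1)] T_add[OF assms(1)] C_sum)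

lemma T_prod:
  assumes "v \<in> \<T> p" "finite I" "\<And>i. i \<in> I \<Longrightarrow> f i \<in> \<C> p"
  shows "v (\<lambda>q. \<Prod>i\<in>I. f i q) = (\<Sum>i\<in>I. v (f i) * (\<Prod>j\<in>I - {i}. f j p))"
  using assms(2,3)
proof (induction I rule: finite_induct)
  case (insert i I)
  have "(\<Sum>j\<in>I. v (f j) * (\<Prod>l\<in>insert i I - {j}. f l p)) = (\<Sum>j\<in>I. f i p * (v (f j) * (\<Prod>l\<in>I - {j}. f l p)))"
  proof (rule sum.cong)
    fix j assume "j \<in> I"
    then have "insert i I - {j} = insert i (I - {j})" "i \<notin> I - {j}" using insert.hyps by auto
    then show "v (f j) * (\<Prod>l\<in>insert i I - {j}. f l p) = f i p * (v (f j) * (\<Prod>l\<in>I - {j}. f l p))"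
      using insert.hyps by simp
  qed simp
  then show ?case using insert by (simp add: T_mult[OF assms(1)] C_prod sum_distrib_left mult.commute)
qed (simp add: T_const[OF assms(1)])

lemma T_subspace: "subspace (\<T> p)"
proof (rule subspaceI)
  show "0 \<in> \<T> p" by (simp add: tangent_space_def)
  show "x + y \<in> \<T> p" if "x \<in> \<T> p" "y \<in> \<T> p" for x y
    using that unfolding tangent_space_def by (auto simp: algebra_simps)
  show "c *\<^sub>R x \<in> \<T> p" if "x \<in> \<T> p" for c x
    using that unfolding tangent_space_def by (auto simp: algebra_simps scaleR_fun_def)
qed

lemmas T_closed = subspace_0[OF T_subspace] subspace_add[OF T_subspace] subspace_diff[OF T_subspace]
  subspace_neg[OF T_subspace] subspace_scale[OF T_subspace] subspace_sum[OF T_subspace]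

section \<open>Vector fields near a point\<close>

lemma fields_near_iff:
  "X \<in> \<X> p \<longleftrightarrow> (\<forall>\<^sub>F q in nhds p. X q \<in> \<T> q \<and> (\<forall>f\<in>\<C> q. (\<lambda>r. X r f) \<in> \<C> q))"
proof
  assume "X \<in> \<X> p"
  then obtain W where W: "p \<in> W" "open W" "\<And>q. q \<in> W \<Longrightarrow> X q \<in> \<T> q"
    "\<And>W' f. W' \<subseteq> W \<Longrightarrow> smooth_fun_on A W' f \<Longrightarrow> smooth_fun_on A W' (\<lambda>p. X p f)"
    unfolding fields_near_def vector_field_on_def by blast
  have "(\<lambda>r. X r f) \<in> \<C> q" if q: "q \<in> W" "f \<in> \<C> q" for q f
  proof -
    obtain W1 where "q \<in> W1" "smooth_fun_on A W1 f" using q unfolding smooth_near_def by blast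
    then have "smooth_fun_on A (W \<inter> W1) f" using W(2) by (auto simp: smooth_fun_on_iff)
    from W(4)[OF _ this] show ?thesis using q \<open>q \<in> W1\<close> by (auto simp: smooth_fun_on_iff)
  qed
  then show "\<forall>\<^sub>F q in nhds p. X q \<in> \<T> q \<and> (\<forall>f\<in>\<C> q. (\<lambda>r. X r f) \<in> \<C> q)"
    unfolding eventually_nhds using W by blast
next
  assume "\<forall>\<^sub>F q in nhds p. X q \<in> \<T> q \<and> (\<forall>f\<in>\<C> q. (\<lambda>r. X r f) \<in> \<C> q)"
  then obtain W where "open W" "p \<in> W" "\<And>q. q \<in> W \<Longrightarrow> X q \<in> \<T> q \<and> (\<forall>f\<in>\<C> q. (\<lambda>r. X r f) \<in> \<C> q)"
    unfolding eventually_nhds by blast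
  then show "X \<in> \<X> p" unfolding fields_near_def vector_field_on_def smooth_fun_on_iff by blast
qed

lemma vector_field_on_iff: "vector_field_on A W X \<longleftrightarrow> open W \<and> (\<forall>p\<in>W. X \<in> \<X> p)"
proof
  assume r: "open W \<and> (\<forall>p\<in>W. X \<in> \<X> p)"
  then have "X p \<in> \<T> p \<and> (\<forall>f\<in>\<C> p. (\<lambda>r. X r f) \<in> \<C> p)" if "p \<in> W" for p
    using that fields_near_iff eventually_nhds_x_imp_x by blast
  then show "vector_field_on A W X"
    using r unfolding vector_field_on_def smooth_fun_on_iff by blast
qed (auto simp: fields_near_def vector_field_on_def)

lemma X_eventually: "X \<in> \<X> p \<Longrightarrow> \<forall>\<^sub>F q in nhds p. X \<in> \<X> q"
  unfolding fields_near_iff by (simp add: eventually_eventually)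

lemma X_T: "X \<in> \<X> p \<Longrightarrow> X p \<in> \<T> p"
  unfolding fields_near_iff using eventually_nhds_x_imp_x by blast

lemma X_C: "X \<in> \<X> p \<Longrightarrow> f \<in> \<C> p \<Longrightarrow> (\<lambda>q. X q f) \<in> \<C> p"
  unfolding fields_near_iff using eventually_nhds_x_imp_x by blast

lemma X_cong: assumes "X \<in> \<X> p" "\<forall>\<^sub>F q in nhds p. X q = Y q" shows "Y \<in> \<X> p"
proof -
  have "\<forall>\<^sub>F q in nhds p. \<forall>\<^sub>F r in nhds q. X r = Y r" using assms(2) by (simp add: eventually_eventually)
  moreover have "\<forall>\<^sub>F q in nhds p. X \<in> \<X> q" using X_eventually assms(1) .
  ultimately show ?thesis
    unfolding fields_near_iff[of Y]
  proof eventually_elim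
    case (elim q)
    have "(\<lambda>r. Y r f) \<in> \<C> q" if "f \<in> \<C> q" for f
      using elim(1) by (intro C_cong[OF X_C[OF elim(2) that]]) (auto elim: eventually_mono)
    then show ?case using X_T[OF elim(2)] eventually_nhds_x_imp_x[OF elim(1)] by simp
  qed
qed

lemma X_zero [simp]: "(\<lambda>q. 0) \<in> \<X> p"
  unfolding fields_near_iff using T_closed(1) by simp

lemma X_add: assumes "X \<in> \<X> p" "Y \<in> \<X> p" shows "(\<lambda>q. X q + Y q) \<in> \<X> p"
  unfolding fields_near_iff
  using X_eventually[OF assms(1)] X_eventually[OF assms(2)]
  by eventually_elim (simp add: subspace_add[OF T_subspace] X_T C_add X_C)

lemma X_scale: assumes "f \<in> \<C> p" "X \<in> \<X> p" shows "(\<lambda>q. f q *\<^sub>R X q) \<in> \<X> p"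
  unfolding fields_near_iff
  using C_eventually[OF assms(1)] X_eventually[OF assms(2)]
  by eventually_elim (intro conjI ballI subspace_scale[OF T_subspace] X_T; simp add: scaleR_fun_def C_mult X_C)

lemma X_cscale: "X \<in> \<X> p \<Longrightarrow> (\<lambda>q. c *\<^sub>R X q) \<in> \<X> p"
  by (rule X_scale[OF C_const])

lemma X_sum: "(\<And>i. i \<in> I \<Longrightarrow> X i \<in> \<X> p) \<Longrightarrow> (\<lambda>q. \<Sum>i\<in>I. X i q) \<in> \<X> p"
  by (induction I rule: infinite_finite_induct) (auto intro: X_add)

text \<open>Local coordinates \<open>x\<close> with their coordinate fields \<open>E\<close>, freed
  from the chart. Duality and expansion are required on a whole neighbourhood, so that they may be
  differentiated.\<close>

definition frame :: "'m \<Rightarrow> ('a \<Rightarrow> 'm \<Rightarrow> real) \<Rightarrow> ('a \<Rightarrow> 'm vfield) \<Rightarrow> bool" where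
  "frame p x E \<longleftrightarrow> (\<forall>b\<in>Basis. x b \<in> \<C> p \<and> E b \<in> \<X> p) \<and>
     (\<forall>\<^sub>F q in nhds p. (\<forall>b\<in>Basis. \<forall>c\<in>Basis. E b q (x c) = (if b = c then 1 else 0)) \<and>
        (\<forall>v\<in>\<T> q. v = (\<Sum>b\<in>Basis. v (x b) *\<^sub>R E b q)))"

lemma sum_fun_apply: "(\<Sum>i\<in>I. f i) x = (\<Sum>i\<in>I. f i x)"
  by (induction I rule: infinite_finite_induct) auto

text \<open>The expansion of a derivation rests on Hadamard's lemma: near \<open>q\<close>,
  \<open>f\<close> is the constant \<open>f q\<close> plus a sum of products
  \<open>(x b - x b q) * G b\<close>. A derivation kills the constant, and as the first factors
  vanish at \<open>q\<close>, only \<open>v (x b) * G b q\<close> remains, where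
  \<open>G b q\<close> is the partial derivative \<open>E b q f\<close>.\<close>

lemma frame_exists: "\<exists>x E. frame p x E"
proof -
  obtain U \<phi> where c: "(U, \<phi>) \<in> A" "p \<in> U" using chart_at .
  let ?\<psi> = "inv_into U \<phi>"
  define x where "x b q = \<phi> q \<bullet> b" for b q
  define E where "E b q f = (if f \<in> \<C> q then frechet_derivative (f \<circ> ?\<psi>) (at (\<phi> q)) b else 0)" for b q f
  note sc = smooth_near_chart[OF c(1)]
  have img: "\<forall>\<^sub>F y in nhds (\<phi> q). y \<in> \<phi> ` U" if "q \<in> U" for q
    using that chart_open(2)[OF c(1)] eventually_nhds_in_open by blast
  have inv2: "\<phi> (?\<psi> y) = y" if "y \<in> \<phi> ` U" for y using that by (auto simp: chart_inv[OF c(1)])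
  have x: "x b \<in> \<C> q" if "q \<in> U" for b q
    unfolding sc[OF that]
    by (rule smooth_at_cong[OF smooth_at_bounded_linear[OF bounded_linear_inner_left[of b]]])
      (use img[OF that] inv2 in \<open>auto elim!: eventually_mono simp: x_def\<close>)
  have diff: "(f \<circ> ?\<psi>) differentiable at (\<phi> q)" if "q \<in> U" "f \<in> \<C> q" for q f
    using that sc smooth_at_differentiable by blast
  have dfx: "E b q f = D b" if "q \<in> U" "f \<in> \<C> q" "((f \<circ> ?\<psi>) has_derivative D) (at (\<phi> q))" for b q f D
    using that(2) frechet_derivative_at[OF that(3)] by (simp add: E_def)
  have dfw: "((f \<circ> ?\<psi>) has_derivative (\<lambda>b. E b q f)) (at (\<phi> q))" if "q \<in> U" "f \<in> \<C> q" for q f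
    using diff[OF that] that(2) frechet_derivative_works unfolding E_def by auto
  have ET: "E b q \<in> \<T> q" if q: "q \<in> U" for b q
    unfolding tangent_space_def
  proof (intro CollectI conjI ballI allI impI)
    fix f g c assume f: "f \<in> \<C> q"
    show "E b q (\<lambda>q. c * f q) = c * E b q f"
      by (rule dfx[OF q C_mult[OF C_const f]])
        (use has_derivative_mult_right[OF dfw[OF q f], of c] in \<open>simp add: comp_def\<close>)
    assume g: "g \<in> \<C> q"
    show "E b q (\<lambda>q. f q + g q) = E b q f + E b q g"
      by (rule dfx[OF q C_add[OF f g]])
        (use has_derivative_add[OF dfw[OF q f] dfw[OF q g]] in \<open>simp add: comp_def\<close>)
    show "E b q (\<lambda>q. f q * g q) = f q * E b q g + g q * E b q f"
      by (rule dfx[OF q C_mult[OF f g]])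
        (use has_derivative_mult[OF dfw[OF q f] dfw[OF q g]] in \<open>simp add: comp_def chart_inv[OF c(1) q] mult.commute\<close>)
  qed (simp add: E_def)
  have EC: "(\<lambda>r. E b r f) \<in> \<C> q" if q: "q \<in> U" "f \<in> \<C> q" for b q f
    unfolding sc[OF q(1)]
  proof (rule smooth_at_cong[OF smooth_at_derivative[of _ _ b]])
    show s: "smooth_at (\<phi> q) (f \<circ> ?\<psi>)" using q sc by blast
    show "\<forall>\<^sub>F y in nhds (\<phi> q). frechet_derivative (f \<circ> ?\<psi>) (at y) b = ((\<lambda>r. E b r f) \<circ> ?\<psi>) y"
      using img[OF q(1)] smooth_at_eventually[OF s]
      by eventually_elim (auto simp: E_def sc inv2 chart_inv[OF c(1)])
  qed
  have "E b \<in> \<X> p" for b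
    unfolding fields_near_iff using ET EC eventually_nhds_in_open[OF chart_open(1)[OF c(1)] c(2)]
    by (auto elim!: eventually_mono)
  moreover have "E b q (x c') = (if b = c' then 1 else 0)" if "q \<in> U" "b \<in> Basis" "c' \<in> Basis" for q b c'
  proof -
    have "E b q (x c') = b \<bullet> c'"
    proof (rule dfx[OF that(1) x[OF that(1)]])
      show "((x c' \<circ> ?\<psi>) has_derivative (\<lambda>b. b \<bullet> c')) (at (\<phi> q))"
        by (rule has_derivative_transform_within_open[of "\<lambda>y. y \<bullet> c'" _ _ UNIV "\<phi> ` U"])
          (use that inv2 chart_open[OF c(1)] in \<open>auto intro!: derivative_eq_intros simp: x_def\<close>)
    qed
    then show ?thesis using inner_Basis[OF that(2,3)] by simp
  qed
  moreover have "v = (\<Sum>b\<in>Basis. v (x b) *\<^sub>R E b q)" if q: "q \<in> U" and v: "v \<in> \<T> q" for v q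
  proof
    fix f
    show "v f = (\<Sum>b\<in>Basis. v (x b) *\<^sub>R E b q) f"
    proof (cases "f \<in> \<C> q")
      case True
      then have "smooth_at (\<phi> q) (f \<circ> ?\<psi>)" using sc[OF q] by simp
      then obtain g where g: "\<And>b. smooth_at (\<phi> q) (g b)"
        "\<And>b. g b (\<phi> q) = frechet_derivative (f \<circ> ?\<psi>) (at (\<phi> q)) b"
        "\<forall>\<^sub>F y in nhds (\<phi> q). (f \<circ> ?\<psi>) y = (f \<circ> ?\<psi>) (\<phi> q) + (\<Sum>b\<in>Basis. ((y - \<phi> q) \<bullet> b) * g b y)"
        using smooth_at_Hadamard by blast
      define G where "G b q = g b (\<phi> q)" for b q
      have G: "G b \<in> \<C> q" for b
        unfolding sc[OF q]
        by (rule smooth_at_cong[OF g(1)[of b]]) (use img[OF q] inv2 in \<open>auto elim!: eventually_mono simp: G_def\<close>)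
      have Gq: "G b q = E b q f" for b using g(2) True by (simp add: G_def E_def)
      have "\<forall>\<^sub>F y in nhds (\<phi> q). f (?\<psi> y) = f q + (\<Sum>b\<in>Basis. (x b (?\<psi> y) - x b q) * G b (?\<psi> y))"
        using g(3) img[OF q]
        by eventually_elim (auto simp: chart_inv[OF c(1)] q x_def G_def inner_diff_left)
      then have "\<forall>\<^sub>F r in nhds q. f r = f q + (\<Sum>b\<in>Basis. (x b r - x b q) * G b r)"
        using chart_eventually[OF c(1) q, of "\<lambda>r. f r = f q + (\<Sum>b\<in>Basis. (x b r - x b q) * G b r)"] by simp
      then have "v f = v (\<lambda>r. f q + (\<Sum>b\<in>Basis. (x b r - x b q) * G b r))" by (rule T_cong[OF v])
      also have "\<dots> = (\<Sum>b\<in>Basis. v (x b) * E b q f)"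
      proof -
        have d: "(\<lambda>r. x b r - x b q) \<in> \<C> q" for b using x[OF q] by (intro C_diff C_const)
        have "v (\<lambda>r. f q + (\<Sum>b\<in>Basis. (x b r - x b q) * G b r)) = (\<Sum>b\<in>Basis. v (\<lambda>r. (x b r - x b q) * G b r))"
          using d G by (simp add: T_add[OF v] T_const[OF v] T_sum[OF v] C_sum C_mult)
        also have "\<dots> = (\<Sum>b\<in>Basis. v (x b) * E b q f)"
          using T_mult[OF v d G] T_diff[OF v x[OF q] C_const] by (simp add: T_const[OF v] Gq mult.commute)
        finally show ?thesis .
      qed
      finally show ?thesis by (simp add: sum_fun_apply scaleR_fun_def)
    next
      case False
      then show ?thesis using T_outside[OF v] by (simp add: sum_fun_apply scaleR_fun_def E_def)
    qed
  qed
  ultimately have "frame p x E"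
    unfolding frame_def using x[OF c(2)] eventually_nhds_in_open[OF chart_open(1)[OF c(1)] c(2)]
    by (auto elim!: eventually_mono)
  then show ?thesis by blast
qed

end

section \<open>Linear algebra of a quaternionic vector space\<close>

text \<open>Relative to a set, because tangent spaces are carved out of the type of all functionals
  and nothing is known off them.\<close>

definition lin_on :: "'v::real_vector set \<Rightarrow> ('v \<Rightarrow> 'w::real_vector) \<Rightarrow> bool" where
  "lin_on S F \<longleftrightarrow> (\<forall>v\<in>S. \<forall>w\<in>S. F (v + w) = F v + F w) \<and> (\<forall>v\<in>S. \<forall>c. F (c *\<^sub>R v) = c *\<^sub>R F v)"

lemma lin_on_add: "lin_on S F \<Longrightarrow> v \<in> S \<Longrightarrow> w \<in> S \<Longrightarrow> F (v + w) = F v + F w"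
  and lin_on_scale: "lin_on S F \<Longrightarrow> v \<in> S \<Longrightarrow> F (c *\<^sub>R v) = c *\<^sub>R F v"
  by (auto simp: lin_on_def)

lemma lin_on_minus: "lin_on S F \<Longrightarrow> v \<in> S \<Longrightarrow> F (- v) = - F v"
  using lin_on_scale[of S F v "-1"] by simp

lemma lin_on_diff: "lin_on S F \<Longrightarrow> subspace S \<Longrightarrow> v \<in> S \<Longrightarrow> w \<in> S \<Longrightarrow> F (v - w) = F v - F w"
  using lin_on_add[of S F v "- w"] lin_on_minus[of S F w] subspace_neg[of S w] by simp

lemma lin_on_zero: "lin_on S F \<Longrightarrow> subspace S \<Longrightarrow> F 0 = 0"
  using lin_on_scale[of S F 0 0] subspace_0[of S] by simp

lemma lin_on_sum:
  assumes "lin_on S F" "subspace S" "\<And>i. i \<in> I \<Longrightarrow> f i \<in> S"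
  shows "F (\<Sum>i\<in>I. c i *\<^sub>R f i) = (\<Sum>i\<in>I. c i *\<^sub>R F (f i))"
  using assms(3)
proof (induction I rule: infinite_finite_induct)
  case (insert i I)
  then show ?case
    using lin_on_add[OF assms(1), of "c i *\<^sub>R f i" "\<Sum>i\<in>I. c i *\<^sub>R f i"]
    by (simp add: subspace_scale[OF assms(2)] subspace_sum[OF assms(2)] lin_on_scale[OF assms(1)])
qed (simp_all add: lin_on_zero[OF assms(1,2)])

lemma lin_on_cmult: "lin_on S F \<Longrightarrow> lin_on S (\<lambda>v. c * F v :: real)"
  unfolding lin_on_def by (simp add: algebra_simps)

lemma neg_eq_self_iff: "- x = x \<longleftrightarrow> x = (0 :: 'v::real_vector)"
  by (metis neg_equal_0_iff_equal neg_eq_iff_add_eq_0 scaleR_2 scaleR_eq_0_iff zero_neq_numeral)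

section \<open>Traces in a fixed basis\<close>

definition btrace :: "'v::real_vector set \<Rightarrow> ('v \<Rightarrow> 'v) \<Rightarrow> real" where
  "btrace B F = (\<Sum>b\<in>B. representation B (F b) b)"

lemma btrace_cong: "(\<And>b. b \<in> B \<Longrightarrow> F b = G b) \<Longrightarrow> btrace B F = btrace B G"
  unfolding btrace_def by simp

context
  fixes B :: "'v::real_vector set"
  assumes B: "finite B" "independent B"
begin

lemma btrace_add:
  assumes "\<And>b. b \<in> B \<Longrightarrow> F b \<in> span B" "\<And>b. b \<in> B \<Longrightarrow> G b \<in> span B"
  shows "btrace B (\<lambda>w. F w + G w) = btrace B F + btrace B G"
  unfolding btrace_def using assms B by (simp add: representation_add sum.distrib)

lemma btrace_scale:
  assumes "\<And>b. b \<in> B \<Longrightarrow> F b \<in> span B"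
  shows "btrace B (\<lambda>w. c *\<^sub>R F w) = c * btrace B F"
  unfolding btrace_def using assms B by (simp add: representation_scale sum_distrib_left)

lemma btrace_minus:
  assumes "\<And>b. b \<in> B \<Longrightarrow> F b \<in> span B"
  shows "btrace B (\<lambda>w. - F w) = - btrace B F"
  using btrace_scale[OF assms, where c = "-1"] by simp

lemma btrace_diff:
  assumes "\<And>b. b \<in> B \<Longrightarrow> F b \<in> span B" "\<And>b. b \<in> B \<Longrightarrow> G b \<in> span B"
  shows "btrace B (\<lambda>w. F w - G w) = btrace B F - btrace B G"
  unfolding btrace_def using assms B by (simp add: representation_diff sum_subtractf)

lemma btrace_id: "btrace B (\<lambda>w. w) = card B"
  unfolding btrace_def using B by (simp add: representation_basis)

lemma representation_expand: "v \<in> span B \<Longrightarrow> (\<Sum>b\<in>B. representation B v b *\<^sub>R b) = v"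
  using B sum_representation_eq[OF B(2) _ B(1) order_refl] by blast

lemma btrace_rank1:
  assumes "lin_on (span B) \<alpha>" "u \<in> span B"
  shows "btrace B (\<lambda>w. \<alpha> w *\<^sub>R u) = \<alpha> u"
proof -
  have "\<alpha> u = \<alpha> (\<Sum>b\<in>B. representation B u b *\<^sub>R b)" using representation_expand assms by simp
  also have "\<dots> = (\<Sum>b\<in>B. representation B u b * \<alpha> b)"
    using lin_on_sum[OF assms(1), of B "\<lambda>b. b"] by (simp add: subspace_span span_base)
  finally show ?thesis
    unfolding btrace_def using assms B by (simp add: representation_scale mult.commute)
qed

lemma btrace_commute:
  assumes F: "lin_on (span B) F" "\<And>v. v \<in> span B \<Longrightarrow> F v \<in> span B"
    and G: "lin_on (span B) G" "\<And>v. v \<in> span B \<Longrightarrow> G v \<in> span B"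
  shows "btrace B (\<lambda>w. F (G w)) = btrace B (\<lambda>w. G (F w))"
proof -
  have r: "representation B (F (G b)) b = (\<Sum>c\<in>B. representation B (G b) c * representation B (F c) b)"
    if F: "lin_on (span B) F" "\<And>v. v \<in> span B \<Longrightarrow> F v \<in> span B"
      and G: "\<And>v. v \<in> span B \<Longrightarrow> G v \<in> span B" and b: "b \<in> B" for F G b
  proof -
    have "F (G b) = F (\<Sum>c\<in>B. representation B (G b) c *\<^sub>R c)" using representation_expand G b span_base by metis
    also have "\<dots> = (\<Sum>c\<in>B. representation B (G b) c *\<^sub>R F c)"
      using lin_on_sum[OF F(1), of B "\<lambda>b. b"] by (simp add: subspace_span span_base)
    finally show ?thesis
      using B by (simp add: representation_sum representation_scale span_scale span_base F(2))
  qed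
  have "btrace B (\<lambda>w. F (G w)) = (\<Sum>b\<in>B. \<Sum>c\<in>B. representation B (G b) c * representation B (F c) b)"
    unfolding btrace_def by (intro sum.cong refl r[OF F G(2)])
  also have "\<dots> = (\<Sum>c\<in>B. \<Sum>b\<in>B. representation B (F c) b * representation B (G b) c)"
    by (subst sum.swap) (simp add: mult.commute)
  also have "\<dots> = btrace B (\<lambda>w. G (F w))"
    unfolding btrace_def by (intro sum.cong refl r[OF G F(2), symmetric])
  finally show ?thesis .
qed

end

text \<open>Exposes the basis that \<open>trace_on\<close> picks by choice. It depends on
  \<open>S\<close> alone, so all traces on \<open>S\<close> are computed in this one basis.\<close>

lemma trace_on_btrace:
  assumes "finite B0" "S = span B0" "independent B0"
  obtains B where "finite B" "independent B" "span B = S" "B \<subseteq> S" "card B = card B0" "trace_on S = btrace B"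
proof -
  define B where "B = (SOME B. B \<subseteq> S \<and> independent B \<and> S \<subseteq> span B)"
  have "B0 \<subseteq> S \<and> independent B0 \<and> S \<subseteq> span B0" using assms span_superset by blast
  then have B: "B \<subseteq> S" "independent B" "S \<subseteq> span B" unfolding B_def by (metis (mono_tags, lifting) someI_ex)+
  have sp: "span B = S" using B assms span_mono[OF B(1)] by (simp add: span_span subset_antisym)
  have "finite B" using independent_span_bound[OF assms(1) B(2)] B(1) assms(2) by blast
  moreover have "card B = card B0"
    using independent_span_bound[OF assms(1) B(2)] independent_span_bound[OF calculation assms(3)] B assms sp
    by (metis le_antisym span_superset)
  moreover have "trace_on S = btrace B"
    unfolding trace_on_def btrace_def B_def[symmetric] Let_def by (rule ext) simp
  ultimately show ?thesis using B sp that by blast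
qed

section \<open>Quaternionic vector spaces\<close>

locale quat_space =
  fixes S :: "'v::real_vector set" and J1 J2 J3 :: "'v \<Rightarrow> 'v"
  assumes sub: "subspace S"
    and lin: "lin_on S J1" "lin_on S J2" "lin_on S J3"
    and cl: "v \<in> S \<Longrightarrow> J1 v \<in> S" "v \<in> S \<Longrightarrow> J2 v \<in> S" "v \<in> S \<Longrightarrow> J3 v \<in> S"
    and sq: "v \<in> S \<Longrightarrow> J1 (J1 v) = - v" "v \<in> S \<Longrightarrow> J2 (J2 v) = - v" "v \<in> S \<Longrightarrow> J3 (J3 v) = - v"
    and J12: "v \<in> S \<Longrightarrow> J1 (J2 v) = J3 v" and J21: "v \<in> S \<Longrightarrow> J2 (J1 v) = - J3 v"
begin

lemmas Scl = subspace_0[OF sub] subspace_add[OF sub] subspace_diff[OF sub] subspace_neg[OF sub]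
  subspace_scale[OF sub] cl
lemmas Jlin = lin[THEN lin_on_add] lin[THEN lin_on_scale] lin[THEN lin_on_minus]
  lin_on_diff[OF lin(1) sub] lin_on_diff[OF lin(2) sub] lin_on_diff[OF lin(3) sub]

lemma J32: "v \<in> S \<Longrightarrow> J3 (J2 v) = - J1 v"
  using J12[of "J2 v"] by (simp add: Scl Jlin sq)

lemma J13: "v \<in> S \<Longrightarrow> J1 (J3 v) = - J2 v"
  using J12[of v] sq(1)[of "J2 v"] by (simp add: Scl)

lemma J23: "v \<in> S \<Longrightarrow> J2 (J3 v) = J1 v"
  using J12[of v] J21[of "J2 v"] J32[of v] by (simp add: Scl)

lemma J31: "v \<in> S \<Longrightarrow> J3 (J1 v) = J2 v"
  using J12[of "J1 v"] J21[of v] J13[of v] by (simp add: Scl Jlin)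

lemmas Jrel = sq J12 J21 J32 J13 J23 J31

text \<open>Applying the conjugate quaternion to the combination multiplies \<open>w\<close> by the
  sum of the four squares.\<close>

lemma quat_independent:
  assumes w: "w \<in> S" "w \<noteq> 0" and z: "a *\<^sub>R w + b *\<^sub>R J1 w + c *\<^sub>R J2 w + d *\<^sub>R J3 w = 0"
  shows "a = 0 \<and> b = 0 \<and> c = 0 \<and> d = 0"
proof -
  let ?q = "a *\<^sub>R w + b *\<^sub>R J1 w + c *\<^sub>R J2 w + d *\<^sub>R J3 w"
  have "a *\<^sub>R ?q - b *\<^sub>R J1 ?q - c *\<^sub>R J2 ?q - d *\<^sub>R J3 ?q = (a * a + b * b + c * c + d * d) *\<^sub>R w"
    using w by (simp add: Scl Jlin Jrel algebra_simps)
  then have "(a * a + b * b + c * c + d * d) *\<^sub>R w = 0"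
    unfolding z using lin[THEN lin_on_zero] sub by simp
  then have "a * a + b * b + c * c + d * d = 0" using w by simp
  then show ?thesis by (smt (verit) mult_eq_0_iff zero_le_square)
qed

text \<open>The pointwise algebra of \<open>K\<^sub>a = \<nabla> J\<^sub>a\<close> for a connection
  preserving the span: linear in the direction, with values in the span, and subject to the
  derivatives of \<open>J\<^sub>a J\<^sub>a = - 1\<close> and
  \<open>J\<^sub>1 J\<^sub>2 = J\<^sub>3\<close>.\<close>

definition quat_derivation :: "('v \<Rightarrow> 'v \<Rightarrow> 'v) \<Rightarrow> ('v \<Rightarrow> 'v \<Rightarrow> 'v) \<Rightarrow> ('v \<Rightarrow> 'v \<Rightarrow> 'v) \<Rightarrow> bool" where
  "quat_derivation K1 K2 K3 \<longleftrightarrow>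
     (\<forall>K\<in>{K1, K2, K3}. (\<forall>w\<in>S. lin_on S (\<lambda>v. K v w)) \<and>
        (\<forall>v\<in>S. \<exists>a b c. \<forall>w\<in>S. K v w = a *\<^sub>R J1 w + b *\<^sub>R J2 w + c *\<^sub>R J3 w)) \<and>
     (\<forall>v\<in>S. \<forall>w\<in>S. K1 v (J1 w) + J1 (K1 v w) = 0 \<and> K2 v (J2 w) + J2 (K2 v w) = 0 \<and>
        K3 v (J3 w) + J3 (K3 v w) = 0 \<and> K1 v (J2 w) + J1 (K2 v w) = K3 v w)"

text \<open>The derivatives of an admissible basis along a connection preserving its span form a
  skew-symmetric matrix.\<close>

lemma derivation_coefficients:
  assumes S: "S \<noteq> {0}"
    and K: "quat_derivation K1 K2 K3"
  obtains \<omega>1 \<omega>2 \<omega>3 :: "'v \<Rightarrow> real" where "lin_on S \<omega>1" "lin_on S \<omega>2" "lin_on S \<omega>3"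
    "\<forall>v\<in>S. \<forall>w\<in>S. K1 v w = \<omega>3 v *\<^sub>R J2 w - \<omega>2 v *\<^sub>R J3 w"
    "\<forall>v\<in>S. \<forall>w\<in>S. K2 v w = \<omega>1 v *\<^sub>R J3 w - \<omega>3 v *\<^sub>R J1 w"
    "\<forall>v\<in>S. \<forall>w\<in>S. K3 v w = \<omega>2 v *\<^sub>R J1 w - \<omega>1 v *\<^sub>R J2 w"
proof -
  obtain w0 where w0: "w0 \<in> S" "w0 \<noteq> 0" using S subspace_0[OF sub] by blast
  have K_lin: "lin_on S (\<lambda>v. K1 v w)" "lin_on S (\<lambda>v. K2 v w)" "lin_on S (\<lambda>v. K3 v w)" if "w \<in> S" for w
    using K that unfolding quat_derivation_def by blast+
  note K_add = K_lin[THEN lin_on_add] and K_scale = K_lin[THEN lin_on_scale]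
  have K_Q: "\<exists>a b c. \<forall>w\<in>S. K1 v w = a *\<^sub>R J1 w + b *\<^sub>R J2 w + c *\<^sub>R J3 w"
    "\<exists>a b c. \<forall>w\<in>S. K2 v w = a *\<^sub>R J1 w + b *\<^sub>R J2 w + c *\<^sub>R J3 w"
    "\<exists>a b c. \<forall>w\<in>S. K3 v w = a *\<^sub>R J1 w + b *\<^sub>R J2 w + c *\<^sub>R J3 w" if "v \<in> S" for v
    using K that unfolding quat_derivation_def by simp_all
  have K_sq: "K1 v (J1 w) + J1 (K1 v w) = 0" "K2 v (J2 w) + J2 (K2 v w) = 0" "K3 v (J3 w) + J3 (K3 v w) = 0"
    and K_12: "K1 v (J2 w) + J1 (K2 v w) = K3 v w" if "v \<in> S" "w \<in> S" for v w
    using K that unfolding quat_derivation_def by blast+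
  have "\<exists>x y z. \<forall>w\<in>S. K1 v w = z *\<^sub>R J2 w - y *\<^sub>R J3 w \<and> K2 v w = x *\<^sub>R J3 w - z *\<^sub>R J1 w \<and>
      K3 v w = y *\<^sub>R J1 w - x *\<^sub>R J2 w" if v: "v \<in> S" for v
  proof -
    obtain a1 b1 c1 a2 b2 c2 a3 b3 c3 where
      K1: "\<And>w. w \<in> S \<Longrightarrow> K1 v w = a1 *\<^sub>R J1 w + b1 *\<^sub>R J2 w + c1 *\<^sub>R J3 w" and
      K2: "\<And>w. w \<in> S \<Longrightarrow> K2 v w = a2 *\<^sub>R J1 w + b2 *\<^sub>R J2 w + c2 *\<^sub>R J3 w" and
      K3: "\<And>w. w \<in> S \<Longrightarrow> K3 v w = a3 *\<^sub>R J1 w + b3 *\<^sub>R J2 w + c3 *\<^sub>R J3 w"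
      using K_Q[OF v] by metis
    \<comment> \<open>In the anticommutator of \<open>K1 v\<close> and \<open>J1\<close> only the
      \<open>J1\<close> coefficient survives, doubled, so it is zero. The other diagonal
      coefficients vanish likewise.\<close>
    have "- (a1 *\<^sub>R w0) = a1 *\<^sub>R w0"
      using K_sq(1)[OF v w0(1)] w0(1) by (simp add: K1 Scl Jlin Jrel algebra_simps)
    then have a1: "a1 = 0" using w0(2) by (simp add: neg_eq_self_iff)
    have "- (b2 *\<^sub>R w0) = b2 *\<^sub>R w0"
      using K_sq(2)[OF v w0(1)] w0(1) by (simp add: K2 Scl Jlin Jrel algebra_simps)
    then have b2: "b2 = 0" using w0(2) by (simp add: neg_eq_self_iff)
    have "- (c3 *\<^sub>R w0) = c3 *\<^sub>R w0"
      using K_sq(3)[OF v w0(1)] w0(1) by (simp add: K3 Scl Jlin Jrel algebra_simps)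
    then have c3: "c3 = 0" using w0(2) by (simp add: neg_eq_self_iff)
    \<comment> \<open>The derivative of \<open>J1 J2 = J3\<close>, sorted by \<open>w0\<close>,
      \<open>J1 w0\<close>, \<open>J2 w0\<close>, says that the remaining coefficients form a skew
      matrix.\<close>
    have "(- b1 - a2) *\<^sub>R w0 + (- c1 - a3) *\<^sub>R J1 w0 + (- c2 - b3) *\<^sub>R J2 w0 + 0 *\<^sub>R J3 w0
        = K1 v (J2 w0) + J1 (K2 v w0) - K3 v w0"
      using w0(1) by (simp add: K1 K2 K3 a1 b2 c3 Scl Jlin Jrel algebra_simps)
    also have "\<dots> = 0" using K_12[OF v w0(1)] by simp
    finally have "(- b1 - a2) *\<^sub>R w0 + (- c1 - a3) *\<^sub>R J1 w0 + (- c2 - b3) *\<^sub>R J2 w0 + 0 *\<^sub>R J3 w0 = 0" .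
    then have "- b1 - a2 = 0 \<and> - c1 - a3 = 0 \<and> - c2 - b3 = 0" using quat_independent[OF w0] by blast
    then have "a2 = - b1" "a3 = - c1" "b3 = - c2" by auto
    then show ?thesis
      using K1 K2 K3 a1 b2 c3 by (rule_tac exI[of _ c2], rule_tac exI[of _ "- c1"], rule_tac exI[of _ b1]) simp
  qed
  then obtain \<omega>1 \<omega>2 \<omega>3 where K': "\<And>v w. v \<in> S \<Longrightarrow> w \<in> S \<Longrightarrow>
      K1 v w = \<omega>3 v *\<^sub>R J2 w - \<omega>2 v *\<^sub>R J3 w \<and> K2 v w = \<omega>1 v *\<^sub>R J3 w - \<omega>3 v *\<^sub>R J1 w \<and>
      K3 v w = \<omega>2 v *\<^sub>R J1 w - \<omega>1 v *\<^sub>R J2 w" by metis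
  \<comment> \<open>The coefficients were chosen separately for each \<open>v\<close>. Their
    linearity comes from that of \<open>K\<close> at the fixed vector \<open>w0\<close> and the
    independence of \<open>J1 w0\<close>, \<open>J2 w0\<close>, \<open>J3 w0\<close>.\<close>
  have add: "\<omega>1 (v + v') = \<omega>1 v + \<omega>1 v' \<and> \<omega>2 (v + v') = \<omega>2 v + \<omega>2 v' \<and> \<omega>3 (v + v') = \<omega>3 v + \<omega>3 v'"
    if v: "v \<in> S" "v' \<in> S" for v v'
  proof -
    have "0 *\<^sub>R w0 + 0 *\<^sub>R J1 w0 + (\<omega>3 (v + v') - \<omega>3 v - \<omega>3 v') *\<^sub>R J2 w0 + (\<omega>2 v + \<omega>2 v' - \<omega>2 (v + v')) *\<^sub>R J3 w0 = 0"
      using K_add[OF w0(1) v] K'[OF _ w0(1)] Scl v by (simp add: algebra_simps)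
    moreover have "0 *\<^sub>R w0 + (\<omega>3 v + \<omega>3 v' - \<omega>3 (v + v')) *\<^sub>R J1 w0 + 0 *\<^sub>R J2 w0 + (\<omega>1 (v + v') - \<omega>1 v - \<omega>1 v') *\<^sub>R J3 w0 = 0"
      using K_add[OF w0(1) v] K'[OF _ w0(1)] Scl v by (simp add: algebra_simps)
    ultimately show ?thesis using quat_independent[OF w0] by (smt (verit))
  qed
  have scale: "\<omega>1 (r *\<^sub>R v) = r * \<omega>1 v \<and> \<omega>2 (r *\<^sub>R v) = r * \<omega>2 v \<and> \<omega>3 (r *\<^sub>R v) = r * \<omega>3 v"
    if v: "v \<in> S" for v r
  proof -
    have "0 *\<^sub>R w0 + 0 *\<^sub>R J1 w0 + (\<omega>3 (r *\<^sub>R v) - r * \<omega>3 v) *\<^sub>R J2 w0 + (r * \<omega>2 v - \<omega>2 (r *\<^sub>R v)) *\<^sub>R J3 w0 = 0"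
      using K_scale[OF w0(1) v, of r] K'[OF _ w0(1)] Scl v by (simp add: algebra_simps)
    moreover have "0 *\<^sub>R w0 + (r * \<omega>3 v - \<omega>3 (r *\<^sub>R v)) *\<^sub>R J1 w0 + 0 *\<^sub>R J2 w0 + (\<omega>1 (r *\<^sub>R v) - r * \<omega>1 v) *\<^sub>R J3 w0 = 0"
      using K_scale[OF w0(1) v, of r] K'[OF _ w0(1)] Scl v by (simp add: algebra_simps)
    ultimately show ?thesis using quat_independent[OF w0] by (smt (verit))
  qed
  show ?thesis
    by (rule that[of \<omega>1 \<omega>2 \<omega>3]) (use add scale K' in \<open>auto simp: lin_on_def\<close>)
qed

text \<open>With \<open>K\<^sub>a = \<nabla> J\<^sub>a\<close> for a torsion-free connection, the left-hand side of the first identity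
  is the sum of the Nijenhuis tensors of the \<open>J\<^sub>a\<close>.\<close>

lemma nijenhuis_sum:
  fixes \<omega>1 \<omega>2 \<omega>3 :: "'v \<Rightarrow> real"
  assumes \<omega>: "lin_on S \<omega>1" "lin_on S \<omega>2" "lin_on S \<omega>3"
    and K: "\<forall>v\<in>S. \<forall>w\<in>S. K1 v w = \<omega>3 v *\<^sub>R J2 w - \<omega>2 v *\<^sub>R J3 w"
    "\<forall>v\<in>S. \<forall>w\<in>S. K2 v w = \<omega>1 v *\<^sub>R J3 w - \<omega>3 v *\<^sub>R J1 w"
    "\<forall>v\<in>S. \<forall>w\<in>S. K3 v w = \<omega>2 v *\<^sub>R J1 w - \<omega>1 v *\<^sub>R J2 w"
  defines "\<theta>1 \<equiv> \<lambda>v. 2 * \<omega>1 v + \<omega>3 (J2 v) - \<omega>2 (J3 v)"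
    and "\<theta>2 \<equiv> \<lambda>v. 2 * \<omega>2 v + \<omega>1 (J3 v) - \<omega>3 (J1 v)"
    and "\<theta>3 \<equiv> \<lambda>v. 2 * \<omega>3 v + \<omega>2 (J1 v) - \<omega>1 (J2 v)"
  shows "v \<in> S \<Longrightarrow> w \<in> S \<Longrightarrow>
      (K1 (J1 v) w - K1 (J1 w) v - J1 (K1 v w) + J1 (K1 w v))
      + (K2 (J2 v) w - K2 (J2 w) v - J2 (K2 v w) + J2 (K2 w v))
      + (K3 (J3 v) w - K3 (J3 w) v - J3 (K3 v w) + J3 (K3 w v))
      = - ((\<theta>1 v *\<^sub>R J1 w - \<theta>1 w *\<^sub>R J1 v) + (\<theta>2 v *\<^sub>R J2 w - \<theta>2 w *\<^sub>R J2 v) + (\<theta>3 v *\<^sub>R J3 w - \<theta>3 w *\<^sub>R J3 v))"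
    and "\<forall>v\<in>S. \<theta>1 (J1 v) + \<theta>2 (J2 v) + \<theta>3 (J3 v) = 0"
    and "lin_on S \<theta>1" "lin_on S \<theta>2" "lin_on S \<theta>3"
proof -
  show "(K1 (J1 v) w - K1 (J1 w) v - J1 (K1 v w) + J1 (K1 w v))
      + (K2 (J2 v) w - K2 (J2 w) v - J2 (K2 v w) + J2 (K2 w v))
      + (K3 (J3 v) w - K3 (J3 w) v - J3 (K3 v w) + J3 (K3 w v))
      = - ((\<theta>1 v *\<^sub>R J1 w - \<theta>1 w *\<^sub>R J1 v) + (\<theta>2 v *\<^sub>R J2 w - \<theta>2 w *\<^sub>R J2 v) + (\<theta>3 v *\<^sub>R J3 w - \<theta>3 w *\<^sub>R J3 v))"
    if "v \<in> S" "w \<in> S"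
    using that by (simp add: K \<theta>1_def \<theta>2_def \<theta>3_def Scl Jlin Jrel algebra_simps scaleR_2 flip: scaleR_scaleR)
  \<comment> \<open>The doubled terms cancel against the mixed ones, since for instance
    \<open>J3 J2 = - J1\<close> and \<open>J2 J3 = J1\<close> both contribute to \<omega>1.
    \<open>trace_partial\<close> owes its constant to this relation.\<close>
  show "\<forall>v\<in>S. \<theta>1 (J1 v) + \<theta>2 (J2 v) + \<theta>3 (J3 v) = 0"
    by (simp add: \<theta>1_def \<theta>2_def \<theta>3_def Scl Jrel \<omega>[THEN lin_on_minus])
  show "lin_on S \<theta>1" "lin_on S \<theta>2" "lin_on S \<theta>3"
    unfolding \<theta>1_def \<theta>2_def \<theta>3_def lin_on_def
    by (simp_all add: Scl Jlin \<omega>[THEN lin_on_add] \<omega>[THEN lin_on_scale] algebra_simps)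
qed

text \<open>One has \<open>R (J v) (J w) = - R v w\<close> for \<open>J = J\<^sub>1, J\<^sub>2, J\<^sub>3\<close>, but applying this to \<open>J\<^sub>1\<close> and \<open>J\<^sub>2\<close> in
  turn gives the opposite sign for \<open>J\<^sub>3 = J\<^sub>1 J\<^sub>2\<close>.\<close>

lemma symmetric_quaternionic_zero:
  assumes sym: "\<And>v w. v \<in> S \<Longrightarrow> w \<in> S \<Longrightarrow> R v w = R w v"
    and R_S: "\<And>v w. v \<in> S \<Longrightarrow> w \<in> S \<Longrightarrow> R v w \<in> S"
    and com: "\<And>v w. v \<in> S \<Longrightarrow> w \<in> S \<Longrightarrow> R v (J1 w) = J1 (R v w)"
      "\<And>v w. v \<in> S \<Longrightarrow> w \<in> S \<Longrightarrow> R v (J2 w) = J2 (R v w)"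
    and v: "v \<in> S" "w \<in> S"
  shows "R v w = 0"
proof -
  have a: "R (J1 v) (J1 w) = - R v w" if "v \<in> S" "w \<in> S" for v w
    using that sym[of "J1 v" w] R_S by (simp add: com Scl Jrel sym[of v w])
  have b: "R (J2 v) (J2 w) = - R v w" if "v \<in> S" "w \<in> S" for v w
    using that sym[of "J2 v" w] R_S by (simp add: com Scl Jrel sym[of v w])
  have "R v (J3 w) = J3 (R v w)" if "v \<in> S" "w \<in> S" for v w
    using com(1)[of v "J2 w"] com(2)[of v w] that R_S by (simp add: Scl Jrel)
  then have "R (J3 v) (J3 w) = - R v w"
    using v sym[of "J3 v" w] R_S by (simp add: Scl Jrel sym[of v w])
  moreover have "R (J3 v) (J3 w) = R v w"
    using a[of "J2 v" "J2 w"] b[of v w] v by (simp add: Scl Jrel)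
  ultimately show ?thesis using neg_eq_self_iff by metis
qed

context
  fixes B assumes B: "finite B" "independent B" "span B = S"
begin

text \<open>Each structure is the product of the other two in one order and its negative in the
  other order, while the trace does not see the order.\<close>

lemma trace_J: "btrace B J1 = 0" "btrace B J2 = 0" "btrace B J3 = 0"
proof -
  have BS: "b \<in> S" if "b \<in> B" for b using that B span_base by blast
  note com = btrace_commute[OF B(1,2), unfolded B(3)]
  note neg = btrace_minus[OF B(1,2), unfolded B(3)]
  have "btrace B (\<lambda>w. J2 (J3 w)) = btrace B (\<lambda>w. J3 (J2 w))" by (rule com) (use lin cl in auto)
  then have "btrace B J1 = btrace B (\<lambda>w. - J1 w)" by (simp add: BS Jrel cong: btrace_cong)
  then show "btrace B J1 = 0" using neg[of J1] BS cl by simp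
  have "btrace B (\<lambda>w. J3 (J1 w)) = btrace B (\<lambda>w. J1 (J3 w))" by (rule com) (use lin cl in auto)
  then have "btrace B J2 = btrace B (\<lambda>w. - J2 w)" by (simp add: BS Jrel cong: btrace_cong)
  then show "btrace B J2 = 0" using neg[of J2] BS cl by simp
  have "btrace B (\<lambda>w. J1 (J2 w)) = btrace B (\<lambda>w. J2 (J1 w))" by (rule com) (use lin cl in auto)
  then have "btrace B J3 = btrace B (\<lambda>w. - J3 w)" by (simp add: BS Jrel cong: btrace_cong)
  then show "btrace B J3 = 0" using neg[of J3] BS cl by simp
qed

text \<open>After composition with \<open>J1\<close> the trace is
  \<open>card B * \<theta>1 v\<close> from the multiple of the identity,
  \<open>- \<theta>1 v\<close> from a rank one term, and
  \<open>\<theta>2 (J3 v) - \<theta>3 (J2 v)\<close> from the mixed ones. The hypothesis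
  \<open>zero\<close> at \<open>J1 v\<close> evaluates the last contribution to another
  \<open>- \<theta>1 v\<close>. This is the origin of the denominator in
  \<open>oproiu_form\<close>.\<close>

lemma trace_partial:
  fixes \<theta>1 \<theta>2 \<theta>3 :: "'v \<Rightarrow> real"
  assumes \<theta>: "lin_on S \<theta>1" "lin_on S \<theta>2" "lin_on S \<theta>3"
    and zero: "\<forall>v\<in>S. \<theta>1 (J1 v) + \<theta>2 (J2 v) + \<theta>3 (J3 v) = 0"
    and v: "v \<in> S"
  defines "T \<equiv> \<lambda>w. - ((\<theta>1 v *\<^sub>R J1 w - \<theta>1 w *\<^sub>R J1 v) + (\<theta>2 v *\<^sub>R J2 w - \<theta>2 w *\<^sub>R J2 v) + (\<theta>3 v *\<^sub>R J3 w - \<theta>3 w *\<^sub>R J3 v))"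
  shows "btrace B (\<lambda>w. J1 (T w)) = (real (card B) - 2) * \<theta>1 v"
    "btrace B (\<lambda>w. J2 (T w)) = (real (card B) - 2) * \<theta>2 v"
    "btrace B (\<lambda>w. J3 (T w)) = (real (card B) - 2) * \<theta>3 v"
proof -
  have BS: "b \<in> S" if "b \<in> B" for b using that B span_base by blast
  note tr = btrace_add[OF B(1,2), unfolded B(3)] btrace_diff[OF B(1,2), unfolded B(3)]
    btrace_scale[OF B(1,2), unfolded B(3)] btrace_minus[OF B(1,2), unfolded B(3)]
    btrace_id[OF B(1,2)] \<theta>[THEN btrace_rank1[OF B(1,2), unfolded B(3)]] trace_J
  have "btrace B (\<lambda>w. J1 (T w)) = btrace B (\<lambda>w. (\<theta>1 v *\<^sub>R w - \<theta>1 w *\<^sub>R v) - \<theta>2 v *\<^sub>R J3 w + \<theta>2 w *\<^sub>R J3 v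
      + \<theta>3 v *\<^sub>R J2 w - \<theta>3 w *\<^sub>R J2 v)"
    by (rule btrace_cong) (use v BS in \<open>simp add: T_def Scl Jlin Jrel algebra_simps\<close>)
  also have "\<dots> = real (card B) * \<theta>1 v - \<theta>1 v + (\<theta>2 (J3 v) - \<theta>3 (J2 v))"
    using v BS by (simp add: tr Scl)
  also have "\<theta>2 (J3 v) - \<theta>3 (J2 v) = - \<theta>1 v"
    using zero[rule_format, of "J1 v"] v by (simp add: Scl Jrel \<theta>[THEN lin_on_minus])
  finally show "btrace B (\<lambda>w. J1 (T w)) = (real (card B) - 2) * \<theta>1 v" by (simp add: algebra_simps)
  have "btrace B (\<lambda>w. J2 (T w)) = btrace B (\<lambda>w. (\<theta>2 v *\<^sub>R w - \<theta>2 w *\<^sub>R v) - \<theta>3 v *\<^sub>R J1 w + \<theta>3 w *\<^sub>R J1 v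
      + \<theta>1 v *\<^sub>R J3 w - \<theta>1 w *\<^sub>R J3 v)"
    by (rule btrace_cong) (use v BS in \<open>simp add: T_def Scl Jlin Jrel algebra_simps\<close>)
  also have "\<dots> = real (card B) * \<theta>2 v - \<theta>2 v + (\<theta>3 (J1 v) - \<theta>1 (J3 v))"
    using v BS by (simp add: tr Scl)
  also have "\<theta>3 (J1 v) - \<theta>1 (J3 v) = - \<theta>2 v"
    using zero[rule_format, of "J2 v"] v by (simp add: Scl Jrel \<theta>[THEN lin_on_minus])
  finally show "btrace B (\<lambda>w. J2 (T w)) = (real (card B) - 2) * \<theta>2 v" by (simp add: algebra_simps)
  have "btrace B (\<lambda>w. J3 (T w)) = btrace B (\<lambda>w. (\<theta>3 v *\<^sub>R w - \<theta>3 w *\<^sub>R v) - \<theta>1 v *\<^sub>R J2 w + \<theta>1 w *\<^sub>R J2 v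
      + \<theta>2 v *\<^sub>R J1 w - \<theta>2 w *\<^sub>R J1 v)"
    by (rule btrace_cong) (use v BS in \<open>simp add: T_def Scl Jlin Jrel algebra_simps\<close>)
  also have "\<dots> = real (card B) * \<theta>3 v - \<theta>3 v + (\<theta>1 (J2 v) - \<theta>2 (J1 v))"
    using v BS by (simp add: tr Scl)
  also have "\<theta>1 (J2 v) - \<theta>2 (J1 v) = - \<theta>3 v"
    using zero[rule_format, of "J3 v"] v by (simp add: Scl Jrel \<theta>[THEN lin_on_minus])
  finally show "btrace B (\<lambda>w. J3 (T w)) = (real (card B) - 2) * \<theta>3 v" by (simp add: algebra_simps)
qed

text \<open>The vanishing of Oproiu's torsion at one point: \<open>N\<close> is the Obata torsion
  expressed by a torsion-free connection, and \<open>\<tau>\<close> gives its Oproiu forms.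
  \<open>card B \<noteq> 2\<close> keeps their denominator away from zero.\<close>

lemma obata_partial:
  assumes S: "S \<noteq> {0}" and K: "quat_derivation K1 K2 K3" and card: "card B \<noteq> 2"
    and vw: "v \<in> S" "w \<in> S"
  defines "N \<equiv> \<lambda>v w. (1 / 6) *\<^sub>R
      ((K1 (J1 v) w - K1 (J1 w) v - J1 (K1 v w) + J1 (K1 w v))
      + (K2 (J2 v) w - K2 (J2 w) v - J2 (K2 v w) + J2 (K2 w v))
      + (K3 (J3 v) w - K3 (J3 w) v - J3 (K3 v w) + J3 (K3 w v)))"
  defines "\<tau> \<equiv> \<lambda>J v. btrace B (\<lambda>w. J (N v w)) / (real (card B) - 2)"
  shows "N v w + ((\<tau> J1 v *\<^sub>R J1 w - \<tau> J1 w *\<^sub>R J1 v) + (\<tau> J2 v *\<^sub>R J2 w - \<tau> J2 w *\<^sub>R J2 v)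
     + (\<tau> J3 v *\<^sub>R J3 w - \<tau> J3 w *\<^sub>R J3 v)) = 0"
proof -
  have BS: "b \<in> S" if "b \<in> B" for b using that B span_base by blast
  obtain \<omega>1 \<omega>2 \<omega>3 :: "'v \<Rightarrow> real" where \<omega>: "lin_on S \<omega>1" "lin_on S \<omega>2" "lin_on S \<omega>3"
    "\<forall>v\<in>S. \<forall>w\<in>S. K1 v w = \<omega>3 v *\<^sub>R J2 w - \<omega>2 v *\<^sub>R J3 w"
    "\<forall>v\<in>S. \<forall>w\<in>S. K2 v w = \<omega>1 v *\<^sub>R J3 w - \<omega>3 v *\<^sub>R J1 w"
    "\<forall>v\<in>S. \<forall>w\<in>S. K3 v w = \<omega>2 v *\<^sub>R J1 w - \<omega>1 v *\<^sub>R J2 w"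
    using derivation_coefficients[OF S K] by blast
  \<comment> \<open>With the factor 1/6 of the Obata torsion absorbed, these forms are equal to
    \<open>\<tau> J1\<close>, \<open>\<tau> J2\<close>, \<open>\<tau> J3\<close>.\<close>
  define \<theta>1 where "\<theta>1 v = (1/6) * (2 * \<omega>1 v + \<omega>3 (J2 v) - \<omega>2 (J3 v))" for v
  define \<theta>2 where "\<theta>2 v = (1/6) * (2 * \<omega>2 v + \<omega>1 (J3 v) - \<omega>3 (J1 v))" for v
  define \<theta>3 where "\<theta>3 v = (1/6) * (2 * \<omega>3 v + \<omega>2 (J1 v) - \<omega>1 (J2 v))" for v
  note ns = nijenhuis_sum[OF \<omega>]
  have N: "N v w = - ((\<theta>1 v *\<^sub>R J1 w - \<theta>1 w *\<^sub>R J1 v) + (\<theta>2 v *\<^sub>R J2 w - \<theta>2 w *\<^sub>R J2 v)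
      + (\<theta>3 v *\<^sub>R J3 w - \<theta>3 w *\<^sub>R J3 v))" if "v \<in> S" "w \<in> S" for v w
    unfolding N_def ns(1)[OF that] \<theta>1_def \<theta>2_def \<theta>3_def
    by (simp only: scaleR_add_right scaleR_diff_right scaleR_scaleR scaleR_minus_right)
  have z: "\<forall>v\<in>S. \<theta>1 (J1 v) + \<theta>2 (J2 v) + \<theta>3 (J3 v) = 0"
  proof
    fix v assume "v \<in> S"
    have "1 / 6 * x + 1 / 6 * y + 1 / 6 * z = 1 / 6 * (x + y + z)" for x y z :: real by (simp only: distrib_left)
    then show "\<theta>1 (J1 v) + \<theta>2 (J2 v) + \<theta>3 (J3 v) = 0"
      unfolding \<theta>1_def \<theta>2_def \<theta>3_def using bspec[OF ns(2) \<open>v \<in> S\<close>] by (simp only: mult_zero_right)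
  qed
  have l: "lin_on S \<theta>1" "lin_on S \<theta>2" "lin_on S \<theta>3"
    using ns(3-5)[THEN lin_on_cmult, of "1 / 6"] unfolding \<theta>1_def \<theta>2_def \<theta>3_def .
  have c: "real (card B) - 2 \<noteq> 0" using card by linarith
  have \<tau>: "\<tau> J1 v = \<theta>1 v" "\<tau> J2 v = \<theta>2 v" "\<tau> J3 v = \<theta>3 v" if v: "v \<in> S" for v
  proof -
    have "btrace B (\<lambda>w. J (N v w)) = btrace B (\<lambda>w. J (- ((\<theta>1 v *\<^sub>R J1 w - \<theta>1 w *\<^sub>R J1 v)
       + (\<theta>2 v *\<^sub>R J2 w - \<theta>2 w *\<^sub>R J2 v) + (\<theta>3 v *\<^sub>R J3 w - \<theta>3 w *\<^sub>R J3 v))))" for J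
      by (rule btrace_cong) (simp only: N v BS)
    then show "\<tau> J1 v = \<theta>1 v" "\<tau> J2 v = \<theta>2 v" "\<tau> J3 v = \<theta>3 v"
      unfolding \<tau>_def by (simp_all only: trace_partial[OF l z v]) (use c in simp_all)
  qed
  show ?thesis using vw by (simp add: N \<tau>)
qed

text \<open>The Lie algebra of trace-free endomorphisms commuting with the \<open>J\<^sub>a\<close> up to their span
  has trivial first prolongation.\<close>

lemma prolongation_zero:
  assumes S: "S \<noteq> {0}" and card: "card B \<noteq> 2"
    and sym: "\<And>v w. v \<in> S \<Longrightarrow> w \<in> S \<Longrightarrow> R v w = R w v"
    and R_S: "\<And>v w. v \<in> S \<Longrightarrow> w \<in> S \<Longrightarrow> R v w \<in> S"
    and R_lin: "\<And>w. w \<in> S \<Longrightarrow> lin_on S (\<lambda>v. R v w)"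
    and R_Q: "\<And>J v. J \<in> {J1, J2, J3} \<Longrightarrow> v \<in> S \<Longrightarrow>
      \<exists>a b c. \<forall>w\<in>S. R v (J w) - J (R v w) = a *\<^sub>R J1 w + b *\<^sub>R J2 w + c *\<^sub>R J3 w"
    and trace: "\<And>v. v \<in> S \<Longrightarrow> btrace B (R v) = 0"
    and vw: "v \<in> S" "w \<in> S"
  shows "R v w = 0"
proof -
  have BS: "b \<in> S" if "b \<in> B" for b using that B span_base by blast
  have R_lin2: "lin_on S (R v)" if "v \<in> S" for v
    using R_lin[OF that] sym that unfolding lin_on_def by (auto simp: Scl)
  \<comment> \<open>Taking the commutator with \<open>R v\<close> is a derivation, so
    \<open>K J\<close> obeys the same algebra as the covariant derivative of
    \<open>J\<close>.\<close>
  define K where "K J v w = R v (J w) - J (R v w)" for J v w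
  have "quat_derivation (K J1) (K J2) (K J3)"
    unfolding quat_derivation_def
  proof (intro conjI ballI)
    fix K' assume "K' \<in> {K J1, K J2, K J3}"
    then obtain J where J: "K' = K J" "J \<in> {J1, J2, J3}" by blast
    then have JJ: "lin_on S J" "\<And>v. v \<in> S \<Longrightarrow> J v \<in> S" using lin cl by auto
    show "lin_on S (\<lambda>v. K' v w)" if "w \<in> S" for w
      using that JJ R_S R_lin unfolding J(1) K_def lin_on_def by (simp add: algebra_simps)
    show "\<exists>a b c. \<forall>w\<in>S. K' v w = a *\<^sub>R J1 w + b *\<^sub>R J2 w + c *\<^sub>R J3 w" if "v \<in> S" for v
      using R_Q[OF J(2) that] unfolding J(1) K_def .
  next
    fix v w assume "v \<in> S" "w \<in> S"
    then show "K J1 v (J1 w) + J1 (K J1 v w) = 0" "K J2 v (J2 w) + J2 (K J2 v w) = 0"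
        "K J3 v (J3 w) + J3 (K J3 v w) = 0" "K J1 v (J2 w) + J1 (K J2 v w) = K J3 v w"
      unfolding K_def using R_S by (simp_all add: Scl Jlin Jrel R_lin2[THEN lin_on_minus])
  qed
  from derivation_coefficients[OF S this]
  obtain \<omega>1 \<omega>2 \<omega>3 :: "'v \<Rightarrow> real" where \<omega>: "lin_on S \<omega>1" "lin_on S \<omega>2" "lin_on S \<omega>3"
    "\<forall>v\<in>S. \<forall>w\<in>S. K J1 v w = \<omega>3 v *\<^sub>R J2 w - \<omega>2 v *\<^sub>R J3 w"
    "\<forall>v\<in>S. \<forall>w\<in>S. K J2 v w = \<omega>1 v *\<^sub>R J3 w - \<omega>3 v *\<^sub>R J1 w"
    "\<forall>v\<in>S. \<forall>w\<in>S. K J3 v w = \<omega>2 v *\<^sub>R J1 w - \<omega>1 v *\<^sub>R J2 w" by blast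
  \<comment> \<open>This expression in \<open>K J\<close> is the one that represents a Nijenhuis
    tensor for a torsion-free connection. For commutators with a symmetric \<open>R\<close> its
    terms cancel in pairs.\<close>
  have N0: "K J (J v) w - K J (J w) v - J (K J v w) + J (K J w v) = 0"
    if J: "J \<in> {J1, J2, J3}" and v: "v \<in> S" "w \<in> S" for J v w
  proof -
    have JJ: "lin_on S J" "\<And>v. v \<in> S \<Longrightarrow> J v \<in> S" "\<And>v. v \<in> S \<Longrightarrow> J (J v) = - v" using lin cl sq J by auto
    show ?thesis
      unfolding K_def using v sym[of "J v" "J w"] sym[of "J v" w] sym[of "J w" v] sym[of v w]
      by (simp add: R_S JJ lin_on_diff[OF JJ(1) sub])
  qed
  define \<theta>1 where "\<theta>1 v = 2 * \<omega>1 v + \<omega>3 (J2 v) - \<omega>2 (J3 v)" for v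
  define \<theta>2 where "\<theta>2 v = 2 * \<omega>2 v + \<omega>1 (J3 v) - \<omega>3 (J1 v)" for v
  define \<theta>3 where "\<theta>3 v = 2 * \<omega>3 v + \<omega>2 (J1 v) - \<omega>1 (J2 v)" for v
  note ns = nijenhuis_sum[OF \<omega>, folded \<theta>1_def \<theta>2_def \<theta>3_def]
  have c: "real (card B) - 2 \<noteq> 0" using card by linarith
  have "\<theta>1 v = 0 \<and> \<theta>2 v = 0 \<and> \<theta>3 v = 0" if v: "v \<in> S" for v
  proof -
    have T0: "- ((\<theta>1 v *\<^sub>R J1 w - \<theta>1 w *\<^sub>R J1 v) + (\<theta>2 v *\<^sub>R J2 w - \<theta>2 w *\<^sub>R J2 v) + (\<theta>3 v *\<^sub>R J3 w - \<theta>3 w *\<^sub>R J3 v)) = 0"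
      if w: "w \<in> S" for w
      using ns(1)[OF v w] N0[of J1, OF _ v w] N0[of J2, OF _ v w] N0[of J3, OF _ v w] by simp
    \<comment> \<open>\<open>T0\<close> contains the three forms in combination; composing with one
      of the structures and taking the trace singles out each of them.\<close>
    have "btrace B (\<lambda>w. J (- ((\<theta>1 v *\<^sub>R J1 w - \<theta>1 w *\<^sub>R J1 v) + (\<theta>2 v *\<^sub>R J2 w - \<theta>2 w *\<^sub>R J2 v)
        + (\<theta>3 v *\<^sub>R J3 w - \<theta>3 w *\<^sub>R J3 v)))) = 0" if "J \<in> {J1, J2, J3}" for J
    proof -
      have "lin_on S J" using lin that by auto
      then have "J 0 = 0" using lin_on_zero sub by blast
      then show ?thesis unfolding btrace_def using T0[OF BS] by (intro sum.neutral ballI) (simp add: representation_zero)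
    qed
    from this[of J1] this[of J2] this[of J3]
    have "(real (card B) - 2) * \<theta>1 v = 0" "(real (card B) - 2) * \<theta>2 v = 0" "(real (card B) - 2) * \<theta>3 v = 0"
      unfolding trace_partial[OF ns(3-5) ns(2) v] by blast+
    then show ?thesis using c by simp
  qed
  then have \<theta>: "2 * \<omega>1 v + \<omega>3 (J2 v) - \<omega>2 (J3 v) = 0" "2 * \<omega>2 v + \<omega>1 (J3 v) - \<omega>3 (J1 v) = 0"
      "2 * \<omega>3 v + \<omega>2 (J1 v) - \<omega>1 (J2 v) = 0" if "v \<in> S" for v
    using that unfolding \<theta>1_def \<theta>2_def \<theta>3_def by blast+
  \<comment> \<open>The equations \<open>\<theta> = 0\<close>, evaluated at \<open>J1 v\<close>,
    \<open>J2 v\<close>, \<open>J3 v\<close>, force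
    \<open>\<omega>1 (J1 v) = \<omega>2 (J2 v) = \<omega>3 (J3 v)\<close>. So one covector is left;
    \<beta> is half of it.\<close>
  define \<beta> where "\<beta> v = \<omega>1 (J1 v) / 2" for v
  have eq: "\<omega>2 (J2 v) = \<omega>1 (J1 v)" "\<omega>3 (J3 v) = \<omega>1 (J1 v)" if "v \<in> S" for v
    using \<theta>(1)[of "J1 v"] \<theta>(2)[of "J2 v"] \<theta>(3)[of "J3 v"] that
    by (simp_all add: Scl Jrel \<omega>(1-3)[THEN lin_on_minus])
  have \<beta>_lin: "lin_on S \<beta>"
    unfolding lin_on_def \<beta>_def using \<omega>(1) by (simp add: Scl Jlin lin_on_add lin_on_scale field_simps)
  have \<omega>\<beta>: "\<omega>1 v = - 2 * \<beta> (J1 v)" "\<omega>2 v = - 2 * \<beta> (J2 v)" "\<omega>3 v = - 2 * \<beta> (J3 v)" if "v \<in> S" for v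
    unfolding \<beta>_def using eq[of "J2 v"] eq[of "J3 v"] that by (simp_all add: Scl Jrel \<omega>(1-3)[THEN lin_on_minus])
  \<comment> \<open>The change of a connection under a quaternionic projective transformation with
    covector \<beta>. It is symmetric and has the same commutators with \<open>J1\<close> and
    \<open>J2\<close> as \<open>R\<close>, so \<open>symmetric_quaternionic_zero\<close> applies to
    the difference.\<close>
  define P where "P v w = \<beta> v *\<^sub>R w + \<beta> w *\<^sub>R v - (\<beta> (J1 v) *\<^sub>R J1 w + \<beta> (J1 w) *\<^sub>R J1 v)
     - (\<beta> (J2 v) *\<^sub>R J2 w + \<beta> (J2 w) *\<^sub>R J2 v) - (\<beta> (J3 v) *\<^sub>R J3 w + \<beta> (J3 w) *\<^sub>R J3 v)" for v w
  have P_S: "P v w \<in> S" if "v \<in> S" "w \<in> S" for v w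
    unfolding P_def using that by (simp add: Scl)
  have PK: "P v (J1 w) - J1 (P v w) = K J1 v w" "P v (J2 w) - J2 (P v w) = K J2 v w" if "v \<in> S" "w \<in> S" for v w
    unfolding P_def using that by (simp_all add: \<omega>(4,5) \<omega>\<beta> Scl Jlin Jrel \<beta>_lin[THEN lin_on_minus] algebra_simps scaleR_2 flip: scaleR_scaleR)
  have RP: "R v w - P v w = 0" if "v \<in> S" "w \<in> S" for v w
  proof (rule symmetric_quaternionic_zero[of "\<lambda>v w. R v w - P v w"])
    show "R v w - P v w = R w v - P w v" if "v \<in> S" "w \<in> S" for v w
      using sym[OF that] unfolding P_def by (simp add: algebra_simps)
    show "R v w - P v w \<in> S" if "v \<in> S" "w \<in> S" for v w
      using that by (simp add: Scl R_S P_S)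
    show "R v (J1 w) - P v (J1 w) = J1 (R v w - P v w)" if "v \<in> S" "w \<in> S" for v w
      using PK(1)[OF that] that unfolding K_def by (simp add: Jlin R_S P_S algebra_simps)
    show "R v (J2 w) - P v (J2 w) = J2 (R v w - P v w)" if "v \<in> S" "w \<in> S" for v w
      using PK(2)[OF that] that unfolding K_def by (simp add: Jlin R_S P_S algebra_simps)
  qed (use that in auto)
  note tr = btrace_add[OF B(1,2), unfolded B(3)] btrace_diff[OF B(1,2), unfolded B(3)]
    btrace_scale[OF B(1,2), unfolded B(3)] btrace_id[OF B(1,2)] trace_J
    btrace_rank1[OF B(1,2), unfolded B(3)]
  have lJ: "lin_on S (\<lambda>w. \<beta> (J1 w))" "lin_on S (\<lambda>w. \<beta> (J2 w))" "lin_on S (\<lambda>w. \<beta> (J3 w))"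
    using \<beta>_lin unfolding lin_on_def by (simp_all add: Scl Jlin)
  have "\<beta> v = 0" if v: "v \<in> S" for v
  proof -
    \<comment> \<open>The trace of \<open>P v\<close> collects \<open>card B\<close> times
      \<open>\<beta> v\<close>, once \<open>\<beta> v\<close> from the rank one term, and
      \<open>- \<beta> (J (J v)) = \<beta> v\<close> from each of the three structures.\<close>
    have "0 = btrace B (P v)"
      using trace[OF v] RP[OF v] BS by (simp cong: btrace_cong)
    also have "\<dots> = real (card B) * \<beta> v + \<beta> v - \<beta> (J1 (J1 v)) - \<beta> (J2 (J2 v)) - \<beta> (J3 (J3 v))"
      unfolding P_def using v BS lJ \<beta>_lin by (simp add: tr Scl)
    also have "\<dots> = (real (card B) + 4) * \<beta> v"
      using v by (simp add: Jrel \<beta>_lin[THEN lin_on_minus] algebra_simps)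
    finally show ?thesis by (simp add: add_nonneg_eq_0_iff)
  qed
  then show ?thesis using RP[OF vw] vw unfolding P_def by (simp add: Scl)
qed

end

end

section \<open>Powers of a symplectic form\<close>

text \<open>In a symplectic basis the vectors with indices \<open>2 i\<close> and \<open>2 i + 1\<close> are dual to each other.\<close>

definition partner :: "nat \<Rightarrow> nat" where
  "partner a = (if even a then a + 1 else a - 1)"

definition pair_sign :: "nat \<Rightarrow> real" where
  "pair_sign a = (if even a then 1 else - 1)"

lemma partner_partner [simp]: "partner (partner a) = a"
  by (auto simp: partner_def elim!: oddE)

lemma pair_sign_partner [simp]: "pair_sign (partner a) = - pair_sign a"
  by (auto simp: partner_def pair_sign_def elim!: oddE)

lemma pair_sign_sq [simp]: "pair_sign a * pair_sign a = 1"
  by (simp add: pair_sign_def)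

lemma partner_less: "a < 2 * m \<Longrightarrow> partner a < 2 * m"
  by (auto simp: partner_def elim!: evenE oddE)

text \<open>Such a permutation permutes the pairs and then flips some of them. Exchanging two pairs
  is even, being two transpositions, and each flip contributes -1 both to the sign and to the
  product.\<close>

lemma sign_pairing_permutation:
  "\<sigma> permutes {..<2 * m} \<Longrightarrow> (\<And>i. i < m \<Longrightarrow> \<sigma> (2 * i + 1) = partner (\<sigma> (2 * i)))
    \<Longrightarrow> of_int (sign \<sigma>) * (\<Prod>i<m. pair_sign (\<sigma> (2 * i))) = 1"
proof (induction m arbitrary: \<sigma>)
  case 0
  then show ?case by (simp add: permutes_empty)
next
  case (Suc m)
  have even_case: "of_int (sign \<sigma>) * (\<Prod>i<Suc m. pair_sign (\<sigma> (2 * i))) = 1"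
    if \<sigma>: "\<sigma> permutes {..<2 * Suc m}" and pair: "\<And>i. i < Suc m \<Longrightarrow> \<sigma> (2 * i + 1) = partner (\<sigma> (2 * i))"
      and ev: "even (\<sigma> (2 * m))" for \<sigma>
  proof -
    obtain j where j: "\<sigma> (2 * m) = 2 * j" using ev by (elim evenE)
    have j': "\<sigma> (2 * m + 1) = 2 * j + 1" using pair[of m] j by (simp add: partner_def)
    have jm: "j \<le> m" using permutes_in_image[OF \<sigma>, of "2 * m"] j by simp
    \<comment> \<open>\<tau> exchanges pair \<open>j\<close> with the last pair and keeps the order
      inside both, so that \<open>\<tau> \<circ> \<sigma>\<close> fixes the last pair. It is even:
      two transpositions, or the identity if \<open>j = m\<close>.\<close>
    define \<tau> where "\<tau> = Transposition.transpose (2 * j) (2 * m) \<circ> Transposition.transpose (2 * j + 1) (2 * m + 1)"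
    have \<tau>: "\<tau> permutes {..<2 * Suc m}"
      unfolding \<tau>_def using jm by (intro permutes_compose permutes_swap_id) auto
    have \<tau>_sign: "sign \<tau> = 1"
    proof (cases "j = m")
      case True
      then show ?thesis unfolding \<tau>_def by (simp add: sign_id)
    next
      case False
      then show ?thesis unfolding \<tau>_def by (simp add: sign_compose sign_swap_id permutation_swap_id)
    qed
    have \<tau>_eq: "\<tau> x = (if x = 2 * j then 2 * m else if x = 2 * m then 2 * j else
      if x = 2 * j + 1 then 2 * m + 1 else if x = 2 * m + 1 then 2 * j + 1 else x)" for x
    proof -
      have "2 * j + 1 \<noteq> 2 * m" "2 * m + 1 \<noteq> 2 * j" by presburger+
      then show ?thesis unfolding \<tau>_def by (auto simp: Transposition.transpose_def)
    qed
    have \<tau>_even: "even (\<tau> x) = even x" for x unfolding \<tau>_eq by auto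
    have \<tau>_partner: "\<tau> (partner x) = partner (\<tau> x)" for x
    proof (cases "even x")
      case True
      then obtain y where "x = 2 * y" by (elim evenE)
      moreover have "2 * y + 1 \<noteq> 2 * z" for z by presburger
      ultimately show ?thesis unfolding \<tau>_eq partner_def by auto
    next
      case False
      then obtain y where "x = 2 * y + 1" by (elim oddE)
      moreover have "2 * y + 1 \<noteq> 2 * z" for z by presburger
      ultimately show ?thesis unfolding \<tau>_eq partner_def by auto
    qed
    have "\<tau> \<circ> \<sigma> permutes {..<2 * m}"
    proof (rule permutes_superset[OF permutes_compose[OF \<sigma> \<tau>]])
      fix x assume "x \<in> {..<2 * Suc m} - {..<2 * m}"
      then have "x = 2 * m \<or> x = 2 * m + 1" by auto
      moreover have "2 * m \<noteq> 2 * j + 1" "2 * j \<noteq> 2 * m + 1" by presburger+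
      ultimately show "(\<tau> \<circ> \<sigma>) x = x" using j j' by (auto simp: \<tau>_eq)
    qed
    then have IH: "of_int (sign (\<tau> \<circ> \<sigma>)) * (\<Prod>i<m. pair_sign ((\<tau> \<circ> \<sigma>) (2 * i))) = 1"
      by (rule Suc.IH) (use pair \<tau>_partner in simp)
    have "sign (\<tau> \<circ> \<sigma>) = sign \<sigma>"
      using \<tau> \<sigma> \<tau>_sign by (subst sign_compose) (auto intro: permutes_imp_permutation)
    moreover have "pair_sign ((\<tau> \<circ> \<sigma>) x) = pair_sign (\<sigma> x)" for x
      by (simp add: pair_sign_def \<tau>_even)
    ultimately show ?thesis using IH ev by (simp add: pair_sign_def)
  qed
  show ?case
  proof (cases "even (\<sigma> (2 * m))")
    case True
    then show ?thesis using even_case Suc.prems by blast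
  next
    case False
    \<comment> \<open>The last pair is hit in reversed order. Undoing this changes the sign of
      \<sigma> and that of the last factor, and leads back to the even case.\<close>
    let ?t = "Transposition.transpose (2 * m) (2 * m + 1)"
    have t: "?t permutes {..<2 * Suc m}" by (rule permutes_swap_id) auto
    have o: "(\<sigma> \<circ> ?t) (2 * i) = \<sigma> (2 * i)" "(\<sigma> \<circ> ?t) (2 * i + 1) = \<sigma> (2 * i + 1)" if "i < m" for i
      using that by (auto simp: Transposition.transpose_def)
    have l: "(\<sigma> \<circ> ?t) (2 * m) = partner (\<sigma> (2 * m))" "(\<sigma> \<circ> ?t) (2 * m + 1) = \<sigma> (2 * m)"
      using Suc.prems(2)[of m] by simp_all
    have "of_int (sign (\<sigma> \<circ> ?t)) * (\<Prod>i<Suc m. pair_sign ((\<sigma> \<circ> ?t) (2 * i))) = 1"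
    proof (rule even_case)
      show "\<sigma> \<circ> ?t permutes {..<2 * Suc m}" using permutes_compose[OF t Suc.prems(1)] .
      show "even ((\<sigma> \<circ> ?t) (2 * m))" unfolding l(1) using False by (simp add: partner_def)
      show "(\<sigma> \<circ> ?t) (2 * i + 1) = partner ((\<sigma> \<circ> ?t) (2 * i))" if "i < Suc m" for i
      proof (cases "i = m")
        case True then show ?thesis unfolding True l by simp
      next
        case False
        then show ?thesis using o[of i] Suc.prems(2)[of i] that by simp
      qed
    qed
    moreover have "sign (\<sigma> \<circ> ?t) = - sign \<sigma>"
      using Suc.prems(1) t by (subst sign_compose) (auto intro: permutes_imp_permutation simp: sign_swap_id)
    ultimately show ?thesis using o(1) l(1) by simp
  qed
qed

lemma sum_lessThan_double: "(\<Sum>l<2 * m. f l) = (\<Sum>j<m. f (2 * j) + f (2 * j + 1))" for f :: "nat \<Rightarrow> 'b::comm_monoid_add"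
  by (induction m) (simp_all add: ac_simps)

section \<open>Skew forms and their Pfaffians\<close>

locale skew_form =
  fixes S :: "'v::real_vector set" and W :: "'v \<Rightarrow> 'v \<Rightarrow> real"
  assumes sub: "subspace S"
    and W_lin: "w \<in> S \<Longrightarrow> lin_on S (\<lambda>v. W v w)"
    and W_skew: "v \<in> S \<Longrightarrow> w \<in> S \<Longrightarrow> W v w = - W w v"
begin

lemma W_lin2: assumes v: "v \<in> S" shows "lin_on S (W v)"
  using W_lin[OF v] unfolding lin_on_def
  by (simp add: W_skew[OF v] subspace_add[OF sub] subspace_scale[OF sub])

definition pair_prod :: "nat \<Rightarrow> (nat \<Rightarrow> nat) \<Rightarrow> (nat \<Rightarrow> 'v) \<Rightarrow> real" where
  "pair_prod m \<sigma> vs = (\<Prod>i<m. W (vs (\<sigma> (2 * i))) (vs (\<sigma> (2 * i + 1))))"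

text \<open>For the Gram matrix of \<open>vs\<close> this is \<open>2 ^ m * fact m\<close> times the
  usual Pfaffian; \<open>wedge_power\<close> divides by \<open>2 ^ m\<close>.\<close>

definition pfaffian :: "nat \<Rightarrow> (nat \<Rightarrow> 'v) \<Rightarrow> real" where
  "pfaffian m vs = (\<Sum>\<sigma> | \<sigma> permutes {..<2 * m}. of_int (sign \<sigma>) * pair_prod m \<sigma> vs)"

text \<open>Naming the changed slot as \<open>\<sigma> l\<close> locates it: only the factor
  \<open>l div 2\<close> sees \<open>x\<close>, in first place for even \<open>l\<close> and in
  second place for odd \<open>l\<close>.\<close>

lemma pair_prod_update:
  assumes \<sigma>: "\<sigma> permutes {..<2 * m}" and l: "l < 2 * m"
  shows "pair_prod m \<sigma> (vs(\<sigma> l := x)) =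
    (\<Prod>j\<in>{..<m} - {l div 2}. W (vs (\<sigma> (2 * j))) (vs (\<sigma> (2 * j + 1)))) *
    (if even l then W x (vs (\<sigma> (l + 1))) else W (vs (\<sigma> (l - 1))) x)"
proof -
  have inj: "\<sigma> a = \<sigma> b \<longleftrightarrow> a = b" for a b using permutes_inj[OF \<sigma>] by (auto dest: injD)
  let ?f = "\<lambda>i. W ((vs(\<sigma> l := x)) (\<sigma> (2 * i))) ((vs(\<sigma> l := x)) (\<sigma> (2 * i + 1)))"
  have "pair_prod m \<sigma> (vs(\<sigma> l := x)) = ?f (l div 2) * (\<Prod>j\<in>{..<m} - {l div 2}. ?f j)"
    unfolding pair_prod_def using l by (intro prod.remove) auto
  also have "(\<Prod>j\<in>{..<m} - {l div 2}. ?f j)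
      = (\<Prod>j\<in>{..<m} - {l div 2}. W (vs (\<sigma> (2 * j))) (vs (\<sigma> (2 * j + 1))))"
  proof (rule prod.cong[OF refl])
    fix j assume "j \<in> {..<m} - {l div 2}"
    then have "2 * j \<noteq> l" "2 * j + 1 \<noteq> l" by auto
    then show "?f j = W (vs (\<sigma> (2 * j))) (vs (\<sigma> (2 * j + 1)))" by (simp add: inj)
  qed
  also have "?f (l div 2) = (if even l then W x (vs (\<sigma> (l + 1))) else W (vs (\<sigma> (l - 1))) x)"
    by (auto simp: inj elim!: evenE oddE)
  finally show ?thesis by (simp only: mult.commute)
qed

text \<open>Regrouping slots by factors gives the shape that the product rule produces when
  \<open>pair_prod\<close> is differentiated. This makes the powers of a parallel form
  parallel.\<close>

lemma sum_pair_prod_update: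
  assumes \<sigma>: "\<sigma> permutes {..<2 * m}"
  shows "(\<Sum>i<2 * m. pair_prod m \<sigma> (vs(i := d i))) =
    (\<Sum>j<m. (W (d (\<sigma> (2 * j))) (vs (\<sigma> (2 * j + 1))) + W (vs (\<sigma> (2 * j))) (d (\<sigma> (2 * j + 1)))) *
       (\<Prod>k\<in>{..<m} - {j}. W (vs (\<sigma> (2 * k))) (vs (\<sigma> (2 * k + 1)))))"
proof -
  have "(\<Sum>i<2 * m. pair_prod m \<sigma> (vs(i := d i))) = (\<Sum>l<2 * m. pair_prod m \<sigma> (vs(\<sigma> l := d (\<sigma> l))))"
    using sum.reindex_bij_betw[OF permutes_imp_bij[OF \<sigma>], symmetric] .
  also have "\<dots> = (\<Sum>j<m. pair_prod m \<sigma> (vs(\<sigma> (2 * j) := d (\<sigma> (2 * j))))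
      + pair_prod m \<sigma> (vs(\<sigma> (2 * j + 1) := d (\<sigma> (2 * j + 1)))))"
    by (rule sum_lessThan_double)
  also have "\<dots> = (\<Sum>j<m. (W (d (\<sigma> (2 * j))) (vs (\<sigma> (2 * j + 1))) + W (vs (\<sigma> (2 * j))) (d (\<sigma> (2 * j + 1)))) *
       (\<Prod>k\<in>{..<m} - {j}. W (vs (\<sigma> (2 * k))) (vs (\<sigma> (2 * k + 1)))))"
    by (intro sum.cong refl) (simp add: pair_prod_update[OF \<sigma>] algebra_simps)
  finally show ?thesis .
qed

lemma pfaffian_lin:
  assumes vs: "\<And>j. j < 2 * m \<Longrightarrow> vs j \<in> S" and i: "i < 2 * m"
  shows "lin_on S (\<lambda>x. pfaffian m (vs(i := x)))"
proof -
  have "lin_on S (\<lambda>x. pair_prod m \<sigma> (vs(i := x)))" if \<sigma>: "\<sigma> permutes {..<2 * m}" for \<sigma>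
  proof -
    obtain l where l: "i = \<sigma> l" "l < 2 * m"
      using i permutes_image[OF \<sigma>] by (metis imageE lessThan_iff)
    have im: "\<sigma> a < 2 * m" if "a < 2 * m" for a using permutes_in_image[OF \<sigma>] that by simp
    show ?thesis
    proof (cases "even l")
      case True
      then have "l + 1 < 2 * m" using l by (auto elim!: evenE)
      then have "lin_on S (\<lambda>x. W x (vs (\<sigma> (l + 1))))" using W_lin vs im by blast
      then show ?thesis unfolding l(1) pair_prod_update[OF \<sigma> l(2)] using True by (simp add: lin_on_cmult)
    next
      case False
      have "lin_on S (W (vs (\<sigma> (l - 1))))" using W_lin2 vs im l by (simp add: less_imp_diff_less)
      then show ?thesis unfolding l(1) pair_prod_update[OF \<sigma> l(2)] using False by (simp add: lin_on_cmult)
    qed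
  qed
  then show ?thesis
    unfolding pfaffian_def lin_on_def
    by (auto simp: sum.distrib[symmetric] sum_distrib_left distrib_left mult.left_commute intro!: sum.cong)
qed

lemma pfaffian_transpose:
  assumes ij: "i < 2 * m" "j < 2 * m" "i \<noteq> j"
  shows "pfaffian m (vs \<circ> Transposition.transpose i j) = - pfaffian m vs"
proof -
  have t: "Transposition.transpose i j permutes {..<2 * m}" using ij by (intro permutes_swap_id) auto
  have "pfaffian m vs = (\<Sum>\<sigma> | \<sigma> permutes {..<2 * m}. of_int (sign (Transposition.transpose i j \<circ> \<sigma>)) * pair_prod m (Transposition.transpose i j \<circ> \<sigma>) vs)"
    unfolding pfaffian_def
    by (rule sum.reindex_bij_witness[of _ "\<lambda>\<sigma>. Transposition.transpose i j \<circ> \<sigma>" "\<lambda>\<sigma>. Transposition.transpose i j \<circ> \<sigma>"])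
      (use t in \<open>auto simp: o_assoc intro: permutes_compose\<close>)
  also have "\<dots> = (\<Sum>\<sigma> | \<sigma> permutes {..<2 * m}. - (of_int (sign \<sigma>) * pair_prod m \<sigma> (vs \<circ> Transposition.transpose i j)))"
  proof (rule sum.cong[OF refl])
    fix \<sigma> assume "\<sigma> \<in> {\<sigma>. \<sigma> permutes {..<2 * m}}"
    then have "sign (Transposition.transpose i j \<circ> \<sigma>) = - sign \<sigma>"
      using t ij by (subst sign_compose) (auto intro: permutes_imp_permutation simp: sign_swap_id)
    then show "of_int (sign (Transposition.transpose i j \<circ> \<sigma>)) * pair_prod m (Transposition.transpose i j \<circ> \<sigma>) vs
        = - (of_int (sign \<sigma>) * pair_prod m \<sigma> (vs \<circ> Transposition.transpose i j))"
      by (simp add: pair_prod_def)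
  qed
  finally show ?thesis by (simp add: pfaffian_def sum_negf)
qed

lemma pfaffian_repeated:
  assumes "i < 2 * m" "j < 2 * m" "i \<noteq> j" "vs i = vs j"
  shows "pfaffian m vs = 0"
proof -
  have "vs \<circ> Transposition.transpose i j = vs" using assms(4) by (auto simp: fun_eq_iff Transposition.transpose_def)
  then show ?thesis using pfaffian_transpose[OF assms(1-3), of vs] by simp
qed

text \<open>An endomorphism acts on an alternating form of top degree, as a derivation, by its
  trace: the off-diagonal entries of \<open>a\<close> repeat a vector and drop out.\<close>

lemma pfaffian_trace:
  assumes e: "\<And>j. j < 2 * m \<Longrightarrow> e j \<in> S"
    and x: "\<And>i. i < 2 * m \<Longrightarrow> x i = (\<Sum>j<2 * m. a i j *\<^sub>R e j)"
  shows "(\<Sum>i<2 * m. pfaffian m (e(i := x i))) = (\<Sum>i<2 * m. a i i) * pfaffian m e"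
proof -
  have "pfaffian m (e(i := x i)) = a i i * pfaffian m e" if i: "i < 2 * m" for i
  proof -
    have "pfaffian m (e(i := x i)) = (\<Sum>j<2 * m. a i j * pfaffian m (e(i := e j)))"
      unfolding x[OF i] using lin_on_sum[OF pfaffian_lin[OF e i] sub, where I = "{..<2 * m}" and f = e] e by simp
    also have "\<dots> = (\<Sum>j<2 * m. if j = i then a i i * pfaffian m e else 0)"
    proof (rule sum.cong[OF refl])
      fix j assume "j \<in> {..<2 * m}"
      then show "a i j * pfaffian m (e(i := e j)) = (if j = i then a i i * pfaffian m e else 0)"
        using pfaffian_repeated[of i m j "e(i := e j)"] i by auto
    qed
    finally show ?thesis using i by simp
  qed
  then show ?thesis by (simp add: sum_distrib_right)
qed

section \<open>Symplectic bases\<close>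

definition symplectic_seq :: "nat \<Rightarrow> (nat \<Rightarrow> 'v) \<Rightarrow> bool" where
  "symplectic_seq r e \<longleftrightarrow> (\<forall>a<2 * r. e a \<in> S) \<and>
     (\<forall>a<2 * r. \<forall>b<2 * r. W (e a) (e b) = (if b = partner a then pair_sign a else 0))"

text \<open>A summand is zero unless its permutation sends pairs to pairs, and then it is 1 by
  \<open>sign_pairing_permutation\<close>. The identity is such a permutation.\<close>

lemma pfaffian_symplectic:
  assumes "symplectic_seq m e"
  shows "pfaffian m e > 0"
proof -
  have t: "of_int (sign \<sigma>) * pair_prod m \<sigma> e = (if \<forall>i<m. \<sigma> (2 * i + 1) = partner (\<sigma> (2 * i)) then 1 else 0)"
    if \<sigma>: "\<sigma> permutes {..<2 * m}" for \<sigma>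
  proof -
    have im: "\<sigma> a < 2 * m" if "a < 2 * m" for a using permutes_in_image[OF \<sigma>] that by simp
    have W: "W (e (\<sigma> (2 * i))) (e (\<sigma> (2 * i + 1))) =
        (if \<sigma> (2 * i + 1) = partner (\<sigma> (2 * i)) then pair_sign (\<sigma> (2 * i)) else 0)" if "i < m" for i
      using assms im[of "2 * i"] im[of "2 * i + 1"] that unfolding symplectic_seq_def by simp
    show ?thesis
    proof (cases "\<forall>i<m. \<sigma> (2 * i + 1) = partner (\<sigma> (2 * i))")
      case True
      then have "pair_prod m \<sigma> e = (\<Prod>i<m. pair_sign (\<sigma> (2 * i)))"
        unfolding pair_prod_def using W by (intro prod.cong) auto
      then show ?thesis using sign_pairing_permutation[OF \<sigma>] True by simp
    next
      case False
      then obtain i where "i < m" "\<sigma> (2 * i + 1) \<noteq> partner (\<sigma> (2 * i))" by blast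
      then have "pair_prod m \<sigma> e = 0" unfolding pair_prod_def using W by (intro prod_zero) auto
      then show ?thesis using False by auto
    qed
  qed
  define f where "f \<sigma> = of_int (sign \<sigma>) * pair_prod m \<sigma> e" for \<sigma>
  have "0 \<le> f \<sigma>" if "\<sigma> permutes {..<2 * m}" for \<sigma> using t[OF that] by (simp add: f_def)
  then have "f id \<le> sum f {\<sigma>. \<sigma> permutes {..<2 * m}}"
    using permutes_id[of "{..<2 * m}"] by (intro member_le_sum) (simp_all only: mem_Collect_eq finite_permutations finite_lessThan Diff_iff)
  also have "\<dots> = pfaffian m e" by (simp add: f_def pfaffian_def)
  finally show ?thesis using t[OF permutes_id] by (simp add: f_def partner_def)
qed

lemma span_orthogonal:
  assumes "T \<subseteq> S" "z \<in> S" "\<And>t. t \<in> T \<Longrightarrow> W t z = 0" "u \<in> span T"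
  shows "W u z = 0"
proof -
  have "u \<in> S \<and> W u z = 0"
    using assms(4)
  proof (induction rule: span_induct_alt)
    case base
    show ?case using lin_on_zero[OF W_lin[OF assms(2)] sub] subspace_0[OF sub] by simp
  next
    case (step c x y)
    then show ?case
      using assms lin_on_add[OF W_lin[OF assms(2)], of "c *\<^sub>R x" y] lin_on_scale[OF W_lin[OF assms(2)], of x c]
      by (auto simp: subspace_add[OF sub] subspace_scale[OF sub] subset_iff)
  qed
  then show ?thesis ..
qed

text \<open>Up to sign, \<open>e (partner a)\<close> is dual to \<open>e a\<close>: it is orthogonal
  to all the other members.\<close>

lemma symplectic_seq_independent:
  assumes "symplectic_seq r e"
  shows "inj_on e {..<2 * r}" "independent (e ` {..<2 * r})"
proof -
  have eS: "e a \<in> S" if "a < 2 * r" for a using assms that unfolding symplectic_seq_def by blast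
  have W: "W (e a) (e (partner b)) = (if a = b then pair_sign a else 0)" if "a < 2 * r" "b < 2 * r" for a b
    using assms that partner_less[OF that(2)] unfolding symplectic_seq_def by (metis partner_partner)
  have nz: "pair_sign a \<noteq> 0" for a by (simp add: pair_sign_def)
  show inj: "inj_on e {..<2 * r}"
    by (rule inj_onI) (metis W lessThan_iff nz)
  show "independent (e ` {..<2 * r})"
    unfolding dependent_def
  proof
    assume "\<exists>x\<in>e ` {..<2 * r}. x \<in> span (e ` {..<2 * r} - {x})"
    then obtain a where a: "a \<in> {..<2 * r}" "e a \<in> span (e ` {..<2 * r} - {e a})" by blast
    have "W (e a) (e (partner a)) = 0"
    proof (rule span_orthogonal[OF _ _ _ a(2)])
      show "W t (e (partner a)) = 0" if "t \<in> e ` {..<2 * r} - {e a}" for t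
        using that W a(1) by auto
    qed (use eS partner_less a in auto)
    then show False using W[of a a] nz a(1) by simp
  qed
qed

text \<open>A symplectic sequence of maximal length spans: otherwise a vector outside its span, made
  orthogonal to it, and a partner provided by nondegeneracy would extend it by a pair.\<close>

lemma symplectic_basis:
  assumes B: "finite B" "independent B" "span B = S"
    and nd: "\<forall>v\<in>S. (\<forall>w\<in>S. W v w = 0) \<longrightarrow> v = 0"
  shows "\<exists>r e. symplectic_seq r e \<and> span (e ` {..<2 * r}) = S \<and> card B = 2 * r"
proof -
  have bound: "2 * r \<le> card B" if "symplectic_seq r e" for r e
  proof -
    have "e ` {..<2 * r} \<subseteq> span B" using that B unfolding symplectic_seq_def by auto
    from independent_span_bound[OF B(1) symplectic_seq_independent(2)[OF that] this]
    show ?thesis using card_image[OF symplectic_seq_independent(1)[OF that]] by simp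
  qed
  have "\<exists>e. symplectic_seq 0 e" by (simp add: symplectic_seq_def)
  moreover have "\<forall>r. (\<exists>e. symplectic_seq r e) \<longrightarrow> r \<le> card B" using bound by fastforce
  ultimately have "\<exists>r. (\<exists>e. symplectic_seq r e) \<and> (\<forall>r'. (\<exists>e. symplectic_seq r' e) \<longrightarrow> r' \<le> r)"
    by (rule Nat.ex_has_greatest_nat)
  then obtain r where r: "\<exists>e. symplectic_seq r e" "\<And>r'. \<exists>e. symplectic_seq r' e \<Longrightarrow> r' \<le> r" by blast
  then obtain e where e: "symplectic_seq r e" by blast
  have eS: "e a \<in> S" if "a < 2 * r" for a using e that unfolding symplectic_seq_def by blast
  have We: "W (e a) (e b) = (if b = partner a then pair_sign a else 0)" if "a < 2 * r" "b < 2 * r" for a b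
    using e that unfolding symplectic_seq_def by blast
  have sub_span: "span (e ` {..<2 * r}) \<subseteq> S" using eS sub by (intro span_minimal) auto
  \<comment> \<open>The projection onto the span of the sequence along its orthogonal complement;
    \<open>e (partner a)\<close>, with the sign of the pair, reads off the coefficient of
    \<open>e a\<close>.\<close>
  define pr where "pr x = (\<Sum>a<2 * r. (pair_sign a * W x (e (partner a))) *\<^sub>R e a)" for x
  have pr_S: "x - pr x \<in> S" if "x \<in> S" for x
  proof -
    have "(pair_sign a * W x (e (partner a))) *\<^sub>R e a \<in> S" if "a \<in> {..<2 * r}" for a
      using that eS subspace_scale[OF sub] by blast
    then show ?thesis unfolding pr_def by (rule subspace_diff[OF sub that subspace_sum[OF sub]])
  qed
  have pr_orth: "W (x - pr x) (e b) = 0" if x: "x \<in> S" and b: "b < 2 * r" for x b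
  proof -
    have "W (pr x) (e b) = (\<Sum>a<2 * r. (pair_sign a * W x (e (partner a))) * W (e a) (e b))"
      unfolding pr_def using lin_on_sum[OF W_lin[OF eS[OF b]] sub, where I = "{..<2 * r}" and f = e] eS by simp
    also have "\<dots> = (\<Sum>a<2 * r. if a = partner b then W x (e b) else 0)"
      by (intro sum.cong refl) (use b in \<open>auto simp: We\<close>)
    also have "\<dots> = W x (e b)" using partner_less[OF b] by simp
    finally show ?thesis
      using lin_on_diff[OF W_lin[OF eS[OF b]] sub x, of "pr x"] subspace_diff[OF sub x pr_S[OF x]] by simp
  qed
  have "S \<subseteq> span (e ` {..<2 * r})"
  proof (rule ccontr)
    assume "\<not> S \<subseteq> span (e ` {..<2 * r})"
    then obtain x where x: "x \<in> S" "x \<notin> span (e ` {..<2 * r})" by blast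
    define u where "u = x - pr x"
    have "pr x \<in> span (e ` {..<2 * r})" unfolding pr_def by (intro span_sum span_scale span_base) auto
    then have u: "u \<in> S" "u \<noteq> 0" unfolding u_def using x pr_S by auto
    then obtain y where y: "y \<in> S" "W u y \<noteq> 0" using nd by blast
    \<comment> \<open>Removing \<open>pr y\<close> does not change the pairing with
      \<open>u\<close>, which is orthogonal to the sequence; the factor normalises that pairing to
      1.\<close>
    define z where "z = (1 / W u y) *\<^sub>R (y - pr y)"
    have yS: "y - pr y \<in> S" "pr y \<in> S" using pr_S y subspace_diff[OF sub y(1) pr_S[OF y(1)]] by auto
    have z: "z \<in> S" unfolding z_def using yS subspace_scale[OF sub] by blast
    have ue: "W u (e b) = 0" if "b < 2 * r" for b unfolding u_def using pr_orth x that by blast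
    have ze: "W z (e b) = 0" if "b < 2 * r" for b
      unfolding z_def using lin_on_scale[OF W_lin[OF eS[OF that]] yS(1)] pr_orth y that by simp
    have "W u (pr y) = 0"
      unfolding pr_def using lin_on_sum[OF W_lin2[OF u(1)] sub, where I = "{..<2 * r}" and f = e] eS ue by simp
    then have uz: "W u z = 1"
      unfolding z_def using y yS u by (simp add: lin_on_scale[OF W_lin2] lin_on_diff[OF W_lin2 sub])
    define e' where "e' a = (if a = 2 * r then u else if a = 2 * r + 1 then z else e a)" for a
    have "symplectic_seq (Suc r) e'"
      unfolding symplectic_seq_def
    proof (intro conjI allI impI)
      fix a assume a: "a < 2 * Suc r"
      then have "a < 2 * r \<or> a = 2 * r \<or> a = 2 * r + 1" by presburger
      then show "e' a \<in> S" unfolding e'_def using u(1) z eS[of a] by fastforce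
      fix b assume b: "b < 2 * Suc r"
      have "a < 2 * r \<or> a = 2 * r \<or> a = 2 * r + 1" "b < 2 * r \<or> b = 2 * r \<or> b = 2 * r + 1"
        using a b by presburger+
      then consider "a < 2 * r" "b < 2 * r" | "a < 2 * r" "b = 2 * r" | "a < 2 * r" "b = 2 * r + 1" |
        "a = 2 * r" "b < 2 * r" | "a = 2 * r + 1" "b < 2 * r" | "a = 2 * r" "b = 2 * r" | "a = 2 * r" "b = 2 * r + 1" |
        "a = 2 * r + 1" "b = 2 * r" | "a = 2 * r + 1" "b = 2 * r + 1" by blast
      then show "W (e' a) (e' b) = (if b = partner a then pair_sign a else 0)"
      proof cases
        case 1 then show ?thesis by (simp add: e'_def We)
      next
        case 2 then show ?thesis using partner_less[of a r] W_skew[OF eS u(1), of a] ue by (auto simp: e'_def)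
      next
        case 3 then show ?thesis using partner_less[of a r] W_skew[OF eS z, of a] ze by (auto simp: e'_def)
      next
        case 4 then show ?thesis using ue by (auto simp: e'_def partner_def)
      next
        case 5 then show ?thesis using ze by (auto simp: e'_def partner_def)
      next
        case 6 then show ?thesis using W_skew[OF u(1) u(1)] by (auto simp: e'_def partner_def)
      next
        case 7 then show ?thesis using uz by (auto simp: e'_def partner_def pair_sign_def)
      next
        case 8 then show ?thesis using uz W_skew[OF z u(1)] by (auto simp: e'_def partner_def pair_sign_def)
      next
        case 9 then show ?thesis using W_skew[OF z z] by (auto simp: e'_def partner_def)
      qed
    qed
    then show False using r(2)[of "Suc r"] by auto
  qed
  then have sp: "span (e ` {..<2 * r}) = S" using sub_span by blast
  have "B \<subseteq> span (e ` {..<2 * r})" using B(3) sp span_superset by blast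
  from independent_span_bound[OF _ B(2) this] have "card B \<le> 2 * r"
    using card_image_le[of "{..<2 * r}" e] by simp
  then have "card B = 2 * r" using bound[OF e] by simp
  then show ?thesis using e sp by blast
qed

end

section \<open>Frames, connections and forms\<close>

context manifold
begin

lemma frame_C: "frame p x E \<Longrightarrow> b \<in> Basis \<Longrightarrow> x b \<in> \<C> p"
  and frame_X: "frame p x E \<Longrightarrow> b \<in> Basis \<Longrightarrow> E b \<in> \<X> p"
  unfolding frame_def by blast+

lemma frame_eventually_expand: "frame p x E \<Longrightarrow> \<forall>\<^sub>F q in nhds p. \<forall>v\<in>\<T> q. v = (\<Sum>b\<in>Basis. v (x b) *\<^sub>R E b q)"
  and frame_eventually_dual:
  "frame p x E \<Longrightarrow> \<forall>\<^sub>F q in nhds p. \<forall>b\<in>Basis. \<forall>c\<in>Basis. E b q (x c) = (if b = c then 1 else 0)"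
  unfolding frame_def eventually_conj_iff by blast+

lemma frame_expand: "frame p x E \<Longrightarrow> v \<in> \<T> p \<Longrightarrow> v = (\<Sum>b\<in>Basis. v (x b) *\<^sub>R E b p)"
  using eventually_nhds_x_imp_x[OF frame_eventually_expand] by blast

lemma frame_dual: "frame p x E \<Longrightarrow> b \<in> Basis \<Longrightarrow> c \<in> Basis \<Longrightarrow> E b p (x c) = (if b = c then 1 else 0)"
  using eventually_nhds_x_imp_x[OF frame_eventually_dual] by blast

lemma frame_eventually: assumes f: "frame p x E" shows "\<forall>\<^sub>F q in nhds p. frame q x E"
proof -
  have "\<forall>\<^sub>F q in nhds p. \<forall>b\<in>Basis. x b \<in> \<C> q \<and> E b \<in> \<X> q"
    using C_eventually[OF frame_C[OF f]] X_eventually[OF frame_X[OF f]]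
    by (intro eventually_ball_finite ballI finite_Basis eventually_conj)
  moreover have "\<forall>\<^sub>F q in nhds p. \<forall>\<^sub>F r in nhds q. (\<forall>b\<in>Basis. \<forall>c\<in>Basis. E b r (x c) = (if b = c then 1 else 0)) \<and>
        (\<forall>v\<in>\<T> r. v = (\<Sum>b\<in>Basis. v (x b) *\<^sub>R E b r))"
    using f unfolding frame_def eventually_eventually by blast
  ultimately show ?thesis unfolding frame_def by eventually_elim blast
qed

lemma frame_T: "frame p x E \<Longrightarrow> b \<in> Basis \<Longrightarrow> E b p \<in> \<T> p"
  using X_T frame_X by blast

lemma tangent_basis:
  obtains B where "finite B" "independent B" "span B = \<T> p" "card B = DIM('a)"
proof -
  obtain x E where f: "frame p x E" using frame_exists by blast
  let ?e = "\<lambda>b. E b p"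
  note d = frame_dual[OF f]
  have inj: "inj_on ?e Basis"
    by (rule inj_onI) (metis d zero_neq_one)
  have ind: "independent (?e ` Basis)"
    unfolding dependent_def
  proof
    assume "\<exists>u\<in>?e ` Basis. u \<in> span (?e ` Basis - {u})"
    then obtain b where b: "b \<in> Basis" "E b p \<in> span (?e ` Basis - {E b p})" by blast
    have "u (x b) = 0" if "u \<in> span (?e ` Basis - {E b p})" for u
      using that
    proof (induction rule: span_induct_alt)
      case (step c y z)
      then obtain b' where "b' \<in> Basis" "b' \<noteq> b" "y = E b' p" by blast
      then show ?case using step d b by (simp add: scaleR_fun_def)
    qed simp
    then show False using b d[OF b(1) b(1)] by force
  qed
  have "span (?e ` Basis) = \<T> p"
  proof (rule antisym[OF span_minimal[OF _ T_subspace] subsetI])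
    show "?e ` Basis \<subseteq> \<T> p" using frame_T[OF f] by blast
    fix v assume "v \<in> \<T> p"
    have "(\<Sum>b\<in>Basis. v (x b) *\<^sub>R E b p) \<in> span (?e ` Basis)" by (intro span_sum span_scale span_base) simp
    then show "v \<in> span (?e ` Basis)" using frame_expand[OF f \<open>v \<in> \<T> p\<close>] by simp
  qed
  then show ?thesis using that[of "?e ` Basis"] ind card_image[OF inj] by simp
qed

lemma T_nontrivial: "\<T> p \<noteq> {0}"
proof -
  obtain x E where f: "frame p x E" using frame_exists by blast
  obtain b :: 'a where b: "b \<in> Basis" using nonempty_Basis by blast
  have "E b p (x b) = 1" using frame_dual[OF f b b] by simp
  then have "E b p \<noteq> 0" by auto
  then show ?thesis using frame_T[OF f b] by blast
qed

lemma extension_exists: assumes "v \<in> \<T> p" shows "\<exists>X\<in>\<X> p. X p = v"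
proof -
  obtain x E where f: "frame p x E" using frame_exists by blast
  \<comment> \<open>Constant components in a frame.\<close>
  define X where "X q = (\<Sum>b\<in>Basis. v (x b) *\<^sub>R E b q)" for q
  have "X \<in> \<X> p" unfolding X_def using frame_X[OF f] by (intro X_sum X_cscale)
  moreover have "X p = v" unfolding X_def using frame_expand[OF f assms] by (rule sym)
  ultimately show ?thesis by blast
qed

definition extend :: "'m \<Rightarrow> 'm tvec \<Rightarrow> 'm vfield" where
  "extend p v = (SOME X. X \<in> \<X> p \<and> X p = v)"

lemma extend: "v \<in> \<T> p \<Longrightarrow> extend p v \<in> \<X> p" "v \<in> \<T> p \<Longrightarrow> extend p v p = v"
  using extension_exists[of v p] someI_ex[of "\<lambda>X. X \<in> \<X> p \<and> X p = v"] unfolding extend_def by blast+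

lemma X_expand: assumes "frame p x E" "X \<in> \<X> p" shows "\<forall>\<^sub>F q in nhds p. X q = (\<Sum>b\<in>Basis. X q (x b) *\<^sub>R E b q)"
  using frame_eventually_expand[OF assms(1)] X_eventually[OF assms(2)] by eventually_elim (auto dest: X_T)

lemma X_I:
  assumes f: "frame p x E" and T: "\<forall>\<^sub>F q in nhds p. X q \<in> \<T> q" and C: "\<And>b. b \<in> Basis \<Longrightarrow> (\<lambda>q. X q (x b)) \<in> \<C> p"
  shows "X \<in> \<X> p"
proof (rule X_cong)
  show "(\<lambda>q. \<Sum>b\<in>Basis. X q (x b) *\<^sub>R E b q) \<in> \<X> p" using frame_X[OF f] C by (intro X_sum X_scale)
  show "\<forall>\<^sub>F q in nhds p. (\<Sum>b\<in>Basis. X q (x b) *\<^sub>R E b q) = X q"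
    using frame_eventually_expand[OF f] T by eventually_elim auto
qed

lemma fields_nearE: assumes "X \<in> \<X> p" obtains W where "p \<in> W" "vector_field_on A W X"
  using assms unfolding fields_near_def by blast

text \<open>In \<open>X (Y (f * g))\<close> the terms with one derivative on each factor are
  symmetric in \<open>X\<close> and \<open>Y\<close>, so they disappear from the commutator. The
  facts \<open>1\<close>, \<open>2\<close>, \<open>3\<close> treat both orders of the fields at
  once.\<close>

lemma lie_bracket_T: assumes X: "X \<in> \<X> p" and Y: "Y \<in> \<X> p" shows "lie_bracket A X Y p \<in> \<T> p"
  unfolding tangent_space_def
proof (intro CollectI conjI ballI allI impI)
  note XT = X_T[OF X] and YT = X_T[OF Y]
  note eX = X_eventually[OF X] and eY = X_eventually[OF Y]
  fix f g c assume f: "f \<in> \<C> p"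
  note Xf = X_C[OF X f] and Yf = X_C[OF Y f]
  have 1: "Z p (\<lambda>q. Z' q (\<lambda>r. c * f r)) = c * Z p (\<lambda>q. Z' q f)" if Z: "Z \<in> \<X> p" "Z' \<in> \<X> p" for Z Z'
  proof -
    have "\<forall>\<^sub>F q in nhds p. Z' q (\<lambda>r. c * f r) = c * Z' q f"
      using X_eventually[OF Z(2)] C_eventually[OF f] by eventually_elim (simp add: T_cmult[OF X_T])
    then have "Z p (\<lambda>q. Z' q (\<lambda>r. c * f r)) = Z p (\<lambda>q. c * Z' q f)" by (rule T_cong[OF X_T[OF Z(1)]])
    then show ?thesis using T_cmult[OF X_T[OF Z(1)] X_C[OF Z(2) f]] by simp
  qed
  show "lie_bracket A X Y p (\<lambda>q. c * f q) = c * lie_bracket A X Y p f"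
    using f 1[OF X Y] 1[OF Y X] C_mult[OF C_const f] by (simp add: lie_bracket_def algebra_simps)
  assume g: "g \<in> \<C> p"
  have 2: "Z p (\<lambda>q. Z' q (\<lambda>r. f r + g r)) = Z p (\<lambda>q. Z' q f) + Z p (\<lambda>q. Z' q g)" if Z: "Z \<in> \<X> p" "Z' \<in> \<X> p" for Z Z'
  proof -
    have "\<forall>\<^sub>F q in nhds p. Z' q (\<lambda>r. f r + g r) = Z' q f + Z' q g"
      using X_eventually[OF Z(2)] C_eventually[OF f] C_eventually[OF g] by eventually_elim (simp add: T_add[OF X_T])
    then have "Z p (\<lambda>q. Z' q (\<lambda>r. f r + g r)) = Z p (\<lambda>q. Z' q f + Z' q g)" by (rule T_cong[OF X_T[OF Z(1)]])
    then show ?thesis using T_add[OF X_T[OF Z(1)] X_C[OF Z(2) f] X_C[OF Z(2) g]] by simp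
  qed
  show "lie_bracket A X Y p (\<lambda>q. f q + g q) = lie_bracket A X Y p f + lie_bracket A X Y p g"
    using f g 2[OF X Y] 2[OF Y X] C_add[OF f g] by (simp add: lie_bracket_def algebra_simps)
  have 3: "Z p (\<lambda>q. Z' q (\<lambda>r. f r * g r)) = f p * Z p (\<lambda>q. Z' q g) + Z' p g * Z p f + g p * Z p (\<lambda>q. Z' q f) + Z' p f * Z p g"
    if Z: "Z \<in> \<X> p" "Z' \<in> \<X> p" for Z Z'
  proof -
    have "\<forall>\<^sub>F q in nhds p. Z' q (\<lambda>r. f r * g r) = f q * Z' q g + g q * Z' q f"
      using X_eventually[OF Z(2)] C_eventually[OF f] C_eventually[OF g] by eventually_elim (simp add: T_mult[OF X_T])
    then have "Z p (\<lambda>q. Z' q (\<lambda>r. f r * g r)) = Z p (\<lambda>q. f q * Z' q g + g q * Z' q f)" by (rule T_cong[OF X_T[OF Z(1)]])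
    then show ?thesis
      using X_C[OF Z(2) f] X_C[OF Z(2) g] f g
      by (simp add: T_add[OF X_T[OF Z(1)]] T_mult[OF X_T[OF Z(1)]] C_mult)
  qed
  show "lie_bracket A X Y p (\<lambda>q. f q * g q) = f p * lie_bracket A X Y p g + g p * lie_bracket A X Y p f"
    using f g 3[OF X Y] 3[OF Y X] C_mult[OF f g] by (simp add: lie_bracket_def algebra_simps)
qed (simp add: lie_bracket_def)

text \<open>Near \<open>p\<close> the functions \<open>E c q (x a)\<close> are constant, so every
  component of the bracket vanishes.\<close>

lemma frame_bracket:
  assumes f: "frame p x E" and b: "b \<in> Basis" "c \<in> Basis"
  shows "lie_bracket A (E b) (E c) p = 0"
proof -
  have z: "E b p (\<lambda>q. E c q (x a)) = 0" if "a \<in> Basis" "b \<in> Basis" "c \<in> Basis" for a b c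
  proof -
    have "\<forall>\<^sub>F q in nhds p. E c q (x a) = (if c = a then 1 else 0)"
      using frame_eventually_dual[OF f] that by (auto elim: eventually_mono)
    from T_cong[OF frame_T[OF f that(2)] this] show ?thesis using T_const[OF frame_T[OF f that(2)]] by simp
  qed
  have T: "lie_bracket A (E b) (E c) p \<in> \<T> p" using lie_bracket_T frame_X[OF f] b by blast
  have "lie_bracket A (E b) (E c) p (x a) = 0" if "a \<in> Basis" for a
    using z[OF that] b frame_C[OF f that] by (simp add: lie_bracket_def)
  then show ?thesis using frame_expand[OF f T] by simp
qed

section \<open>Connections\<close>

context
  fixes D assumes D: "connection A D"
begin

lemma D_T: "v \<in> \<T> p \<Longrightarrow> Y \<in> \<X> p \<Longrightarrow> D p v Y \<in> \<T> p"
  and D_addv: "v \<in> \<T> p \<Longrightarrow> w \<in> \<T> p \<Longrightarrow> Y \<in> \<X> p \<Longrightarrow> D p (v + w) Y = D p v Y + D p w Y"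
  and D_scalev: "v \<in> \<T> p \<Longrightarrow> Y \<in> \<X> p \<Longrightarrow> D p (c *\<^sub>R v) Y = c *\<^sub>R D p v Y"
  and D_add: "v \<in> \<T> p \<Longrightarrow> Y \<in> \<X> p \<Longrightarrow> Z \<in> \<X> p \<Longrightarrow> D p v (\<lambda>q. Y q + Z q) = D p v Y + D p v Z"
  and D_leibniz: "v \<in> \<T> p \<Longrightarrow> Y \<in> \<X> p \<Longrightarrow> f \<in> \<C> p \<Longrightarrow> D p v (\<lambda>q. f q *\<^sub>R Y q) = v f *\<^sub>R Y p + f p *\<^sub>R D p v Y"
  using D unfolding connection_def by blast+

lemma D_lin: "Y \<in> \<X> p \<Longrightarrow> lin_on (\<T> p) (\<lambda>v. D p v Y)"
  unfolding lin_on_def by (simp add: D_addv D_scalev)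

lemma D_smooth: assumes "X \<in> \<X> p" "Y \<in> \<X> p" shows "(\<lambda>q. D q (X q) Y) \<in> \<X> p"
proof -
  obtain W1 W2 where W: "p \<in> W1" "p \<in> W2" "vector_field_on A W1 X" "vector_field_on A W2 Y"
    using assms unfolding fields_near_def by blast
  then have "vector_field_on A (W1 \<inter> W2) X" "vector_field_on A (W1 \<inter> W2) Y"
    unfolding vector_field_on_iff by auto
  then have "vector_field_on A (W1 \<inter> W2) (\<lambda>q. D q (X q) Y)" using D unfolding connection_def by blast
  then show ?thesis using W unfolding fields_near_def by blast
qed

lemma D_cscale: "v \<in> \<T> p \<Longrightarrow> Y \<in> \<X> p \<Longrightarrow> D p v (\<lambda>q. c *\<^sub>R Y q) = c *\<^sub>R D p v Y"
  using D_leibniz[of v p Y "\<lambda>q. c"] by (simp add: T_const)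

lemma D_minus: "v \<in> \<T> p \<Longrightarrow> Y \<in> \<X> p \<Longrightarrow> D p v (\<lambda>q. - Y q) = - D p v Y"
  using D_cscale[of v p Y "-1"] by simp

lemma D_zero: "v \<in> \<T> p \<Longrightarrow> D p v (\<lambda>q. 0) = 0"
  using D_cscale[of v p "\<lambda>q. 0" 0] by simp

text \<open>The indicator of the set where \<open>Y\<close> and \<open>Z\<close> agree is smooth
  near \<open>p\<close> with derivative 0; multiplying both fields by it makes them equal
  everywhere, and the Leibniz rule removes it again.\<close>

lemma D_cong:
  assumes v: "v \<in> \<T> p" and Y: "Y \<in> \<X> p" and e: "\<forall>\<^sub>F q in nhds p. Y q = Z q"
  shows "D p v Y = D p v Z"
proof -
  define u where "u q = (if Y q = Z q then 1 else 0 :: real)" for q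
  have uC: "u \<in> \<C> p" using e by (intro C_cong[OF C_const[of 1]]) (auto simp: u_def elim: eventually_mono)
  have "v u = v (\<lambda>q. 1)" using e by (intro T_cong[OF v]) (auto simp: u_def elim: eventually_mono)
  then have vu: "v u = 0" using T_const[OF v] by simp
  have u1: "u p = 1" using eventually_nhds_x_imp_x[OF e] by (simp add: u_def)
  have "(\<lambda>q. u q *\<^sub>R Y q) = (\<lambda>q. u q *\<^sub>R Z q)" by (auto simp: u_def)
  then show ?thesis
    using D_leibniz[OF v Y uC] D_leibniz[OF v X_cong[OF Y e] uC] vu u1 by simp
qed

lemma D_sum:
  assumes "v \<in> \<T> p" "\<And>i. i \<in> I \<Longrightarrow> Y i \<in> \<X> p"
  shows "D p v (\<lambda>q. \<Sum>i\<in>I. Y i q) = (\<Sum>i\<in>I. D p v (Y i))"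
  using assms(2) by (induction I rule: infinite_finite_induct) (auto simp: D_zero assms(1) D_add X_sum)

lemma D_expand:
  assumes f: "frame p x E" and v: "v \<in> \<T> p" and Y: "Y \<in> \<X> p"
  shows "D p v Y = (\<Sum>b\<in>Basis. v (\<lambda>q. Y q (x b)) *\<^sub>R E b p + Y p (x b) *\<^sub>R D p v (E b))"
proof -
  have "D p v Y = D p v (\<lambda>q. \<Sum>b\<in>Basis. Y q (x b) *\<^sub>R E b q)" by (rule D_cong[OF v Y X_expand[OF f Y]])
  then show ?thesis
    using D_sum[OF v, of Basis "\<lambda>b q. Y q (x b) *\<^sub>R E b q"]
    by (simp add: X_scale[OF X_C[OF Y frame_C[OF f]] frame_X[OF f]] D_leibniz[OF v frame_X[OF f] X_C[OF Y frame_C[OF f]]])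
qed

end

text \<open>In a frame the derivatives of the components of \<open>Y\<close> enter both connections
  in the same way; what is left of the difference involves only \<open>Y p\<close>.\<close>

lemma D_diff_tensorial:
  assumes "connection A D" "connection A D'" "v \<in> \<T> p" "Y \<in> \<X> p" "Y' \<in> \<X> p" "Y p = Y' p"
  shows "D p v Y - D' p v Y = D p v Y' - D' p v Y'"
proof -
  obtain x E where f: "frame p x E" using frame_exists by blast
  show ?thesis
    using assms(6) by (simp add: D_expand[OF assms(1) f] D_expand[OF assms(2) f] assms sum_subtractf[symmetric])
qed

section \<open>Two-forms and their powers\<close>

context
  fixes \<omega> assumes \<omega>: "two_form A \<omega>"
begin

lemma form_skew: "skew_form (\<T> p) (\<omega> p)"
proof
  show "subspace (\<T> p)" by (rule T_subspace)
  have 1: "\<omega> p (u + v) w = \<omega> p u w + \<omega> p v w \<and> \<omega> p (c *\<^sub>R v) w = c * \<omega> p v w \<and> \<omega> p v w = - \<omega> p w v"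
    if "u \<in> \<T> p" "v \<in> \<T> p" "w \<in> \<T> p" for u v w c
    using \<omega> that unfolding two_form_def by blast
  show "lin_on (\<T> p) (\<lambda>v. \<omega> p v w)" if "w \<in> \<T> p" for w
    unfolding lin_on_def real_scaleR_def using that 1 by blast
  show "\<omega> p v w = - \<omega> p w v" if "v \<in> \<T> p" "w \<in> \<T> p" for v w
    using 1 that by blast
qed

lemmas form_lin1 = skew_form.W_lin[OF form_skew]
  and form_lin2 = skew_form.W_lin2[OF form_skew]
  and form_swap = skew_form.W_skew[OF form_skew]

lemma form_C: assumes "X \<in> \<X> p" "Y \<in> \<X> p" shows "(\<lambda>q. \<omega> q (X q) (Y q)) \<in> \<C> p"
proof -
  obtain W1 W2 where W: "p \<in> W1" "p \<in> W2" "vector_field_on A W1 X" "vector_field_on A W2 Y"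
    using assms unfolding fields_near_def by blast
  then have "vector_field_on A (W1 \<inter> W2) X" "vector_field_on A (W1 \<inter> W2) Y"
    unfolding vector_field_on_iff by auto
  then have "smooth_fun_on A (W1 \<inter> W2) (\<lambda>q. \<omega> q (X q) (Y q))" using \<omega> unfolding two_form_def by blast
  then show ?thesis using W unfolding smooth_fun_on_iff by blast
qed

lemma cov_deriv_swap:
  assumes "connection A D" "v \<in> \<T> p" "Y \<in> \<X> p" "Z \<in> \<X> p"
  shows "cov_deriv_form2 D \<omega> p v Z Y = - cov_deriv_form2 D \<omega> p v Y Z"
proof -
  have "\<forall>\<^sub>F q in nhds p. \<omega> q (Z q) (Y q) = - \<omega> q (Y q) (Z q)"
    using X_eventually[OF assms(3)] X_eventually[OF assms(4)]
    by eventually_elim (auto intro!: form_swap X_T)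
  then have "v (\<lambda>q. \<omega> q (Z q) (Y q)) = v (\<lambda>q. - \<omega> q (Y q) (Z q))" by (rule T_cong[OF assms(2)])
  then have "v (\<lambda>q. \<omega> q (Z q) (Y q)) = - v (\<lambda>q. \<omega> q (Y q) (Z q))"
    using T_minus[OF assms(2) form_C[OF assms(3,4)]] by simp
  then show ?thesis
    using form_swap[of "D p v Z" p "Y p"] form_swap[of "Z p" p "D p v Y"] D_T[OF assms(1,2)] assms X_T
    by (simp add: cov_deriv_form2_def)
qed

lemma preserves_form_derivative:
  "preserves_form2 A \<omega> D \<Longrightarrow> v \<in> \<T> p \<Longrightarrow> Y \<in> \<X> p \<Longrightarrow> Z \<in> \<X> p \<Longrightarrow>
     v (\<lambda>q. \<omega> q (Y q) (Z q)) = \<omega> p (D p v Y) (Z p) + \<omega> p (Y p) (D p v Z)"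
  unfolding preserves_form2_def cov_deriv_form2_def by fastforce

text \<open>With brackets written as differences of covariant derivatives, the exterior derivative
  becomes the alternation of \<nabla>\<omega>.\<close>

lemma preserves_form_closed:
  assumes D: "connection A D" "preserves_form2 A \<omega> D" "torsion_free A D"
  shows "closed_form A \<omega>"
  unfolding closed_form_def
proof (intro allI ballI)
  fix p X Y Z assume X: "X \<in> \<X> p" "Y \<in> \<X> p" "Z \<in> \<X> p"
  note T = X[THEN X_T]
  have br: "lie_bracket A U V p = D p (U p) V - D p (V p) U" if "U \<in> \<X> p" "V \<in> \<X> p" for U V
    using D(3) that unfolding torsion_free_def torsion_def by (simp add: eq_diff_eq)
  have lin: "\<omega> p (u - v) w = \<omega> p u w - \<omega> p v w" if "u \<in> \<T> p" "v \<in> \<T> p" "w \<in> \<T> p" for u v w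
    using lin_on_diff[OF form_lin1[OF that(3)] T_subspace] that by simp
  note dT = D_T[OF D(1)]
  show "X p (\<lambda>q. \<omega> q (Y q) (Z q)) - Y p (\<lambda>q. \<omega> q (X q) (Z q)) + Z p (\<lambda>q. \<omega> q (X q) (Y q))
        - \<omega> p (lie_bracket A X Y p) (Z p) + \<omega> p (lie_bracket A X Z p) (Y p)
        - \<omega> p (lie_bracket A Y Z p) (X p) = 0"
    using X T form_swap[of "Y p" p "D p (X p) Z"] form_swap[of "X p" p "D p (Y p) Z"] form_swap[of "X p" p "D p (Z p) Y"]
    by (simp add: br lin dT preserves_form_derivative[OF D(2)])
qed

lemma wedge_power_pfaffian:
  "wedge_power \<omega> m p vs = skew_form.pfaffian (\<omega> p) m vs / 2 ^ m"
  unfolding wedge_power_def skew_form.pfaffian_def[OF form_skew] skew_form.pair_prod_def[OF form_skew] ..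

text \<open>The product rule differentiates each summand of the Pfaffian factor by factor, and
  \<open>sum_pair_prod_update\<close> rearranges the outcome slot by slot. Even dimension makes
  \<open>DIM('a) div 2\<close> the exponent of a form of top degree.\<close>

lemma preserves_form_vol:
  assumes D: "connection A D" "preserves_form2 A \<omega> D" and dim: "even (DIM('a))"
  shows "preserves_vol A (vol_form A \<omega>) D"
  unfolding preserves_vol_def
proof (intro allI ballI impI)
  fix p v and Y :: "nat \<Rightarrow> 'm vfield"
  assume v: "v \<in> \<T> p" and Y: "\<forall>i<DIM('a). Y i \<in> \<X> p"
  define m where "m = DIM('a) div 2"
  have m: "DIM('a) = 2 * m" unfolding m_def using dim by simp
  interpret skew_form "\<T> p" "\<omega> p" by (rule form_skew)
  let ?f = "\<lambda>\<sigma> i q. \<omega> q (Y (\<sigma> (2 * i)) q) (Y (\<sigma> (2 * i + 1)) q)"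
  have Y': "Y (\<sigma> l) \<in> \<X> p" if "\<sigma> permutes {..<2 * m}" "l < 2 * m" for \<sigma> l
    using Y permutes_in_image[OF that(1), of l] that(2) m by simp
  have fC: "?f \<sigma> i \<in> \<C> p" if "\<sigma> permutes {..<2 * m}" "i < m" for \<sigma> i
    using Y'[OF that(1)] that(2) by (intro form_C) auto
  have der: "v (\<lambda>q. \<Prod>i<m. ?f \<sigma> i q) = (\<Sum>i<2 * m. pair_prod m \<sigma> ((\<lambda>j. Y j p)(i := D p v (Y i))))"
    if \<sigma>: "\<sigma> permutes {..<2 * m}" for \<sigma>
  proof -
    have "v (\<lambda>q. \<Prod>i<m. ?f \<sigma> i q) = (\<Sum>i<m. v (?f \<sigma> i) * (\<Prod>j\<in>{..<m} - {i}. ?f \<sigma> j p))"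
      using T_prod[OF v, of "{..<m}" "?f \<sigma>"] fC[OF \<sigma>] by simp
    also have "\<dots> = (\<Sum>i<m. (\<omega> p (D p v (Y (\<sigma> (2 * i)))) (Y (\<sigma> (2 * i + 1)) p)
        + \<omega> p (Y (\<sigma> (2 * i)) p) (D p v (Y (\<sigma> (2 * i + 1))))) * (\<Prod>j\<in>{..<m} - {i}. ?f \<sigma> j p))"
    proof (rule sum.cong[OF refl])
      fix i assume "i \<in> {..<m}"
      then have "2 * i < 2 * m" "2 * i + 1 < 2 * m" by auto
      from preserves_form_derivative[OF D(2) v Y'[OF \<sigma> this(1)] Y'[OF \<sigma> this(2)]]
      show "v (?f \<sigma> i) * (\<Prod>j\<in>{..<m} - {i}. ?f \<sigma> j p) = (\<omega> p (D p v (Y (\<sigma> (2 * i)))) (Y (\<sigma> (2 * i + 1)) p)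
        + \<omega> p (Y (\<sigma> (2 * i)) p) (D p v (Y (\<sigma> (2 * i + 1))))) * (\<Prod>j\<in>{..<m} - {i}. ?f \<sigma> j p)" by simp
    qed
    also have "\<dots> = (\<Sum>i<2 * m. pair_prod m \<sigma> ((\<lambda>j. Y j p)(i := D p v (Y i))))"
      using sum_pair_prod_update[OF \<sigma>, of "\<lambda>j. Y j p" "\<lambda>j. D p v (Y j)"] by simp
    finally show ?thesis .
  qed
  define g where "g \<sigma> q = (of_int (sign \<sigma>) / 2 ^ m) * (\<Prod>i<m. ?f \<sigma> i q)" for \<sigma> q
  have "g \<sigma> \<in> \<C> p" if "\<sigma> permutes {..<2 * m}" for \<sigma>
    unfolding g_def using fC[OF that] by (intro C_mult C_const C_prod) auto
  then have "v (\<lambda>q. \<Sum>\<sigma> | \<sigma> permutes {..<2 * m}. g \<sigma> q) = (\<Sum>\<sigma> | \<sigma> permutes {..<2 * m}. v (g \<sigma>))"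
    by (intro T_sum[OF v]) simp
  moreover have "(\<lambda>q. vol_form A \<omega> q (\<lambda>i. Y i q)) = (\<lambda>q. \<Sum>\<sigma> | \<sigma> permutes {..<2 * m}. g \<sigma> q)"
    unfolding vol_form_def m_def[symmetric] wedge_power_def g_def by (simp add: sum_divide_distrib)
  ultimately have "v (\<lambda>q. vol_form A \<omega> q (\<lambda>i. Y i q)) = (\<Sum>\<sigma> | \<sigma> permutes {..<2 * m}. v (g \<sigma>))" by simp
  also have "\<dots> = (\<Sum>\<sigma> | \<sigma> permutes {..<2 * m}. (of_int (sign \<sigma>) / 2 ^ m) *
      (\<Sum>i<2 * m. pair_prod m \<sigma> ((\<lambda>j. Y j p)(i := D p v (Y i)))))"
  proof (rule sum.cong[OF refl])
    fix \<sigma> assume "\<sigma> \<in> {\<sigma>. \<sigma> permutes {..<2 * m}}"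
    then have s: "\<sigma> permutes {..<2 * m}" by simp
    have "(\<lambda>q. \<Prod>i<m. ?f \<sigma> i q) \<in> \<C> p" using fC[OF s] by (intro C_prod) auto
    from T_cmult[OF v this] show "v (g \<sigma>) =
      (of_int (sign \<sigma>) / 2 ^ m) * (\<Sum>i<2 * m. pair_prod m \<sigma> ((\<lambda>j. Y j p)(i := D p v (Y i))))"
      unfolding g_def der[OF s] .
  qed
  also have "\<dots> = (\<Sum>i<2 * m. pfaffian m ((\<lambda>j. Y j p)(i := D p v (Y i))) / 2 ^ m)"
    unfolding pfaffian_def sum_distrib_left sum_divide_distrib by (subst sum.swap) simp
  finally show "v (\<lambda>q. vol_form A \<omega> q (\<lambda>i. Y i q)) =
        (\<Sum>i<DIM('a). vol_form A \<omega> p ((\<lambda>j. Y j p)(i := D p v (Y i))))"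
    unfolding vol_form_def m_def[symmetric] wedge_power_pfaffian by (simp only: m)
qed

end

end

section \<open>Connections preserving an almost quaternionic structure\<close>

text \<open>Otherwise the simplifier turns the index of \<open>J 1\<close> into \<open>Suc 0\<close>.\<close>

declare One_nat_def [simp del]

context manifold
begin

lemma tangent_endo_T: "F \<in> tangent_endos A p \<Longrightarrow> v \<in> \<T> p \<Longrightarrow> F v \<in> \<T> p"
  and tangent_endo_lin: "F \<in> tangent_endos A p \<Longrightarrow> lin_on (\<T> p) F"
  unfolding tangent_endos_def lin_on_def by blast+

lemma endo_field_at: "endo_field_on A W F \<Longrightarrow> p \<in> W \<Longrightarrow> F p \<in> tangent_endos A p"
  unfolding endo_field_on_def by blast

lemma apply_endo_X:
  assumes F: "endo_field_on A W F" "p \<in> W" and X: "X \<in> \<X> p"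
  shows "apply_endo F X \<in> \<X> p"
proof -
  obtain W' where W': "p \<in> W'" "vector_field_on A W' X" using X by (rule fields_nearE)
  then have "vector_field_on A (W \<inter> W') X" using F(1) unfolding vector_field_on_iff endo_field_on_def by auto
  then have "vector_field_on A (W \<inter> W') (apply_endo F X)" using F(1) unfolding endo_field_on_def by blast
  then show ?thesis using W'(1) F(2) by (simp add: vector_field_on_iff)
qed

lemma endo_field_onI:
  assumes "open W" "\<And>p. p \<in> W \<Longrightarrow> F p \<in> tangent_endos A p"
    "\<And>p X. p \<in> W \<Longrightarrow> X \<in> \<X> p \<Longrightarrow> apply_endo F X \<in> \<X> p"
  shows "endo_field_on A W F"
  unfolding endo_field_on_def
proof (intro conjI ballI allI impI)
  fix W' X assume "W' \<subseteq> W" "vector_field_on A W' X"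
  then show "vector_field_on A W' (apply_endo F X)" unfolding vector_field_on_iff using assms(3) by blast
qed (use assms in auto)

text \<open>This is \<open>\<nabla>\<^sub>v F\<close> when \<open>F\<close> belongs to an admissible basis of a structure preserved by the
  connection; otherwise it depends on the choices made by \<open>extend\<close>.\<close>

definition cov_endo :: "'m conn \<Rightarrow> ('m \<Rightarrow> 'm endo) \<Rightarrow> 'm \<Rightarrow> 'm tvec \<Rightarrow> 'm endo" where
  "cov_endo D F p v w = D p v (apply_endo F (extend p w)) - F p (D p v (extend p w))"

context
  fixes Q W J assumes adm: "admissible_basis A Q W J"
begin

lemma adm_endo: "a \<in> {1,2,3} \<Longrightarrow> endo_field_on A W (J a)"
  using adm unfolding admissible_basis_def by blast

lemma adm_open: "open W" using adm_endo[of 1] unfolding endo_field_on_def by simp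

lemma adm_apply: "a \<in> {1,2,3} \<Longrightarrow> p \<in> W \<Longrightarrow> X \<in> \<X> p \<Longrightarrow> apply_endo (J a) X \<in> \<X> p"
  using apply_endo_X adm_endo by blast

lemma adm_near: "p \<in> W \<Longrightarrow> \<forall>\<^sub>F q in nhds p. q \<in> W"
  using adm_open eventually_nhds_in_open by blast

lemma adm_quat:
  assumes p: "p \<in> W"
  shows "quat_space (\<T> p) (J 1 p) (J 2 p) (J 3 p)"
proof -
  have rel: "\<forall>v\<in>\<T> p. (\<forall>a\<in>{1,2,3}. J a p (J a p v) = - v) \<and> J 1 p (J 2 p v) = J 3 p v \<and> J 2 p (J 1 p v) = - J 3 p v"
    using adm p unfolding admissible_basis_def by blast
  have e: "J a p \<in> tangent_endos A p" if "a \<in> {1,2,3}" for a using endo_field_at[OF adm_endo[OF that] p] .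
  show ?thesis
    by unfold_locales
      (use rel T_subspace tangent_endo_T[OF e] tangent_endo_lin[OF e] in simp_all)
qed

lemma adm_Q:
  assumes p: "p \<in> W"
  shows "F \<in> Q p \<longleftrightarrow> (\<exists>a b c. F = a *\<^sub>R J 1 p + b *\<^sub>R J 2 p + c *\<^sub>R J 3 p)"
proof -
  have "Q p = span {J 1 p, J 2 p, J 3 p}" using adm p unfolding admissible_basis_def by blast
  then have "F \<in> Q p \<longleftrightarrow> (\<exists>a b c. F - a *\<^sub>R J 1 p - b *\<^sub>R J 2 p - c *\<^sub>R J 3 p = 0)"
    by (simp add: span_breakdown_eq)
  then show ?thesis by (simp add: algebra_simps)
qed

lemma adm_Q_app:
  assumes p: "p \<in> W" and F: "F \<in> Q p"
  obtains a b c where "\<And>w. F w = a *\<^sub>R J 1 p w + b *\<^sub>R J 2 p w + c *\<^sub>R J 3 p w"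
  using F unfolding adm_Q[OF p] by (auto simp: scaleR_fun_def)

lemma adm_J_Q: assumes "p \<in> W" "a \<in> {1,2,3}" shows "J a p \<in> Q p"
proof -
  have "J a p \<in> span {J 1 p, J 2 p, J 3 p}" using assms(2) by (intro span_base) auto
  then show ?thesis using adm assms(1) unfolding admissible_basis_def by blast
qed

context
  fixes D assumes D: "connection A D" and DQ: "preserves_Q A Q D"
begin

lemma cov_Q:
  assumes p: "p \<in> W" and a: "a \<in> {1,2,3}" and v: "v \<in> \<T> p"
  shows "\<exists>c1 c2 c3. \<forall>Y\<in>\<X> p. D p v (apply_endo (J a) Y) - J a p (D p v Y)
    = c1 *\<^sub>R J 1 p (Y p) + c2 *\<^sub>R J 2 p (Y p) + c3 *\<^sub>R J 3 p (Y p)"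
proof -
  have "\<forall>q\<in>W. J a q \<in> Q q" using adm_J_Q a by blast
  then obtain K where K: "K \<in> Q p" "\<forall>Y\<in>\<X> p. D p v (apply_endo (J a) Y) - J a p (D p v Y) = K (Y p)"
    using DQ adm_endo[OF a] p v unfolding preserves_Q_def by blast
  obtain c1 c2 c3 where "\<And>w. K w = c1 *\<^sub>R J 1 p w + c2 *\<^sub>R J 2 p w + c3 *\<^sub>R J 3 p w"
    by (rule adm_Q_app[OF p K(1)]) blast
  then show ?thesis using K(2) by metis
qed

lemma cov_endo_Q:
  assumes p: "p \<in> W" and a: "a \<in> {1,2,3}" and v: "v \<in> \<T> p"
  obtains c1 c2 c3 where "\<And>w. w \<in> \<T> p \<Longrightarrow> cov_endo D (J a) p v w = c1 *\<^sub>R J 1 p w + c2 *\<^sub>R J 2 p w + c3 *\<^sub>R J 3 p w"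
    "\<And>Y. Y \<in> \<X> p \<Longrightarrow> D p v (apply_endo (J a) Y) - J a p (D p v Y)
      = c1 *\<^sub>R J 1 p (Y p) + c2 *\<^sub>R J 2 p (Y p) + c3 *\<^sub>R J 3 p (Y p)"
proof -
  obtain c1 c2 c3 where c: "\<forall>Y\<in>\<X> p. D p v (apply_endo (J a) Y) - J a p (D p v Y)
    = c1 *\<^sub>R J 1 p (Y p) + c2 *\<^sub>R J 2 p (Y p) + c3 *\<^sub>R J 3 p (Y p)" using cov_Q[OF p a v] by blast
  show ?thesis
  proof (rule that[of c1 c2 c3])
    fix w assume "w \<in> \<T> p"
    then show "cov_endo D (J a) p v w = c1 *\<^sub>R J 1 p w + c2 *\<^sub>R J 2 p w + c3 *\<^sub>R J 3 p w"
      using bspec[OF c extend(1)] extend(2) unfolding cov_endo_def by simp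
  qed (use c in blast)
qed

text \<open>Here the choices made by \<open>extend\<close> drop out: preservation of
  \<open>Q\<close> provides coefficients that serve all fields at once, the chosen extension
  included.\<close>

lemma cov_endo_eq:
  assumes "p \<in> W" "a \<in> {1,2,3}" "v \<in> \<T> p" "Y \<in> \<X> p"
  shows "D p v (apply_endo (J a) Y) = J a p (D p v Y) + cov_endo D (J a) p v (Y p)"
proof -
  obtain c1 c2 c3 where c: "\<And>w. w \<in> \<T> p \<Longrightarrow> cov_endo D (J a) p v w = c1 *\<^sub>R J 1 p w + c2 *\<^sub>R J 2 p w + c3 *\<^sub>R J 3 p w"
    "\<And>Y. Y \<in> \<X> p \<Longrightarrow> D p v (apply_endo (J a) Y) - J a p (D p v Y)
      = c1 *\<^sub>R J 1 p (Y p) + c2 *\<^sub>R J 2 p (Y p) + c3 *\<^sub>R J 3 p (Y p)"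
    by (rule cov_endo_Q[OF assms(1-3)]) blast
  show ?thesis using c(1)[OF X_T[OF assms(4)]] c(2)[OF assms(4)] by (simp add: algebra_simps)
qed

lemma cov_endo_T:
  assumes "p \<in> W" "a \<in> {1,2,3}" "v \<in> \<T> p" "w \<in> \<T> p"
  shows "cov_endo D (J a) p v w \<in> \<T> p"
  unfolding cov_endo_def using assms
  by (intro subspace_diff[OF T_subspace] D_T[OF D] adm_apply extend
      tangent_endo_T[OF endo_field_at[OF adm_endo]])

lemma cov_endo_lin:
  assumes p: "p \<in> W" and a: "a \<in> {1,2,3}" and w: "w \<in> \<T> p"
  shows "lin_on (\<T> p) (\<lambda>v. cov_endo D (J a) p v w)"
proof -
  note e = extend(1)[OF w] and Je = adm_apply[OF a p extend(1)[OF w]]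
  have l: "lin_on (\<T> p) (J a p)" using tangent_endo_lin endo_field_at adm_endo a p by blast
  show ?thesis
    unfolding lin_on_def cov_endo_def
    using e Je D_T[OF D _ e] l
    by (simp add: D_addv[OF D] D_scalev[OF D] lin_on_add lin_on_scale algebra_simps)
qed

text \<open>The quaternion relations hold on the neighbourhood \<open>W\<close> and not just at
  \<open>p\<close>, so \<open>D_cong\<close> allows them to be differentiated.\<close>

lemma cov_endo_derivation:
  assumes p: "p \<in> W"
  shows "quat_space.quat_derivation (\<T> p) (J 1 p) (J 2 p) (J 3 p)
    (cov_endo D (J 1) p) (cov_endo D (J 2) p) (cov_endo D (J 3) p)"
proof -
  interpret quat_space "\<T> p" "J 1 p" "J 2 p" "J 3 p" using adm_quat[OF p] .
  have P: "(\<forall>w\<in>\<T> p. lin_on (\<T> p) (\<lambda>v. cov_endo D (J a) p v w)) \<and>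
      (\<forall>v\<in>\<T> p. \<exists>c1 c2 c3. \<forall>w\<in>\<T> p. cov_endo D (J a) p v w = c1 *\<^sub>R J 1 p w + c2 *\<^sub>R J 2 p w + c3 *\<^sub>R J 3 p w)"
    if a: "a \<in> {1,2,3}" for a
  proof (intro conjI ballI)
    show "lin_on (\<T> p) (\<lambda>v. cov_endo D (J a) p v w)" if "w \<in> \<T> p" for w by (rule cov_endo_lin[OF p a that])
    show "\<exists>c1 c2 c3. \<forall>w\<in>\<T> p. cov_endo D (J a) p v w = c1 *\<^sub>R J 1 p w + c2 *\<^sub>R J 2 p w + c3 *\<^sub>R J 3 p w"
      if "v \<in> \<T> p" for v by (rule cov_endo_Q[OF p a that]) blast
  qed
  show ?thesis
    unfolding quat_derivation_def
  proof (rule conjI, goal_cases)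
    case 1
    show "\<forall>K\<in>{cov_endo D (J 1) p, cov_endo D (J 2) p, cov_endo D (J 3) p}. (\<forall>w\<in>\<T> p. lin_on (\<T> p) (\<lambda>v. K v w)) \<and>
        (\<forall>v\<in>\<T> p. \<exists>a b c. \<forall>w\<in>\<T> p. K v w = a *\<^sub>R J 1 p w + b *\<^sub>R J 2 p w + c *\<^sub>R J 3 p w)"
      using P[OF insertI1] P[OF insertI2[OF insertI1]] P[OF insertI2[OF insertI2[OF insertI1]]]
      by (simp only: ball_simps simp_thms)
  next
    case 2
    show ?case
    proof (intro ballI)
    fix v w assume v: "v \<in> \<T> p" and w: "w \<in> \<T> p"
    define Y where "Y = extend p w"
    have Y: "Y \<in> \<X> p" "Y p = w" unfolding Y_def using extend w by auto
    have near: "\<forall>\<^sub>F q in nhds p. q \<in> W \<and> Y q \<in> \<T> q"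
      using adm_near[OF p] X_eventually[OF Y(1)] by eventually_elim (auto dest: X_T)
    have rel: "J a q (J a q u) = - u" "J 1 q (J 2 q u) = J 3 q u" if "q \<in> W" "u \<in> \<T> q" "a \<in> {1,2,3}" for q u a
      using adm that unfolding admissible_basis_def by blast+
    have JY: "apply_endo (J a) Y \<in> \<X> p" if "a \<in> {1,2,3}" for a using adm_apply[OF that p Y(1)] .
    have DT: "D p v Z \<in> \<T> p" if "Z \<in> \<X> p" for Z using D_T[OF D v that] .
    have sq': "cov_endo D (J a) p v (J a p w) + J a p (cov_endo D (J a) p v w) = 0" if a: "a \<in> {1,2,3}" for a
    proof -
      have l: "lin_on (\<T> p) (J a p)" using tangent_endo_lin endo_field_at adm_endo a p by blast
      have "\<forall>\<^sub>F q in nhds p. apply_endo (J a) (apply_endo (J a) Y) q = - Y q"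
        using near by eventually_elim (simp add: apply_endo_def rel[OF _ _ a])
      then have "D p v (apply_endo (J a) (apply_endo (J a) Y)) = D p v (\<lambda>q. - Y q)"
        by (rule D_cong[OF D v adm_apply[OF a p JY[OF a]]])
      then have 1: "D p v (apply_endo (J a) (apply_endo (J a) Y)) = - D p v Y" using D_minus[OF D v Y(1)] by simp
      have 2: "cov_endo D (J a) p v (J a p w) = - D p v Y - J a p (D p v (apply_endo (J a) Y))"
        using cov_endo_eq[OF p a v JY[OF a]] 1 Y(2) by (simp add: apply_endo_def algebra_simps)
      have "cov_endo D (J a) p v w = D p v (apply_endo (J a) Y) - J a p (D p v Y)"
        using cov_endo_eq[OF p a v Y(1)] Y(2) by simp
      then have "J a p (cov_endo D (J a) p v w) = J a p (D p v (apply_endo (J a) Y)) + D p v Y"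
        using lin_on_diff[OF l T_subspace DT[OF JY[OF a]]] DT[OF Y(1)] tangent_endo_T[OF endo_field_at[OF adm_endo[OF a] p]]
          rel(1)[OF p _ a] by simp
      then show ?thesis using 2 by simp
    qed
    have J12Y: "apply_endo (J 1) (apply_endo (J 2) Y) \<in> \<X> p" by (rule adm_apply[OF _ p JY]) simp_all
    have "\<forall>\<^sub>F q in nhds p. apply_endo (J 1) (apply_endo (J 2) Y) q = apply_endo (J 3) Y q"
      using near by eventually_elim (simp add: apply_endo_def rel(2)[where a = 1])
    then have "D p v (apply_endo (J 1) (apply_endo (J 2) Y)) = D p v (apply_endo (J 3) Y)"
      by (rule D_cong[OF D v J12Y])
    then have "J 1 p (D p v (apply_endo (J 2) Y)) + cov_endo D (J 1) p v (J 2 p w) = J 3 p (D p v Y) + cov_endo D (J 3) p v w"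
      using cov_endo_eq[OF p _ v JY, of 1 2] cov_endo_eq[OF p _ v Y(1), of 3] Y(2) by (simp add: apply_endo_def)
    moreover have "J 1 p (D p v (apply_endo (J 2) Y)) = J 3 p (D p v Y) + J 1 p (cov_endo D (J 2) p v w)"
      using cov_endo_eq[OF p _ v Y(1), of 2] Y(2) DT[OF Y(1)] cov_endo_T[OF p _ v w, of 2] by (simp add: Jlin Jrel Scl)
    ultimately have "cov_endo D (J 1) p v (J 2 p w) + J 1 p (cov_endo D (J 2) p v w) = cov_endo D (J 3) p v w"
      by (simp add: algebra_simps)
    then show "cov_endo D (J 1) p v (J 1 p w) + J 1 p (cov_endo D (J 1) p v w) = 0 \<and>
      cov_endo D (J 2) p v (J 2 p w) + J 2 p (cov_endo D (J 2) p v w) = 0 \<and>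
      cov_endo D (J 3) p v (J 3 p w) + J 3 p (cov_endo D (J 3) p v w) = 0 \<and>
      cov_endo D (J 1) p v (J 2 p w) + J 1 p (cov_endo D (J 2) p v w) = cov_endo D (J 3) p v w"
      using sq'[OF insertI1] sq'[OF insertI2[OF insertI1]] sq'[OF insertI2[OF insertI2[OF insertI1]]] by blast
    qed
  qed
qed

text \<open>Without torsion every bracket is a difference of covariant derivatives. The derivatives
  of \<open>X\<close> and \<open>Y\<close> cancel because \<open>J a\<close> squares to -1, and only
  derivatives of \<open>J a\<close> remain.\<close>

lemma nijenhuis_cov_endo:
  assumes tf: "torsion_free A D" and p: "p \<in> W" and a: "a \<in> {1,2,3}" and X: "X \<in> \<X> p" "Y \<in> \<X> p"
  shows "nijenhuis A (J a) X Y p = cov_endo D (J a) p (J a p (X p)) (Y p) - cov_endo D (J a) p (J a p (Y p)) (X p)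
    - J a p (cov_endo D (J a) p (X p) (Y p)) + J a p (cov_endo D (J a) p (Y p) (X p))"
proof -
  have br: "lie_bracket A U V p = D p (U p) V - D p (V p) U" if "U \<in> \<X> p" "V \<in> \<X> p" for U V
    using tf that unfolding torsion_free_def torsion_def by (simp add: eq_diff_eq)
  note JX = adm_apply[OF a p X(1)] adm_apply[OF a p X(2)]
  note T = X[THEN X_T] JX[THEN X_T, unfolded apply_endo_def]
  have l: "lin_on (\<T> p) (J a p)" using tangent_endo_lin endo_field_at adm_endo a p by blast
  have JT: "J a p u \<in> \<T> p" if "u \<in> \<T> p" for u using tangent_endo_T[OF endo_field_at[OF adm_endo[OF a] p] that] .
  have sq: "J a p (J a p u) = - u" if "u \<in> \<T> p" for u using adm p a that unfolding admissible_basis_def by blast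
  have app: "apply_endo (J a) Z p = J a p (Z p)" for Z by (simp add: apply_endo_def)
  note c = cov_endo_eq[OF p a]
  note m = subspace_add[OF T_subspace] subspace_diff[OF T_subspace] cov_endo_T[OF p a] D_T[OF D] T X JX JT
  show ?thesis
    unfolding nijenhuis_def br[OF JX] br[OF JX(1) X(2)] br[OF X(1) JX(2)] br[OF X] app
    by (simp add: c T X m lin_on_add[OF l] lin_on_diff[OF l T_subspace] sq)
qed

text \<open>Carries \<open>obata_partial\<close> over to the manifold; the work lies in matching the
  choices hidden in \<open>trace_on\<close> and \<open>tensor_at\<close>.\<close>

lemma oproiu_torsion_zero:
  assumes tf: "torsion_free A D" and dim: "DIM('a) \<noteq> 2" and p: "p \<in> W" and X: "X \<in> \<X> p" "Y \<in> \<X> p"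
  shows "oproiu_torsion A J X Y p = 0"
proof -
  interpret quat_space "\<T> p" "J 1 p" "J 2 p" "J 3 p" using adm_quat[OF p] .
  obtain B0 where B0: "finite B0" "independent B0" "span B0 = \<T> p" "card B0 = DIM('a)" by (rule tangent_basis)
  obtain B where B: "finite B" "independent B" "span B = \<T> p" "B \<subseteq> \<T> p" "card B = card B0"
    "trace_on (\<T> p) = btrace B"
    by (rule trace_on_btrace[OF B0(1) B0(3)[symmetric] B0(2)])
  let ?K = "\<lambda>a. cov_endo D (J a) p"
  let ?N = "\<lambda>a v w. ?K a (J a p v) w - ?K a (J a p w) v - J a p (?K a v w) + J a p (?K a w v)"
  define N where "N v w = (1 / 6) *\<^sub>R (?N 1 v w + ?N 2 v w + ?N 3 v w)" for v w
  have ob: "obata_torsion A J X Y p = N (X p) (Y p)" if "X \<in> \<X> p" "Y \<in> \<X> p" for X Y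
    unfolding obata_torsion_def N_def
    using nijenhuis_cov_endo[OF tf p _ that] by (simp add: add.assoc)
  \<comment> \<open>The Obata torsion depends only on the values at \<open>p\<close> by
    \<open>ob\<close>, and fields with prescribed values exist, so the definite description in
    \<open>tensor_at\<close> denotes.\<close>
  have tensor: "tensor_at A (obata_torsion A J) p v w = N v w" if v: "v \<in> \<T> p" "w \<in> \<T> p" for v w
    unfolding tensor_at_def
  proof (rule the_equality)
    show "\<forall>X\<in>\<X> p. \<forall>Y\<in>\<X> p. X p = v \<longrightarrow> Y p = w \<longrightarrow> obata_torsion A J X Y p = N v w" using ob by blast
    show "u = N v w" if "\<forall>X\<in>\<X> p. \<forall>Y\<in>\<X> p. X p = v \<longrightarrow> Y p = w \<longrightarrow> obata_torsion A J X Y p = u" for u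
      using that ob[OF extend(1)[OF v(1)] extend(1)[OF v(2)]] extend v by metis
  qed
  have form: "oproiu_form A J a p v = btrace B (\<lambda>w. J a p (N v w)) / (real (card B) - 2)" if v: "v \<in> \<T> p" for a v
  proof -
    have "btrace B (\<lambda>w. J a p (tensor_at A (obata_torsion A J) p v w)) = btrace B (\<lambda>w. J a p (N v w))"
      by (rule btrace_cong) (use tensor[OF v] B(4) in auto)
    then show ?thesis unfolding oproiu_form_def B(6) B(5) B0(4) by simp
  qed
  have "card B \<noteq> 2" using B(5) B0(4) dim by simp
  note o = obata_partial[OF B(1-3) T_nontrivial cov_endo_derivation[OF p] this X_T[OF X(1)] X_T[OF X(2)]]
  have s3: "(\<Sum>a\<in>{1,2,3::nat}. g a) = g 1 + (g 2 + g 3)" for g :: "nat \<Rightarrow> 'm tvec" by simp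
  show ?thesis
    unfolding oproiu_torsion_def ob[OF X] s3 form[OF X_T[OF X(1)]] form[OF X_T[OF X(2)]] N_def
    using o by (simp only: add.assoc)
qed

end

end

text \<open>The difference \<open>R\<close> of the connections is a tensor. Equal torsions make it
  symmetric, preserving \<open>Q\<close> makes its commutators with the basis lie in
  \<open>Q\<close>, and preserving the volume makes it trace-free, so it lies in the prolongation
  that \<open>prolongation_zero\<close> kills.\<close>

lemma prolongation_unique:
  assumes aq: "almost_quaternionic A Q" and \<omega>: "two_form A \<omega>" "nondegenerate A \<omega>" and dim: "even (DIM('a))" "DIM('a) \<noteq> 2"
    and D: "connection A D" "preserves_Q A Q D" "preserves_vol A (vol_form A \<omega>) D"
    and D': "connection A D'" "preserves_Q A Q D'" "preserves_vol A (vol_form A \<omega>) D'"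
    and tor: "\<And>p X Y. X \<in> \<X> p \<Longrightarrow> Y \<in> \<X> p \<Longrightarrow> torsion A D X Y p = torsion A D' X Y p"
  shows "connection_eq A D D'"
proof -
  have main: "D p v Y - D' p v Y = 0" if v: "v \<in> \<T> p" and Y: "Y \<in> \<X> p" for p v Y
  proof -
    obtain W J where p: "p \<in> W" and adm: "admissible_basis A Q W J" using aq unfolding almost_quaternionic_def by blast
    interpret quat_space "\<T> p" "J 1 p" "J 2 p" "J 3 p" using adm_quat[OF adm p] .
    interpret skew_form "\<T> p" "\<omega> p" by (rule form_skew[OF \<omega>(1)])
    define R where "R v w = D p v (extend p w) - D' p v (extend p w)" for v w
    have RY: "D p v Y - D' p v Y = R v (Y p)" if "v \<in> \<T> p" "Y \<in> \<X> p" for v Y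
      unfolding R_def using that X_T[OF that(2)]
      by (intro D_diff_tensorial[OF D(1) D'(1) that(1,2)]) (auto simp: extend)
    have R_S: "R v w \<in> \<T> p" if "v \<in> \<T> p" "w \<in> \<T> p" for v w
      unfolding R_def using that by (intro Scl D_T[OF D(1)] D_T[OF D'(1)] extend)
    have R_lin: "lin_on (\<T> p) (\<lambda>v. R v w)" if "w \<in> \<T> p" for w
      unfolding lin_on_def R_def using extend(1)[OF that]
      by (simp add: D_addv[OF D(1)] D_addv[OF D'(1)] D_scalev[OF D(1)] D_scalev[OF D'(1)] algebra_simps)
    have R_sym: "R v w = R w v" if "v \<in> \<T> p" "w \<in> \<T> p" for v w
      using tor[OF extend(1)[OF that(1)] extend(1)[OF that(2)]] that
      unfolding torsion_def R_def by (simp add: extend algebra_simps)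
    obtain m where m: "DIM('a) = 2 * m" using dim(1) by (elim evenE)
    obtain B0 where B0: "finite B0" "independent B0" "span B0 = \<T> p" "card B0 = DIM('a)" by (rule tangent_basis)
    obtain r e where e: "symplectic_seq r e" "span (e ` {..<2 * r}) = \<T> p" "card B0 = 2 * r"
      using symplectic_basis[OF B0(1-3)] \<omega>(2) unfolding nondegenerate_def by blast
    have rm: "r = m" using e(3) B0(4) m by simp
    note inj = symplectic_seq_independent(1)[OF e(1)] and ind = symplectic_seq_independent(2)[OF e(1)]
    have eT: "e i \<in> \<T> p" if "i < 2 * m" for i using e(1) that unfolding symplectic_seq_def rm by blast
    let ?B = "e ` {..<2 * m}"
    have B: "finite ?B" "independent ?B" "span ?B = \<T> p" using ind e(2) unfolding rm by auto
    have card: "card ?B = DIM('a)" using card_image[OF inj] m unfolding rm by simp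
    have trace: "btrace ?B (R v) = 0" if v: "v \<in> \<T> p" for v
    proof -
      define Z where "Z i = extend p (e i)" for i
      have Z: "Z i \<in> \<X> p" "Z i p = e i" if "i < 2 * m" for i unfolding Z_def using extend eT that by auto
      define x where "x i = D p v (Z i)" for i
      define x' where "x' i = D' p v (Z i)" for i
      define f where "f i y = pfaffian m ((\<lambda>j. Z j p)(i := y))" for i y
      have vs: "Z j p \<in> \<T> p" if "j < 2 * m" for j using Z eT that by simp
      have xT: "x i \<in> \<T> p" "x' i \<in> \<T> p" if "i < 2 * m" for i
        unfolding x_def x'_def using Z that v by (auto intro: D_T[OF D(1)] D_T[OF D'(1)])
      have Z': "\<forall>i<DIM('a). Z i \<in> \<X> p" using Z m by simp
      have vol: "vol_form A \<omega> q vs = pfaffian m vs / 2 ^ m" if "q = p" for q vs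
        unfolding vol_form_def wedge_power_pfaffian[OF \<omega>(1)] that using m by simp
      \<comment> \<open>The derivative of the volume of the fields \<open>Z\<close> along
        \<open>v\<close> is the same function value for both connections, so the two expansions may
        be equated.\<close>
      have "(\<Sum>i<2 * m. f i (x i) / 2 ^ m) = (\<Sum>i<2 * m. f i (x' i) / 2 ^ m)"
        using D(3)[unfolded preserves_vol_def, rule_format, OF v, of Z]
          D'(3)[unfolded preserves_vol_def, rule_format, OF v, of Z] Z'
        unfolding f_def x_def x'_def m[symmetric] by (simp add: vol)
      then have eq: "(\<Sum>i<2 * m. f i (x i)) = (\<Sum>i<2 * m. f i (x' i))"
        by (simp add: sum_divide_distrib[symmetric])
      have f_diff: "f i (x i - x' i) = f i (x i) - f i (x' i)" if "i < 2 * m" for i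
        unfolding f_def using lin_on_diff[OF pfaffian_lin[OF vs that] T_subspace xT(1)[OF that] xT(2)[OF that]] by simp
      have "(\<Sum>i<2 * m. f i (R v (e i))) = (\<Sum>i<2 * m. f i (x i) - f i (x' i))"
        by (rule sum.cong[OF refl]) (use f_diff in \<open>simp add: R_def x_def x'_def Z_def\<close>)
      then have 0: "(\<Sum>i<2 * m. f i (R v (e i))) = 0" using eq by (simp add: sum_subtractf)
      define a where "a i j = representation ?B (R v (e i)) (e j)" for i j
      have Re: "R v (e i) = (\<Sum>j<2 * m. a i j *\<^sub>R e j)" if "i < 2 * m" for i
      proof -
        have "R v (e i) = (\<Sum>b\<in>?B. representation ?B (R v (e i)) b *\<^sub>R b)"
          using representation_expand[OF B(1,2), of "R v (e i)"] B(3) R_S[OF v eT[OF that]] by simp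
        also have "\<dots> = (\<Sum>j<2 * m. a i j *\<^sub>R e j)"
          unfolding a_def by (subst sum.reindex) (use inj rm in auto)
        finally show ?thesis .
      qed
      \<comment> \<open>\<open>Z j p = e j\<close> is known only for \<open>j < 2 * m\<close>; the
        permutations in the Pfaffian stay inside this range.\<close>
      have "f i y = pfaffian m (e(i := y))" if "i < 2 * m" for i y
      proof -
        have "pair_prod m \<sigma> ((\<lambda>j. Z j p)(i := y)) = pair_prod m \<sigma> (e(i := y))" if \<sigma>: "\<sigma> permutes {..<2 * m}" for \<sigma>
        proof -
          have "((\<lambda>j. Z j p)(i := y)) (\<sigma> l) = (e(i := y)) (\<sigma> l)" if "l < 2 * m" for l
            using Z permutes_in_image[OF \<sigma>, of l] that by simp
          then show ?thesis unfolding pair_prod_def by (intro prod.cong) auto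
        qed
        then show ?thesis unfolding f_def pfaffian_def by (intro sum.cong) auto
      qed
      then have "(\<Sum>i<2 * m. pfaffian m (e(i := R v (e i)))) = 0" using 0 by simp
      then have "(\<Sum>i<2 * m. a i i) * pfaffian m e = 0" using pfaffian_trace[OF eT Re] by simp
      \<comment> \<open>Here the volume must not vanish: on a symplectic basis it is
        positive.\<close>
      then have "(\<Sum>i<2 * m. a i i) = 0" using pfaffian_symplectic e(1) rm by fastforce
      then show ?thesis
        unfolding btrace_def a_def by (subst sum.reindex) (use inj rm in auto)
    qed
    have R_Q: "\<exists>a b c. \<forall>w\<in>\<T> p. R v (F w) - F (R v w) = a *\<^sub>R J 1 p w + b *\<^sub>R J 2 p w + c *\<^sub>R J 3 p w"
      if F: "F \<in> {J 1 p, J 2 p, J 3 p}" and v: "v \<in> \<T> p" for F v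
    proof -
      have "\<exists>i\<in>{1,2,3}. F = J i p" using F by blast
      then obtain i where i: "i \<in> {1,2,3}" "F = J i p" by blast
      have l: "lin_on (\<T> p) F" using lin F by auto
      obtain a b c where 1: "\<And>Y. Y \<in> \<X> p \<Longrightarrow> D p v (apply_endo (J i) Y) - J i p (D p v Y)
        = a *\<^sub>R J 1 p (Y p) + b *\<^sub>R J 2 p (Y p) + c *\<^sub>R J 3 p (Y p)"
        using cov_Q[OF adm D(1,2) p i(1) v] by blast
      obtain a' b' c' where 2: "\<And>Y. Y \<in> \<X> p \<Longrightarrow> D' p v (apply_endo (J i) Y) - J i p (D' p v Y)
        = a' *\<^sub>R J 1 p (Y p) + b' *\<^sub>R J 2 p (Y p) + c' *\<^sub>R J 3 p (Y p)"
        using cov_Q[OF adm D'(1,2) p i(1) v] by blast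
      have "R v (F w) - F (R v w) = (a - a') *\<^sub>R J 1 p w + (b - b') *\<^sub>R J 2 p w + (c - c') *\<^sub>R J 3 p w" if w: "w \<in> \<T> p" for w
      proof -
        define Y where "Y = extend p w"
        have Y: "Y \<in> \<X> p" "Y p = w" unfolding Y_def using extend w by auto
        have JY: "apply_endo (J i) Y \<in> \<X> p" using adm_apply[OF adm i(1) p Y(1)] .
        have "R v (F w) = D p v (apply_endo (J i) Y) - D' p v (apply_endo (J i) Y)"
          using RY[OF v JY] Y(2) i(2) by (simp add: apply_endo_def)
        moreover have "F (R v w) = F (D p v Y) - F (D' p v Y)"
          using RY[OF v Y(1)] Y(2) lin_on_diff[OF l T_subspace D_T[OF D(1) v Y(1)] D_T[OF D'(1) v Y(1)]] by simp
        ultimately have "R v (F w) - F (R v w) = (D p v (apply_endo (J i) Y) - J i p (D p v Y))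
            - (D' p v (apply_endo (J i) Y) - J i p (D' p v Y))" using i(2) by simp
        also have "\<dots> = (a - a') *\<^sub>R J 1 p w + (b - b') *\<^sub>R J 2 p w + (c - c') *\<^sub>R J 3 p w"
          unfolding 1[OF Y(1)] 2[OF Y(1)] Y(2) by (simp add: algebra_simps)
        finally show ?thesis .
      qed
      then show ?thesis by blast
    qed
    have "R v (Y p) = 0"
      by (rule prolongation_zero[OF B T_nontrivial _ R_sym R_S R_lin R_Q trace v X_T[OF Y]])
        (use card dim in simp)
    then show ?thesis using RY[OF v Y] by simp
  qed
  then show ?thesis unfolding connection_eq_def by (metis eq_iff_diff_eq_0)
qed

end

section \<open>Torsion-free adapted connections are minimal and unique\<close>

context manifold
begin

context
  fixes Q \<omega> assumes qsH: "almost_qsH A Q \<omega>"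
begin

lemma qsH_quaternionic: "almost_quaternionic A Q"
  and qsH_two_form: "two_form A \<omega>"
  and qsH_nondegenerate: "nondegenerate A \<omega>"
  using qsH unfolding almost_qsH_def by blast+

lemma qsH_hermitian:
  "admissible_basis A Q W J \<Longrightarrow> p \<in> W \<Longrightarrow> a \<in> {1,2,3} \<Longrightarrow> v \<in> \<T> p \<Longrightarrow> w \<in> \<T> p \<Longrightarrow>
     \<omega> p (J a p v) (J a p w) = \<omega> p v w"
  using qsH unfolding almost_qsH_def by blast

lemma qsH_basis: obtains W J where "p \<in> W" "admissible_basis A Q W J"
  using qsH_quaternionic unfolding almost_quaternionic_def by blast

lemma assumes F: "F \<in> Q p"
  shows Q_T: "v \<in> \<T> p \<Longrightarrow> F v \<in> \<T> p" and Q_lin: "lin_on (\<T> p) F"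
proof -
  obtain W J where W: "p \<in> W" "admissible_basis A Q W J" by (rule qsH_basis)
  interpret quat_space "\<T> p" "J 1 p" "J 2 p" "J 3 p" using adm_quat[OF W(2,1)] .
  obtain a b c where F: "\<And>w. F w = a *\<^sub>R J 1 p w + b *\<^sub>R J 2 p w + c *\<^sub>R J 3 p w"
    by (rule adm_Q_app[OF W(2,1) assms(1)]) blast
  show "F v \<in> \<T> p" if "v \<in> \<T> p" unfolding F using that by (intro Scl)
  show "lin_on (\<T> p) F" unfolding F[abs_def] lin_on_def by (simp add: Jlin algebra_simps)
qed

text \<open>Invariance of \<omega> under a structure that squares to -1 amounts to skewness with
  respect to \<omega>, and skewness is a linear condition, so it passes to all of
  \<open>Q p\<close>.\<close>

lemma Q_skew:
  assumes F: "F \<in> Q p" and v: "v \<in> \<T> p" "w \<in> \<T> p"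
  shows "\<omega> p (F v) w = - \<omega> p v (F w)"
proof -
  obtain W J where W: "p \<in> W" "admissible_basis A Q W J" by (rule qsH_basis)
  interpret quat_space "\<T> p" "J 1 p" "J 2 p" "J 3 p" using adm_quat[OF W(2,1)] .
  obtain a b c where F: "\<And>w. F w = a *\<^sub>R J 1 p w + b *\<^sub>R J 2 p w + c *\<^sub>R J 3 p w"
    by (rule adm_Q_app[OF W(2,1) assms(1)]) blast
  note l = form_lin1[OF qsH_two_form] form_lin2[OF qsH_two_form]
  note la = l[THEN lin_on_add] l[THEN lin_on_scale] l[THEN lin_on_minus]
  have J: "\<omega> p (J i p v) w = - \<omega> p v (J i p w)" if i: "i \<in> {1,2,3}" and v: "v \<in> \<T> p" "w \<in> \<T> p" for i v w
  proof -
    have JT: "J i p u \<in> \<T> p" if "u \<in> \<T> p" for u using cl i that by auto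
    have "J i p (J i p v) = - v" using sq v(1) i by auto
    then show ?thesis using qsH_hermitian[OF W(2,1) i JT[OF v(1)] v(2)] la(5)[of "J i p w" p v] JT v by simp
  qed
  have J': "\<omega> p (J 1 p v) w = - \<omega> p v (J 1 p w)" "\<omega> p (J 2 p v) w = - \<omega> p v (J 2 p w)"
    "\<omega> p (J 3 p v) w = - \<omega> p v (J 3 p w)" using J[OF _ v] by simp_all
  show ?thesis unfolding F using v by (simp add: la Scl J')
qed

lemma qsH_zero:
  assumes "u \<in> \<T> p" "\<And>Z. Z \<in> \<X> p \<Longrightarrow> \<omega> p u (Z p) = 0"
  shows "u = 0"
proof -
  have "\<omega> p u w = 0" if "w \<in> \<T> p" for w using assms(2)[OF extend(1)[OF that]] extend(2)[OF that] by simp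
  then show ?thesis using qsH_nondegenerate assms(1) unfolding nondegenerate_def by blast
qed

text \<open>The correction acts on both arguments of \<omega> and, since \<nabla>\<omega> is skew,
  each of them contributes half of it. This accounts for the factor 1/2 in the definition.\<close>

lemma minimal_adapted_preserves_form:
  assumes D: "minimal_adapted A Q \<omega> D"
  shows "preserves_form2 A \<omega> D"
  unfolding preserves_form2_def
proof (intro allI ballI)
  fix p v Y Z assume v: "v \<in> \<T> p" and Y: "Y \<in> \<X> p" "Z \<in> \<X> p"
  obtain D0 where D0: "unimodular_oproiu A Q (vol_form A \<omega>) D0"
    and c: "\<And>Y Z. Y \<in> \<X> p \<Longrightarrow> Z \<in> \<X> p \<Longrightarrow> \<omega> p (D p v Y - D0 p v Y) (Z p) = cov_deriv_form2 D0 \<omega> p v Y Z / 2"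
    using D v unfolding minimal_adapted_def by blast
  have con: "connection A D" "connection A D0"
    using D D0 unfolding minimal_adapted_def unimodular_oproiu_def by blast+
  note T = D_T[OF con(1) v] D_T[OF con(2) v] X_T
  have lin: "\<omega> p (x - y) z = \<omega> p x z - \<omega> p y z" if "x \<in> \<T> p" "y \<in> \<T> p" "z \<in> \<T> p" for x y z
    using lin_on_diff[OF form_lin1[OF qsH_two_form that(3)] T_subspace] that by simp
  have "\<omega> p (D p v Y) (Z p) = \<omega> p (D0 p v Y) (Z p) + cov_deriv_form2 D0 \<omega> p v Y Z / 2"
    using c[OF Y] lin T Y by simp
  moreover have "\<omega> p (D p v Z) (Y p) = \<omega> p (D0 p v Z) (Y p) - cov_deriv_form2 D0 \<omega> p v Y Z / 2"
    using c[OF Y(2,1)] lin T Y cov_deriv_swap[OF qsH_two_form con(2) v Y] by simp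
  then have "\<omega> p (Y p) (D p v Z) = \<omega> p (Y p) (D0 p v Z) + cov_deriv_form2 D0 \<omega> p v Y Z / 2"
    using form_swap[OF qsH_two_form X_T[OF Y(1)] T(1)[OF Y(2)]] form_swap[OF qsH_two_form X_T[OF Y(1)] T(2)[OF Y(2)]] by simp
  ultimately show "cov_deriv_form2 D \<omega> p v Y Z = 0"
    unfolding cov_deriv_form2_def[of D] by (simp add: cov_deriv_form2_def)
qed

text \<open>A section \<open>F\<close> and its derivative \<open>K\<close> along \<open>D0\<close>
  are both skew for \<omega>, which makes the derivative of \<omega> along \<open>D0\<close> skew
  under \<open>F\<close> as well. By nondegeneracy the correction commutes with \<open>F\<close>, so
  \<open>F\<close> has the same derivative \<open>K\<close> along \<open>D\<close>.\<close>

lemma minimal_adapted_preserves_Q: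
  assumes D: "minimal_adapted A Q \<omega> D"
  shows "preserves_Q A Q D"
  unfolding preserves_Q_def
proof (intro allI impI ballI)
  fix W F p v assume F: "endo_field_on A W F" and FQ: "\<forall>p\<in>W. F p \<in> Q p" and p: "p \<in> W" and v: "v \<in> \<T> p"
  obtain D0 where D0: "unimodular_oproiu A Q (vol_form A \<omega>) D0"
    and c: "\<And>Y Z. Y \<in> \<X> p \<Longrightarrow> Z \<in> \<X> p \<Longrightarrow> \<omega> p (D p v Y - D0 p v Y) (Z p) = cov_deriv_form2 D0 \<omega> p v Y Z / 2"
    using D v unfolding minimal_adapted_def by blast
  have con: "connection A D" "connection A D0" "preserves_Q A Q D0"
    using D D0 unfolding minimal_adapted_def unimodular_oproiu_def by blast+
  obtain K where K: "K \<in> Q p" "\<And>Y. Y \<in> \<X> p \<Longrightarrow> D0 p v (apply_endo F Y) - F p (D0 p v Y) = K (Y p)"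
    using con(3) F FQ p v unfolding preserves_Q_def by blast
  note T = D_T[OF con(1) v] D_T[OF con(2) v] X_T
  note FX = apply_endo_X[OF F p]
  have app: "apply_endo F Y p = F p (Y p)" for Y by (simp add: apply_endo_def)
  have Fp: "F p \<in> Q p" using FQ p by blast
  note l = form_lin1[OF qsH_two_form] form_lin2[OF qsH_two_form]
  have near: "\<forall>\<^sub>F q in nhds p. q \<in> W"
    using F p eventually_nhds_in_open unfolding endo_field_on_def by blast
  have "D p v (apply_endo F Y) - F p (D p v Y) = K (Y p)" if Y: "Y \<in> \<X> p" for Y
  proof -
    let ?A = "\<lambda>Y. D p v Y - D0 p v Y"
    have AT: "?A Y \<in> \<T> p" if "Y \<in> \<X> p" for Y using that T by (intro subspace_diff[OF T_subspace])
    have "?A (apply_endo F Y) - F p (?A Y) = 0"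
    proof (rule qsH_zero)
      show "?A (apply_endo F Y) - F p (?A Y) \<in> \<T> p"
        using AT[OF FX[OF Y]] Q_T[OF Fp AT[OF Y]] by (rule subspace_diff[OF T_subspace])
      fix Z assume Z: "Z \<in> \<X> p"
      have "\<forall>\<^sub>F q in nhds p. \<omega> q (apply_endo F Y q) (Z q) = - \<omega> q (Y q) (apply_endo F Z q)"
        using near X_eventually[OF Y] X_eventually[OF Z]
        by eventually_elim (use FQ in \<open>auto simp: apply_endo_def intro!: Q_skew X_T\<close>)
      from T_cong[OF v this] have 1: "v (\<lambda>q. \<omega> q (apply_endo F Y q) (Z q)) = - v (\<lambda>q. \<omega> q (Y q) (apply_endo F Z q))"
        using T_minus[OF v form_C[OF qsH_two_form Y FX[OF Z]]] by simp
      have D0F: "D0 p v (apply_endo F Y) = F p (D0 p v Y) + K (Y p)" if "Y \<in> \<X> p" for Y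
        using K(2)[OF that] by (simp add: algebra_simps)
      have e1: "\<omega> p (D0 p v (apply_endo F Y)) (Z p) = \<omega> p (F p (D0 p v Y)) (Z p) + \<omega> p (K (Y p)) (Z p)"
        unfolding D0F[OF Y] by (rule lin_on_add[OF l(1)]) (use T Y Z Q_T[OF Fp] Q_T[OF K(1)] in auto)
      have e2: "\<omega> p (Y p) (D0 p v (apply_endo F Z)) = \<omega> p (Y p) (F p (D0 p v Z)) + \<omega> p (Y p) (K (Z p))"
        unfolding D0F[OF Z] by (rule lin_on_add[OF l(2)]) (use T Y Z Q_T[OF Fp] Q_T[OF K(1)] in auto)
      have "cov_deriv_form2 D0 \<omega> p v (apply_endo F Y) Z + cov_deriv_form2 D0 \<omega> p v Y (apply_endo F Z) = 0"
        unfolding cov_deriv_form2_def app 1 e1 e2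
        using Q_skew[OF Fp T(2)[OF Y] X_T[OF Z]] Q_skew[OF Fp X_T[OF Y] T(2)[OF Z]] Q_skew[OF K(1) X_T[OF Y] X_T[OF Z]]
        by simp
      then have "\<omega> p (?A (apply_endo F Y)) (Z p) = - \<omega> p (?A Y) (apply_endo F Z p)"
        unfolding c[OF FX[OF Y] Z] c[OF Y FX[OF Z]] by simp
      also have "\<dots> = \<omega> p (F p (?A Y)) (Z p)"
        using Q_skew[OF Fp AT[OF Y] X_T[OF Z]] by (simp add: app)
      finally show "\<omega> p (?A (apply_endo F Y) - F p (?A Y)) (Z p) = 0"
        using lin_on_diff[OF l(1)[OF X_T[OF Z]] T_subspace AT[OF FX[OF Y]] Q_T[OF Fp AT[OF Y]]] by simp
    qed
    then show ?thesis
      using K(2)[OF Y] lin_on_diff[OF Q_lin[OF Fp] T_subspace T(1)[OF Y] T(2)[OF Y]]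
      by (simp add: algebra_simps)
  qed
  then show "\<exists>K\<in>Q p. \<forall>Y\<in>\<X> p. D p v (apply_endo F Y) - F p (D p v Y) = K (Y p)" using K(1) by blast
qed

context
  fixes D n
  assumes dim: "DIM('a) = 4 * n"
    and D: "connection A D" "preserves_Q A Q D" "preserves_form2 A \<omega> D" "torsion_free A D"
begin

text \<open>Evenness is for \<open>vol_form\<close>, \<open>DIM('a) \<noteq> 2\<close> for the
  denominator of \<open>oproiu_form\<close>.\<close>

lemma dim_even: "even (DIM('a))" "DIM('a) \<noteq> 2"
  using dim by presburger+

lemma adapted_oproiu_torsion:
  "admissible_basis A Q W J \<Longrightarrow> p \<in> W \<Longrightarrow> X \<in> \<X> p \<Longrightarrow> Y \<in> \<X> p \<Longrightarrow> oproiu_torsion A J X Y p = 0"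
  using oproiu_torsion_zero[OF _ D(1,2,4) dim_even(2)] .

lemma adapted_unimodular: "unimodular_oproiu A Q (vol_form A \<omega>) D"
  unfolding unimodular_oproiu_def
  using D adapted_oproiu_torsion preserves_form_vol[OF qsH_two_form D(1,3) dim_even(1)]
  by (auto simp: torsion_free_def)

text \<open>\<open>D\<close> serves as its own \<open>D0\<close>, because it is unimodular Oproiu
  and its correction term vanishes.\<close>

lemma adapted_minimal: "minimal_adapted A Q \<omega> D"
  unfolding minimal_adapted_def
proof (intro conjI exI[of _ D] allI ballI)
  fix p v Y Z assume a: "v \<in> \<T> p" "Y \<in> \<X> p" "Z \<in> \<X> p"
  have "\<omega> p 0 (Z p) = 0" using lin_on_zero[OF form_lin1[OF qsH_two_form X_T[OF a(3)]] T_subspace] .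
  then show "\<omega> p (D p v Y - D p v Y) (Z p) = cov_deriv_form2 D \<omega> p v Y Z / 2"
    using D(3) a unfolding preserves_form2_def by simp
qed (use D adapted_unimodular in auto)

lemma adapted_unimodular_unique:
  assumes D': "unimodular_oproiu A Q (vol_form A \<omega>) D'"
  shows "connection_eq A D D'"
proof (rule prolongation_unique[OF qsH_quaternionic qsH_two_form qsH_nondegenerate dim_even D(1,2)])
  show "preserves_vol A (vol_form A \<omega>) D" using adapted_unimodular unfolding unimodular_oproiu_def by blast
  show "connection A D'" "preserves_Q A Q D'" "preserves_vol A (vol_form A \<omega>) D'"
    using D' unfolding unimodular_oproiu_def by blast+
  show "torsion A D X Y p = torsion A D' X Y p" if X: "X \<in> \<X> p" "Y \<in> \<X> p" for p X Y
  proof -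
    obtain W J where W: "p \<in> W" "admissible_basis A Q W J" by (rule qsH_basis)
    then have "torsion A D' X Y p = oproiu_torsion A J X Y p" using D' X unfolding unimodular_oproiu_def by blast
    then show ?thesis using adapted_oproiu_torsion[OF W(2,1) X] D(4) X unfolding torsion_free_def by simp
  qed
qed

text \<open>The Oproiu connection underlying \<open>D'\<close> agrees with \<open>D\<close>, for
  which \<omega> is parallel; hence the correction in \<open>D'\<close> is zero.\<close>

lemma adapted_minimal_unique:
  assumes D': "minimal_adapted A Q \<omega> D'"
  shows "connection_eq A D D'"
  unfolding connection_eq_def
proof (intro allI ballI)
  fix p v Y assume v: "v \<in> \<T> p" and Y: "Y \<in> \<X> p"
  obtain D0 where D0: "unimodular_oproiu A Q (vol_form A \<omega>) D0"
    and c: "\<And>Z. Z \<in> \<X> p \<Longrightarrow> \<omega> p (D' p v Y - D0 p v Y) (Z p) = cov_deriv_form2 D0 \<omega> p v Y Z / 2"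
    using D' v Y unfolding minimal_adapted_def by blast
  have con: "connection A D'" "connection A D0"
    using D' D0 unfolding minimal_adapted_def unimodular_oproiu_def by blast+
  have e: "D0 p v Z = D p v Z" if "Z \<in> \<X> p" for Z
    using adapted_unimodular_unique[OF D0] v that unfolding connection_eq_def by simp
  have "D' p v Y - D0 p v Y = 0"
  proof (rule qsH_zero)
    show "D' p v Y - D0 p v Y \<in> \<T> p" using D_T[OF con(1) v Y] D_T[OF con(2) v Y] by (rule subspace_diff[OF T_subspace])
    fix Z assume Z: "Z \<in> \<X> p"
    have "cov_deriv_form2 D0 \<omega> p v Y Z = cov_deriv_form2 D \<omega> p v Y Z"
      unfolding cov_deriv_form2_def e[OF Y] e[OF Z] ..
    then show "\<omega> p (D' p v Y - D0 p v Y) (Z p) = 0"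
      using c[OF Z] D(3) v Y Z unfolding preserves_form2_def by simp
  qed
  then show "D p v Y = D' p v Y" using e[OF Y] by simp
qed

end

end

end

section \<open>Immersions\<close>

lemma scaleR_fun_apply: "(c *\<^sub>R f) x = c *\<^sub>R f x"
  by (simp add: scaleR_fun_def)

context manifold
begin

text \<open>Gaussian elimination over the local ring of germs of smooth functions.\<close>

lemma smooth_solution:
  fixes M :: "'i \<Rightarrow> 'j \<Rightarrow> 'm \<Rightarrow> real"
  assumes "finite J" "\<And>i j. i \<in> I \<Longrightarrow> j \<in> J \<Longrightarrow> M i j \<in> \<C> p" "\<And>i. i \<in> I \<Longrightarrow> w i \<in> \<C> p"
    "\<And>i. i \<in> I \<Longrightarrow> \<forall>\<^sub>F q in nhds p. w i q = (\<Sum>j\<in>J. y j q * M i j q)"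
    "\<And>c. (\<forall>i\<in>I. (\<Sum>j\<in>J. c j * M i j p) = 0) \<Longrightarrow> \<forall>j\<in>J. c j = 0"
  shows "\<forall>j\<in>J. y j \<in> \<C> p"
  using assms
proof (induction J arbitrary: M w rule: finite_induct)
  case (insert k J)
  have "\<exists>l\<in>I. M l k p \<noteq> 0"
  proof (rule ccontr)
    assume "\<not> (\<exists>l\<in>I. M l k p \<noteq> 0)"
    then have "(\<Sum>j\<in>insert k J. (if j = k then 1 else 0) * M i j p) = 0" if "i \<in> I" for i
      using that insert.hyps by (auto intro!: sum.neutral)
    then show False using insert.prems(4)[of "\<lambda>j. if j = k then 1 else 0"] by simp
  qed
  then obtain l where l: "l \<in> I" "M l k p \<noteq> 0" by blast
  have nz: "\<forall>\<^sub>F q in nhds p. M l k q \<noteq> 0" using C_nonzero insert.prems(1) l by blast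
  define r where "r i q = M i k q / M l k q" for i q
  have r: "r i \<in> \<C> p" if "i \<in> I" for i
    unfolding r_def using insert.prems(1) l that by (intro C_divide) auto
  \<comment> \<open>One elimination step with pivot row \<open>l\<close> and pivot column
    \<open>k\<close>; the multiplier \<open>r i\<close> is smooth because the pivot is nonzero at
    \<open>p\<close>.\<close>
  define M' where "M' i j q = M i j q - r i q * M l j q" for i j q
  define w' where "w' i q = w i q - r i q * w l q" for i q
  have "\<forall>j\<in>J. y j \<in> \<C> p"
  proof (rule insert.IH[of M' w'])
    show "M' i j \<in> \<C> p" if "i \<in> I" "j \<in> J" for i j
      unfolding M'_def using insert.prems(1) l r that by (intro C_diff C_mult) auto
    show "w' i \<in> \<C> p" if "i \<in> I" for i
      unfolding w'_def using insert.prems(2) l r that by (intro C_diff C_mult) auto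
    show "\<forall>\<^sub>F q in nhds p. w' i q = (\<Sum>j\<in>J. y j q * M' i j q)" if "i \<in> I" for i
      using insert.prems(3)[OF that] insert.prems(3)[OF l(1)] nz
    proof eventually_elim
      case (elim q)
      then have "r i q * M l k q = M i k q" by (simp add: r_def)
      then have "r i q * (y k q * M l k q) = y k q * M i k q" by (metis mult.left_commute)
      then show ?case
        using insert.hyps unfolding w'_def M'_def elim(1,2)
        by (auto simp add: distrib_left right_diff_distrib sum_subtractf sum_distrib_left mult.left_commute)
    qed
    fix c assume c: "\<forall>i\<in>I. (\<Sum>j\<in>J. c j * M' i j p) = 0"
    \<comment> \<open>A kernel vector of the reduced system becomes one of the full system when its
      entry at \<open>k\<close> is solved for from the pivot row.\<close>
    define d where "d j = (if j = k then - (\<Sum>j\<in>J. c j * M l j p) / M l k p else c j)" for j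
    have "\<forall>j\<in>insert k J. d j = 0"
    proof (rule insert.prems(4), rule ballI)
      fix i assume i: "i \<in> I"
      have "(\<Sum>j\<in>J. d j * M i j p) = (\<Sum>j\<in>J. c j * M i j p)"
        using insert.hyps by (intro sum.cong) (auto simp: d_def)
      moreover have "(\<Sum>j\<in>J. c j * M i j p) = r i p * (\<Sum>j\<in>J. c j * M l j p)"
        using bspec[OF c i] unfolding M'_def
        by (simp add: right_diff_distrib sum_subtractf sum_distrib_left mult.left_commute)
      moreover have "d k * M i k p = - (r i p * (\<Sum>j\<in>J. c j * M l j p))" by (simp add: d_def r_def)
      ultimately show "(\<Sum>j\<in>insert k J. d j * M i j p) = 0" using insert.hyps by simp
    qed
    then show "\<forall>j\<in>J. c j = 0" using insert.hyps by (auto simp: d_def split: if_splits)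
  qed
  moreover have "y k \<in> \<C> p"
  proof (rule C_cong)
    show "(\<lambda>q. (w l q - (\<Sum>j\<in>J. y j q * M l j q)) / M l k q) \<in> \<C> p"
      using insert.prems(1,2) l calculation by (intro C_divide C_diff C_sum C_mult) auto
    show "\<forall>\<^sub>F q in nhds p. (w l q - (\<Sum>j\<in>J. y j q * M l j q)) / M l k q = y k q"
      using insert.prems(3)[OF l(1)] nz by eventually_elim (use insert.hyps in simp)
  qed
  ultimately show ?case by simp
qed simp

text \<open>The coefficients of a section \<open>F = \<Sum> c\<^sub>a J\<^sub>a\<close> are smooth because \<open>F J\<^sub>a + J\<^sub>a F = - 2 c\<^sub>a\<close>.\<close>

lemma section_coefficients:
  assumes adm: "admissible_basis A Q W' J" "p \<in> W'"
    and F: "endo_field_on A W F" "\<forall>q\<in>W. F q \<in> Q q" "p \<in> W"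
  obtains c where "\<And>a. a \<in> {1,2,3} \<Longrightarrow> c a \<in> \<C> p"
    "\<forall>\<^sub>F q in nhds p. \<forall>w. F q w = c 1 q *\<^sub>R J 1 q w + c 2 q *\<^sub>R J 2 q w + c (3::nat) q *\<^sub>R J 3 q w"
proof -
  obtain x E where f: "frame p x E" using frame_exists by blast
  obtain b :: 'a where b: "b \<in> Basis" using nonempty_Basis by blast
  define c where "c a q = (- 1 / 2) * (F q (J a q (E b q)) (x b) + J a q (F q (E b q)) (x b))" for a q
  have near: "\<forall>\<^sub>F q in nhds p. q \<in> W \<inter> W'"
    using F(1,3) adm_near[OF adm] eventually_nhds_in_open[of W p] unfolding endo_field_on_def
    by (auto intro: eventually_conj)
  have "c a \<in> \<C> p" if a: "a \<in> {1,2,3}" for a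
  proof -
    have "apply_endo F (apply_endo (J a) (E b)) \<in> \<X> p" "apply_endo (J a) (apply_endo F (E b)) \<in> \<X> p"
      using apply_endo_X[OF F(1,3)] adm_apply[OF adm(1) a adm(2)] frame_X[OF f b] by blast+
    from this[THEN X_C[OF _ frame_C[OF f b]]] show ?thesis
      unfolding c_def apply_endo_def by (intro C_mult C_add C_const)
  qed
  moreover have "\<forall>\<^sub>F q in nhds p. \<forall>w. F q w = c 1 q *\<^sub>R J 1 q w + c 2 q *\<^sub>R J 2 q w + c 3 q *\<^sub>R J 3 q w"
    using near frame_eventually[OF f]
  proof eventually_elim
    case (elim q)
    then have q: "q \<in> W'" "F q \<in> Q q" using F(2) by auto
    interpret quat_space "\<T> q" "J 1 q" "J 2 q" "J 3 q" using adm_quat[OF adm(1) q(1)] .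
    obtain c1 c2 c3 where F': "\<And>w. F q w = c1 *\<^sub>R J 1 q w + c2 *\<^sub>R J 2 q w + c3 *\<^sub>R J 3 q w"
      by (rule adm_Q_app[OF adm(1) q]) blast
    let ?e = "E b q"
    have e: "?e \<in> \<T> q" "?e (x b) = 1" using frame_T[OF elim(2) b] frame_dual[OF elim(2) b b] by auto
    have c: "c a q = (- 1 / 2) * ((F q (J a q ?e) + J a q (F q ?e)) (x b))" for a by (simp add: c_def)
    have "F q (J 1 q ?e) + J 1 q (F q ?e) = - (c1 *\<^sub>R ?e) - c1 *\<^sub>R ?e"
      "F q (J 2 q ?e) + J 2 q (F q ?e) = - (c2 *\<^sub>R ?e) - c2 *\<^sub>R ?e"
      "F q (J 3 q ?e) + J 3 q (F q ?e) = - (c3 *\<^sub>R ?e) - c3 *\<^sub>R ?e"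
      using e(1) unfolding F' by (simp_all add: Scl Jlin Jrel algebra_simps)
    then have "c 1 q = c1" "c 2 q = c2" "c 3 q = c3" unfolding c using e(2) by (simp_all add: scaleR_fun_apply)
    then show ?case using F' by simp
  qed
  ultimately show ?thesis by (rule that)
qed

text \<open>An arbitrary section is a combination of the basis with smooth coefficients. By the
  Leibniz rule its derivative adds multiples \<open>v (c a)\<close> of the basis itself, which lie
  in \<open>Q p\<close> again.\<close>

lemma preserves_Q_I:
  assumes D: "connection A D"
    and loc: "\<And>p. \<exists>W J. p \<in> W \<and> admissible_basis A Q W J \<and> (\<forall>a\<in>{1,2,3}. \<forall>v\<in>\<T> p. \<exists>K\<in>Q p. \<forall>Y\<in>\<X> p.
       D p v (apply_endo (J a) Y) - J a p (D p v Y) = K (Y p))"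
  shows "preserves_Q A Q D"
  unfolding preserves_Q_def
proof (intro allI impI ballI)
  fix W F p v assume F: "endo_field_on A W F" "\<forall>p\<in>W. F p \<in> Q p" "p \<in> W" and v: "v \<in> \<T> p"
  obtain W' J where adm: "admissible_basis A Q W' J" "p \<in> W'"
    and K: "\<forall>a\<in>{1,2,3}. \<forall>v\<in>\<T> p. \<exists>K\<in>Q p. \<forall>Y\<in>\<X> p. D p v (apply_endo (J a) Y) - J a p (D p v Y) = K (Y p)"
    using loc[of p] by blast
  obtain K where K: "\<And>a. a \<in> {1,2,3} \<Longrightarrow> K a \<in> Q p"
    "\<And>a Y. a \<in> {1,2,3} \<Longrightarrow> Y \<in> \<X> p \<Longrightarrow> D p v (apply_endo (J a) Y) = J a p (D p v Y) + K a (Y p)"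
  proof -
    have "\<forall>a\<in>{1,2,3}. \<exists>K\<in>Q p. \<forall>Y\<in>\<X> p. D p v (apply_endo (J a) Y) - J a p (D p v Y) = K (Y p)" using K v by blast
    then obtain K where "\<forall>a\<in>{1,2,3}. K a \<in> Q p \<and> (\<forall>Y\<in>\<X> p. D p v (apply_endo (J a) Y) - J a p (D p v Y) = K a (Y p))"
      by (metis bchoice)
    then show ?thesis by (intro that[of K]) (auto simp: algebra_simps)
  qed
  obtain c where c: "\<And>a. a \<in> {1,2,3} \<Longrightarrow> c a \<in> \<C> p"
    "\<forall>\<^sub>F q in nhds p. \<forall>w. F q w = c 1 q *\<^sub>R J 1 q w + c 2 q *\<^sub>R J 2 q w + c (3::nat) q *\<^sub>R J 3 q w"
    by (rule section_coefficients[OF adm F]) blast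
  define K' where "K' = v (c 1) *\<^sub>R J 1 p + v (c 2) *\<^sub>R J 2 p + v (c 3) *\<^sub>R J 3 p
    + c 1 p *\<^sub>R K 1 + c 2 p *\<^sub>R K 2 + c 3 p *\<^sub>R K 3"
  have sub: "subspace (Q p)" using adm unfolding admissible_basis_def by (metis subspace_span)
  have "K' \<in> Q p"
    unfolding K'_def using adm_J_Q[OF adm] K(1)
    by (intro subspace_add[OF sub] subspace_scale[OF sub]) auto
  moreover have "D p v (apply_endo F Y) - F p (D p v Y) = K' (Y p)" if Y: "Y \<in> \<X> p" for Y
  proof -
    have JY: "apply_endo (J a) Y \<in> \<X> p" if "a \<in> {1,2,3}" for a using adm_apply[OF adm(1) that adm(2) Y] .
    have cJY: "(\<lambda>q. c a q *\<^sub>R apply_endo (J a) Y q) \<in> \<X> p" if "a \<in> {1,2,3}" for a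
      by (rule X_scale[OF c(1)[OF that] JY[OF that]])
    have l: "D p v (\<lambda>q. c a q *\<^sub>R apply_endo (J a) Y q)
        = v (c a) *\<^sub>R J a p (Y p) + c a p *\<^sub>R (J a p (D p v Y) + K a (Y p))" if "a \<in> {1,2,3}" for a
      using D_leibniz[OF D v JY[OF that] c(1)[OF that]] K(2)[OF that Y] by (simp add: apply_endo_def)
    have "D p v (apply_endo F Y) = D p v (\<lambda>q. (c 1 q *\<^sub>R apply_endo (J 1) Y q + c 2 q *\<^sub>R apply_endo (J 2) Y q)
        + c 3 q *\<^sub>R apply_endo (J 3) Y q)"
      using c(2) by (intro D_cong[OF D v apply_endo_X[OF F(1,3) Y]]) (auto elim!: eventually_mono simp: apply_endo_def)
    also have "\<dots> = (v (c 1) *\<^sub>R J 1 p (Y p) + c 1 p *\<^sub>R (J 1 p (D p v Y) + K 1 (Y p))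
        + (v (c 2) *\<^sub>R J 2 p (Y p) + c 2 p *\<^sub>R (J 2 p (D p v Y) + K 2 (Y p))))
        + (v (c 3) *\<^sub>R J 3 p (Y p) + c 3 p *\<^sub>R (J 3 p (D p v Y) + K 3 (Y p)))"
      using D_add[OF D v X_add[OF cJY cJY] cJY, of 1 2 3] D_add[OF D v cJY cJY, of 1 2] l[of 1] l[of 2] l[of 3] by simp
    finally show ?thesis
      using eventually_nhds_x_imp_x[OF c(2)] by (simp add: K'_def scaleR_fun_apply algebra_simps)
  qed
  ultimately show "\<exists>K\<in>Q p. \<forall>Y\<in>\<X> p. D p v (apply_endo F Y) - F p (D p v Y) = K (Y p)" by blast
qed

end

section \<open>Immersions and fields along them\<close>

locale immersion = M: manifold AM + N: manifold AN
  for AM :: "('m::{t2_space,second_countable_topology}, 'a::euclidean_space) atlas"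
    and AN :: "('n::{t2_space,second_countable_topology}, 'b::euclidean_space) atlas" +
  fixes h :: "'n \<Rightarrow> 'm"
  assumes smooth: "smooth_map AN AM h"
    and immersive: "inj_on (differential AM h p) (tangent_space AN p)"
begin

abbreviation "dh \<equiv> differential AM h"

lemma h_eventually: "\<forall>\<^sub>F P in nhds (h p). R P \<Longrightarrow> \<forall>\<^sub>F q in nhds p. R (h q)"
proof -
  have "isCont h p" using smooth unfolding smooth_map_def by (simp add: continuous_on_eq_continuous_at)
  then have "filterlim h (nhds (h p)) (nhds p)" by (simp add: isCont_def tendsto_at_iff_tendsto_nhds)
  then show "\<forall>\<^sub>F P in nhds (h p). R P \<Longrightarrow> \<forall>\<^sub>F q in nhds p. R (h q)" unfolding filterlim_iff by blast
qed

lemma h_C: assumes f: "f \<in> M.\<C> (h p)" shows "(\<lambda>q. f (h q)) \<in> N.\<C> p"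
proof -
  obtain U \<phi> where c: "(U, \<phi>) \<in> AN" "p \<in> U" by (rule N.chart_at)
  obtain V \<psi> where d: "(V, \<psi>) \<in> AM" "h p \<in> V" by (rule M.chart_at)
  have oV: "open (h -` V)"
    using smooth M.chart_open(1)[OF d(1)] unfolding smooth_map_def by (simp add: continuous_on_open_vimage)
  let ?g = "\<psi> \<circ> h \<circ> inv_into U \<phi>"
  have "smooth_on (\<phi> ` (U \<inter> h -` V)) ?g" using smooth c d unfolding smooth_map_def by blast
  then have g: "smooth_at (\<phi> p) ?g"
    unfolding smooth_at_def using N.open_chart_image[OF c(1) oV] c d by blast
  have gp: "?g (\<phi> p) = \<psi> (h p)" by (simp add: N.chart_inv[OF c])
  have "smooth_at (\<phi> p) (\<lambda>y. (f \<circ> inv_into V \<psi>) (?g y))"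
    by (rule smooth_at_compose[OF _ g]) (use f M.smooth_near_chart[OF d] gp in \<open>simp add: comp_def\<close>)
  moreover have "\<forall>\<^sub>F y in nhds (\<phi> p). y \<in> \<phi> ` (U \<inter> h -` V)"
    using N.open_chart_image[OF c(1) oV] c d by (intro eventually_nhds_in_open) auto
  then have "\<forall>\<^sub>F y in nhds (\<phi> p). (f \<circ> inv_into V \<psi>) (?g y) = ((\<lambda>q. f (h q)) \<circ> inv_into U \<phi>) y"
    by eventually_elim (auto simp: N.chart_inv[OF c(1)] M.chart_inv[OF d(1)])
  ultimately show ?thesis unfolding N.smooth_near_chart[OF c] by (rule smooth_at_cong)
qed

lemma dh_app: "f \<in> M.\<C> (h p) \<Longrightarrow> dh p v f = v (\<lambda>q. f (h q))"
  by (simp add: differential_def comp_def)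

lemma dh_add: "dh p (v + w) = dh p v + dh p w"
  and dh_scale: "dh p (c *\<^sub>R v) = c *\<^sub>R dh p v"
  and dh_zero: "dh p 0 = 0"
  and dh_minus: "dh p (- v) = - dh p v"
  by (auto simp: differential_def scaleR_fun_apply fun_eq_iff)

lemma dh_diff: "dh p (v - w) = dh p v - dh p w"
  using dh_add[of p v "- w"] by (simp add: dh_minus)

lemma dh_T: assumes v: "v \<in> N.\<T> p" shows "dh p v \<in> M.\<T> (h p)"
  unfolding tangent_space_def
proof (intro CollectI conjI ballI allI impI)
  fix f g c assume f: "f \<in> M.\<C> (h p)"
  show "dh p v (\<lambda>q. c * f q) = c * dh p v f"
    using f M.C_mult[OF M.C_const f] N.T_cmult[OF v h_C[OF f]] by (simp add: dh_app)
  assume g: "g \<in> M.\<C> (h p)"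
  show "dh p v (\<lambda>q. f q + g q) = dh p v f + dh p v g"
    using f g M.C_add[OF f g] N.T_add[OF v h_C[OF f] h_C[OF g]] by (simp add: dh_app)
  show "dh p v (\<lambda>q. f q * g q) = f (h p) * dh p v g + g (h p) * dh p v f"
    using f g M.C_mult[OF f g] N.T_mult[OF v h_C[OF f] h_C[OF g]] by (simp add: dh_app)
qed (simp add: differential_def)

lemma dh_inj: "v \<in> N.\<T> p \<Longrightarrow> w \<in> N.\<T> p \<Longrightarrow> dh p v = dh p w \<Longrightarrow> v = w"
  using immersive by (auto dest: inj_onD)

lemma dh_X_C: "Y \<in> N.\<X> p \<Longrightarrow> f \<in> M.\<C> (h p) \<Longrightarrow> (\<lambda>q. Y q (\<lambda>r. f (h r))) \<in> N.\<C> p"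
  by (rule N.X_C[OF _ h_C])

lemma dh_expand:
  assumes "M.frame (h p) x E" "v \<in> N.\<T> p"
  shows "dh p v = (\<Sum>b\<in>Basis. v (\<lambda>q. x b (h q)) *\<^sub>R E b (h p))"
  using M.frame_expand[OF assms(1) dh_T[OF assms(2)]] M.frame_C[OF assms(1)] by (simp add: dh_app)

lemma dh_X_expand:
  assumes f: "M.frame (h p) x E" and Y: "Y \<in> N.\<X> p"
  shows "\<forall>\<^sub>F q in nhds p. dh q (Y q) = (\<Sum>b\<in>Basis. Y q (\<lambda>r. x b (h r)) *\<^sub>R E b (h q))"
  using h_eventually[OF M.frame_eventually[OF f]] N.X_eventually[OF Y]
  by eventually_elim (auto intro!: dh_expand N.X_T)

text \<open>Stands in for the local normal form of an immersion. The components of \<open>Y\<close>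
  in a frame of \<open>N\<close> solve a linear system whose right-hand side is smooth by hypothesis
  and whose matrix, that of the differential, is injective at \<open>p\<close>.\<close>

lemma X_immersion:
  assumes f: "M.frame (h p) x E" and T: "\<forall>\<^sub>F q in nhds p. Y q \<in> N.\<T> q"
    and C: "\<And>b. b \<in> Basis \<Longrightarrow> (\<lambda>q. dh q (Y q) (x b)) \<in> N.\<C> p"
  shows "Y \<in> N.\<X> p"
proof -
  obtain y F where g: "N.frame p y F" using N.frame_exists by blast
  have "\<forall>j\<in>Basis. (\<lambda>q. Y q (y j)) \<in> N.\<C> p"
  proof (rule N.smooth_solution[where I = Basis and M = "\<lambda>b j q. F j q (\<lambda>r. x b (h r))" and w = "\<lambda>b q. dh q (Y q) (x b)"])
    show "(\<lambda>q. F j q (\<lambda>r. x b (h r))) \<in> N.\<C> p" if "b \<in> Basis" "j \<in> Basis" for b j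
      using that by (intro dh_X_C N.frame_X[OF g] M.frame_C[OF f])
    show "\<forall>\<^sub>F q in nhds p. dh q (Y q) (x b) = (\<Sum>j\<in>Basis. Y q (y j) * F j q (\<lambda>r. x b (h r)))" if b: "b \<in> Basis" for b
      using h_eventually[OF M.frame_eventually[OF f]] T N.frame_eventually_expand[OF g]
    proof eventually_elim
      case (elim q)
      then have "Y q = (\<Sum>j\<in>Basis. Y q (y j) *\<^sub>R F j q)" by blast
      then have "Y q (\<lambda>r. x b (h r)) = (\<Sum>j\<in>Basis. Y q (y j) *\<^sub>R F j q) (\<lambda>r. x b (h r))" by (rule arg_cong)
      then show ?case using M.frame_C[OF elim(1) b] by (simp add: dh_app N.sum_fun_apply scaleR_fun_apply)
    qed
    \<comment> \<open>A kernel vector of the matrix at \<open>p\<close> gives a tangent vector with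
      zero differential.\<close>
    fix c assume c: "\<forall>b\<in>Basis. (\<Sum>j\<in>Basis. c j * F j p (\<lambda>r. x b (h r))) = 0"
    define v where "v = (\<Sum>j\<in>Basis. c j *\<^sub>R F j p)"
    have v: "v \<in> N.\<T> p"
      unfolding v_def by (rule subspace_sum[OF N.T_subspace]) (auto intro: subspace_scale[OF N.T_subspace] N.frame_T[OF g])
    have "v (\<lambda>r. x b (h r)) = 0" if "b \<in> Basis" for b
      using bspec[OF c that] by (simp add: v_def N.sum_fun_apply scaleR_fun_apply)
    then have "dh p v = 0"
      unfolding dh_expand[OF f v] by (intro sum.neutral ballI) (simp only: scaleR_zero_left)
    then have "v = 0" using dh_inj[OF v, of 0] dh_zero subspace_0[OF N.T_subspace] by simp
    moreover have "v (y j) = c j" if "j \<in> Basis" for j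
      unfolding v_def using N.frame_dual[OF g _ that] that by (simp add: N.sum_fun_apply scaleR_fun_apply mult_delta_right)
    ultimately show "\<forall>j\<in>Basis. c j = 0" by fastforce
  qed (use C in auto)
  then show ?thesis using N.X_I[OF g T] by blast
qed

text \<open>The connection on the pullback of the ambient tangent bundle; \<open>nabla_expansion\<close> shows that
  it does not depend on the choice of frames.\<close>

definition some_frame :: "'m \<Rightarrow> ('a \<Rightarrow> 'm \<Rightarrow> real) \<times> ('a \<Rightarrow> 'm vfield)" where
  "some_frame P = (SOME (x, E). M.frame P x E)"

lemma some_frame: "M.frame P (fst (some_frame P)) (snd (some_frame P))"
proof -
  have "\<exists>z. case z of (x, E) \<Rightarrow> M.frame P x E" using M.frame_exists by auto
  then show ?thesis unfolding some_frame_def by (rule someI2_ex) auto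
qed

definition nabla :: "'m conn \<Rightarrow> 'n \<Rightarrow> 'n tvec \<Rightarrow> ('n \<Rightarrow> 'm tvec) \<Rightarrow> 'm tvec" where
  "nabla D p v \<xi> = (let (x, E) = some_frame (h p) in
     \<Sum>b\<in>Basis. v (\<lambda>q. \<xi> q (x b)) *\<^sub>R E b (h p) + \<xi> p (x b) *\<^sub>R D (h p) (dh p v) (E b))"

section \<open>The connection along the immersion\<close>

context
  fixes D assumes D: "connection AM D"
begin

text \<open>Any expansion of the field by ambient fields may be used: a frame
  (\<open>nabla_frame\<close>), one ambient extension (\<open>nabla_extension\<close>), or the
  images of a frame under a structure (\<open>nabla_J\<close>). The proof takes components in the
  chosen frame and reassembles them by \<open>D_expand\<close>.\<close>

lemma nabla_expansion:
  assumes v: "v \<in> N.\<T> p" and g: "\<And>i. i \<in> I \<Longrightarrow> g i \<in> N.\<C> p" and Z: "\<And>i. i \<in> I \<Longrightarrow> Z i \<in> M.\<X> (h p)"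
    and \<xi>: "\<forall>\<^sub>F q in nhds p. \<xi> q = (\<Sum>i\<in>I. g i q *\<^sub>R Z i (h q))"
  shows "nabla D p v \<xi> = (\<Sum>i\<in>I. v (g i) *\<^sub>R Z i (h p) + g i p *\<^sub>R D (h p) (dh p v) (Z i))"
proof -
  obtain x E where xE: "some_frame (h p) = (x, E)" by fastforce
  have f: "M.frame (h p) x E" using some_frame[of "h p"] xE by simp
  have ZC: "(\<lambda>q. Z i (h q) (x b)) \<in> N.\<C> p" if "i \<in> I" "b \<in> Basis" for i b
    using h_C[OF M.X_C[OF Z[OF that(1)] M.frame_C[OF f that(2)]]] .
  have \<xi>p: "\<xi> p (x b) = (\<Sum>i\<in>I. g i p * Z i (h p) (x b))" for b
    using eventually_nhds_x_imp_x[OF \<xi>] by (simp add: M.sum_fun_apply scaleR_fun_apply)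
  have \<xi>v: "v (\<lambda>q. \<xi> q (x b)) = (\<Sum>i\<in>I. g i p * dh p v (\<lambda>P. Z i P (x b)) + Z i (h p) (x b) * v (g i))"
    if b: "b \<in> Basis" for b
  proof -
    have "\<forall>\<^sub>F q in nhds p. \<xi> q (x b) = (\<Sum>i\<in>I. g i q * Z i (h q) (x b))"
      using \<xi> by eventually_elim (simp add: M.sum_fun_apply scaleR_fun_apply)
    then have "v (\<lambda>q. \<xi> q (x b)) = v (\<lambda>q. \<Sum>i\<in>I. g i q * Z i (h q) (x b))" by (rule N.T_cong[OF v])
    also have "\<dots> = (\<Sum>i\<in>I. v (\<lambda>q. g i q * Z i (h q) (x b)))"
      using N.C_mult[OF g ZC[OF _ b]] by (intro N.T_sum[OF v])
    also have "\<dots> = (\<Sum>i\<in>I. g i p * dh p v (\<lambda>P. Z i P (x b)) + Z i (h p) (x b) * v (g i))"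
      using N.T_mult[OF v g ZC[OF _ b]] M.X_C[OF Z M.frame_C[OF f b]] by (intro sum.cong refl) (simp add: dh_app)
    finally show ?thesis .
  qed
  have "nabla D p v \<xi> = (\<Sum>b\<in>Basis. v (\<lambda>q. \<xi> q (x b)) *\<^sub>R E b (h p) + \<xi> p (x b) *\<^sub>R D (h p) (dh p v) (E b))"
    unfolding nabla_def xE by simp
  also have "\<dots> = (\<Sum>b\<in>Basis. \<Sum>i\<in>I. (v (g i) * Z i (h p) (x b)) *\<^sub>R E b (h p)
      + g i p *\<^sub>R (dh p v (\<lambda>P. Z i P (x b)) *\<^sub>R E b (h p) + Z i (h p) (x b) *\<^sub>R D (h p) (dh p v) (E b)))"
    by (intro sum.cong refl)
      (simp add: \<xi>v \<xi>p scaleR_sum_left sum.distrib[symmetric] algebra_simps)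
  also have "\<dots> = (\<Sum>i\<in>I. v (g i) *\<^sub>R (\<Sum>b\<in>Basis. Z i (h p) (x b) *\<^sub>R E b (h p))
      + g i p *\<^sub>R (\<Sum>b\<in>Basis. dh p v (\<lambda>P. Z i P (x b)) *\<^sub>R E b (h p) + Z i (h p) (x b) *\<^sub>R D (h p) (dh p v) (E b)))"
    by (subst sum.swap) (simp add: sum.distrib scaleR_sum_right scaleR_add_right)
  also have "\<dots> = (\<Sum>i\<in>I. v (g i) *\<^sub>R Z i (h p) + g i p *\<^sub>R D (h p) (dh p v) (Z i))"
    using M.frame_expand[OF f M.X_T[OF Z]] M.D_expand[OF D f dh_T[OF v] Z] by (intro sum.cong refl) simp
  finally show ?thesis .
qed

text \<open>The link to \<open>restricts_to\<close>, which speaks of ambient extensions.\<close>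

lemma nabla_extension:
  assumes "v \<in> N.\<T> p" "Z \<in> M.\<X> (h p)" "\<forall>\<^sub>F q in nhds p. \<xi> q = Z (h q)"
  shows "nabla D p v \<xi> = D (h p) (dh p v) Z"
  using nabla_expansion[of v p "{()}" "\<lambda>_ _. 1" "\<lambda>_. Z" \<xi>] assms by (simp add: N.T_const)

lemma nabla_frame:
  assumes "M.frame (h p) x E" "v \<in> N.\<T> p" "Y \<in> N.\<X> p"
  shows "nabla D p v (\<lambda>q. dh q (Y q)) = (\<Sum>b\<in>Basis. v (\<lambda>q. Y q (\<lambda>r. x b (h r))) *\<^sub>R E b (h p)
     + Y p (\<lambda>r. x b (h r)) *\<^sub>R D (h p) (dh p v) (E b))"
  using dh_X_C[OF assms(3) M.frame_C[OF assms(1)]] M.frame_X[OF assms(1)]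
  by (intro nabla_expansion[OF assms(2) _ _ dh_X_expand[OF assms(1,3)]])

lemma nabla_T:
  assumes "v \<in> N.\<T> p" "Y \<in> N.\<X> p"
  shows "nabla D p v (\<lambda>q. dh q (Y q)) \<in> M.\<T> (h p)"
proof -
  obtain x E where f: "M.frame (h p) x E" using M.frame_exists by blast
  show ?thesis
    unfolding nabla_frame[OF f assms]
    by (rule subspace_sum[OF M.T_subspace], rule subspace_add[OF M.T_subspace]; rule subspace_scale[OF M.T_subspace])
      (auto intro: M.frame_T[OF f] M.D_T[OF D dh_T[OF assms(1)] M.frame_X[OF f]])
qed

lemma nabla_cong:
  assumes "v \<in> N.\<T> p" "Y \<in> N.\<X> p" "\<forall>\<^sub>F q in nhds p. Y q = Y' q"
  shows "nabla D p v (\<lambda>q. dh q (Y q)) = nabla D p v (\<lambda>q. dh q (Y' q))"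
proof -
  obtain x E where f: "M.frame (h p) x E" using M.frame_exists by blast
  have "\<forall>\<^sub>F q in nhds p. dh q (Y' q) = (\<Sum>b\<in>Basis. Y q (\<lambda>r. x b (h r)) *\<^sub>R E b (h q))"
    using dh_X_expand[OF f assms(2)] assms(3) by eventually_elim simp
  then show ?thesis
    unfolding nabla_frame[OF f assms(1,2)]
    using dh_X_C[OF assms(2) M.frame_C[OF f]] M.frame_X[OF f]
    by (intro nabla_expansion[OF assms(1), symmetric]) auto
qed

lemma nabla_addv:
  assumes "v \<in> N.\<T> p" "w \<in> N.\<T> p" "Y \<in> N.\<X> p"
  shows "nabla D p (v + w) (\<lambda>q. dh q (Y q)) = nabla D p v (\<lambda>q. dh q (Y q)) + nabla D p w (\<lambda>q. dh q (Y q))"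
proof -
  obtain x E where f: "M.frame (h p) x E" using M.frame_exists by blast
  have "v + w \<in> N.\<T> p" using subspace_add[OF N.T_subspace] assms by blast
  then show ?thesis
    using M.D_addv[OF D dh_T dh_T M.frame_X[OF f], OF assms(1,2)]
    by (simp add: nabla_frame[OF f] assms dh_add sum.distrib algebra_simps)
qed

lemma nabla_scalev:
  assumes "v \<in> N.\<T> p" "Y \<in> N.\<X> p"
  shows "nabla D p (c *\<^sub>R v) (\<lambda>q. dh q (Y q)) = c *\<^sub>R nabla D p v (\<lambda>q. dh q (Y q))"
proof -
  obtain x E where f: "M.frame (h p) x E" using M.frame_exists by blast
  have "c *\<^sub>R v \<in> N.\<T> p" using subspace_scale[OF N.T_subspace] assms by blast
  then show ?thesis
    using M.D_scalev[OF D dh_T[OF assms(1)] M.frame_X[OF f]]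
    by (simp add: nabla_frame[OF f] assms dh_scale scaleR_sum_right scaleR_fun_apply algebra_simps)
qed

lemma nabla_add:
  assumes v: "v \<in> N.\<T> p" and Y: "Y \<in> N.\<X> p" "Z \<in> N.\<X> p"
  shows "nabla D p v (\<lambda>q. dh q (Y q + Z q)) = nabla D p v (\<lambda>q. dh q (Y q)) + nabla D p v (\<lambda>q. dh q (Z q))"
proof -
  obtain x E where f: "M.frame (h p) x E" using M.frame_exists by blast
  have "v (\<lambda>q. Y q (\<lambda>r. x b (h r)) + Z q (\<lambda>r. x b (h r))) = v (\<lambda>q. Y q (\<lambda>r. x b (h r))) + v (\<lambda>q. Z q (\<lambda>r. x b (h r)))"
    if "b \<in> Basis" for b
    using Y that by (intro N.T_add[OF v] dh_X_C M.frame_C[OF f])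
  then show ?thesis
    using nabla_frame[OF f v N.X_add[OF Y]]
    by (simp add: nabla_frame[OF f v] Y sum.distrib[symmetric] algebra_simps)
qed

lemma nabla_leibniz:
  assumes v: "v \<in> N.\<T> p" and Y: "Y \<in> N.\<X> p" and g: "g \<in> N.\<C> p"
  shows "nabla D p v (\<lambda>q. dh q (g q *\<^sub>R Y q)) = v g *\<^sub>R dh p (Y p) + g p *\<^sub>R nabla D p v (\<lambda>q. dh q (Y q))"
proof -
  obtain x E where f: "M.frame (h p) x E" using M.frame_exists by blast
  have "v (\<lambda>q. g q * Y q (\<lambda>r. x b (h r))) = g p * v (\<lambda>q. Y q (\<lambda>r. x b (h r))) + Y p (\<lambda>r. x b (h r)) * v g"
    if "b \<in> Basis" for b
    by (rule N.T_mult[OF v g dh_X_C[OF Y M.frame_C[OF f that]]])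
  then show ?thesis
    using nabla_frame[OF f v N.X_scale[OF g Y]] dh_expand[OF f N.X_T[OF Y]]
    by (simp add: nabla_frame[OF f v Y] scaleR_fun_apply sum.distrib[symmetric] scaleR_sum_right algebra_simps)
qed

text \<open>The direction \<open>dh q (X q)\<close> is not the value of an ambient field. Expanding
  it in the frame as well leaves only the ambient fields \<open>D (E c) E b\<close>, whose
  components are smooth and can be composed with \<open>h\<close>.\<close>

lemma nabla_smooth:
  assumes f: "M.frame (h p) x E" and X: "X \<in> N.\<X> p" and Y: "Y \<in> N.\<X> p" and a: "a \<in> Basis"
  shows "(\<lambda>q. nabla D q (X q) (\<lambda>r. dh r (Y r)) (x a)) \<in> N.\<C> p"
proof (rule N.C_cong)
  show "(\<lambda>q. \<Sum>b\<in>Basis. X q (\<lambda>r. Y r (\<lambda>s. x b (h s))) * E b (h q) (x a)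
      + Y q (\<lambda>s. x b (h s)) * (\<Sum>c\<in>Basis. X q (\<lambda>s. x c (h s)) * D (h q) (E c (h q)) (E b) (x a))) \<in> N.\<C> p"
  proof (intro N.C_sum N.C_add N.C_mult)
    fix b c :: 'a assume b: "b \<in> Basis" and c: "c \<in> Basis"
    show "(\<lambda>q. X q (\<lambda>s. x c (h s))) \<in> N.\<C> p" by (rule dh_X_C[OF X M.frame_C[OF f c]])
    show "(\<lambda>q. D (h q) (E c (h q)) (E b) (x a)) \<in> N.\<C> p"
      by (rule h_C[OF M.X_C[OF M.D_smooth[OF D M.frame_X[OF f c] M.frame_X[OF f b]] M.frame_C[OF f a]]])
  next
    fix b :: 'a assume b: "b \<in> Basis"
    show "(\<lambda>q. X q (\<lambda>r. Y r (\<lambda>s. x b (h s)))) \<in> N.\<C> p" by (rule N.X_C[OF X dh_X_C[OF Y M.frame_C[OF f b]]])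
    show "(\<lambda>q. E b (h q) (x a)) \<in> N.\<C> p" by (rule h_C[OF M.X_C[OF M.frame_X[OF f b] M.frame_C[OF f a]]])
    show "(\<lambda>q. Y q (\<lambda>s. x b (h s))) \<in> N.\<C> p" by (rule dh_X_C[OF Y M.frame_C[OF f b]])
  qed
  show "\<forall>\<^sub>F q in nhds p. (\<Sum>b\<in>Basis. X q (\<lambda>r. Y r (\<lambda>s. x b (h s))) * E b (h q) (x a)
      + Y q (\<lambda>s. x b (h s)) * (\<Sum>c\<in>Basis. X q (\<lambda>s. x c (h s)) * D (h q) (E c (h q)) (E b) (x a)))
      = nabla D q (X q) (\<lambda>r. dh r (Y r)) (x a)"
    using h_eventually[OF M.frame_eventually[OF f]] N.X_eventually[OF X] N.X_eventually[OF Y]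
  proof eventually_elim
    case (elim q)
    note f = elim(1)
    have "D (h q) (dh q (X q)) (E b) = (\<Sum>c\<in>Basis. X q (\<lambda>s. x c (h s)) *\<^sub>R D (h q) (E c (h q)) (E b))" if "b \<in> Basis" for b
      unfolding dh_expand[OF f N.X_T[OF elim(2)]]
      using M.frame_T[OF f] by (intro lin_on_sum[OF M.D_lin[OF D M.frame_X[OF f that]] M.T_subspace])
    then show ?case
      unfolding nabla_frame[OF f N.X_T[OF elim(2)] elim(3)] by (simp add: M.sum_fun_apply scaleR_fun_apply)
  qed
qed

text \<open>Coordinate fields commute, so \<open>D (E c) E b\<close> is symmetric in
  \<open>b\<close> and \<open>c\<close> and the terms with derivatives of the frame cancel. The
  derivatives of the components make up the bracket on \<open>N\<close>.\<close>

lemma nabla_torsion_free: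
  assumes tf: "torsion_free AM D" and X: "X \<in> N.\<X> p" and Y: "Y \<in> N.\<X> p"
  shows "nabla D p (X p) (\<lambda>q. dh q (Y q)) - nabla D p (Y p) (\<lambda>q. dh q (X q)) = dh p (lie_bracket AN X Y p)"
proof -
  obtain x E where f: "M.frame (h p) x E" using M.frame_exists by blast
  note XT = N.X_T[OF X] and YT = N.X_T[OF Y]
  let ?d = "\<lambda>b c. D (h p) (E c (h p)) (E b)"
  have sym: "?d b c = ?d c b" if "b \<in> Basis" "c \<in> Basis" for b c
    using tf M.frame_X[OF f that(1)] M.frame_X[OF f that(2)] M.frame_bracket[OF f that(2,1)]
    unfolding torsion_free_def torsion_def by fastforce
  have De: "D (h p) (dh p v) (E b) = (\<Sum>c\<in>Basis. v (\<lambda>s. x c (h s)) *\<^sub>R ?d b c)" if "b \<in> Basis" "v \<in> N.\<T> p" for b v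
    unfolding dh_expand[OF f that(2)]
    using M.frame_T[OF f] by (intro lin_on_sum[OF M.D_lin[OF D M.frame_X[OF f that(1)]] M.T_subspace])
  have "(\<Sum>b\<in>Basis. Y p (\<lambda>r. x b (h r)) *\<^sub>R D (h p) (dh p (X p)) (E b))
      = (\<Sum>b\<in>Basis. \<Sum>c\<in>Basis. (Y p (\<lambda>r. x b (h r)) * X p (\<lambda>r. x c (h r))) *\<^sub>R ?d b c)"
    by (intro sum.cong refl) (simp add: De XT scaleR_sum_right)
  also have "\<dots> = (\<Sum>b\<in>Basis. \<Sum>c\<in>Basis. (X p (\<lambda>r. x b (h r)) * Y p (\<lambda>r. x c (h r))) *\<^sub>R ?d b c)"
    by (subst sum.swap) (intro sum.cong refl, simp add: sym mult.commute)
  also have "\<dots> = (\<Sum>b\<in>Basis. X p (\<lambda>r. x b (h r)) *\<^sub>R D (h p) (dh p (Y p)) (E b))"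
    by (intro sum.cong refl) (simp add: De YT scaleR_sum_right)
  finally have eq: "(\<Sum>b\<in>Basis. Y p (\<lambda>r. x b (h r)) *\<^sub>R D (h p) (dh p (X p)) (E b))
      = (\<Sum>b\<in>Basis. X p (\<lambda>r. x b (h r)) *\<^sub>R D (h p) (dh p (Y p)) (E b))" .
  have "dh p (lie_bracket AN X Y p) = (\<Sum>b\<in>Basis. (X p (\<lambda>q. Y q (\<lambda>r. x b (h r))) - Y p (\<lambda>q. X q (\<lambda>r. x b (h r)))) *\<^sub>R E b (h p))"
    unfolding dh_expand[OF f N.lie_bracket_T[OF X Y]]
    by (intro sum.cong refl) (simp add: lie_bracket_def h_C M.frame_C[OF f])
  then show ?thesis
    unfolding nabla_frame[OF f XT Y] nabla_frame[OF f YT X] sum.distrib eq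
    by (simp add: scaleR_diff_left sum_subtractf)
qed

text \<open>In a frame everything reduces to the components of the two fields and the ambient
  functions \<open>w b c\<close>, whose derivatives along the immersion are given by parallelism of
  \<omega>. The first claim is also the smoothness of the induced form.\<close>

lemma nabla_form:
  assumes \<omega>: "two_form AM \<omega>" "preserves_form2 AM \<omega> D" and v: "v \<in> N.\<T> p" and Y: "Y \<in> N.\<X> p" and Z: "Z \<in> N.\<X> p"
  shows "(\<lambda>q. \<omega> (h q) (dh q (Y q)) (dh q (Z q))) \<in> N.\<C> p"
    and "v (\<lambda>q. \<omega> (h q) (dh q (Y q)) (dh q (Z q))) =
      \<omega> (h p) (nabla D p v (\<lambda>q. dh q (Y q))) (dh p (Z p)) + \<omega> (h p) (dh p (Y p)) (nabla D p v (\<lambda>q. dh q (Z q)))"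
proof -
  obtain x E where f: "M.frame (h p) x E" using M.frame_exists by blast
  define y where "y b q = Y q (\<lambda>r. x b (h r))" for b q
  define z where "z b q = Z q (\<lambda>r. x b (h r))" for b q
  define w where "w b c P = \<omega> P (E b P) (E c P)" for b c P
  have yC: "y b \<in> N.\<C> p" "z b \<in> N.\<C> p" if "b \<in> Basis" for b
    unfolding y_def z_def using Y Z that by (auto intro: dh_X_C M.frame_C[OF f])
  have wC: "w b c \<in> M.\<C> (h p)" if "b \<in> Basis" "c \<in> Basis" for b c
    unfolding w_def using that by (intro M.form_C[OF \<omega>(1)] M.frame_X[OF f])
  note whC = h_C[OF wC]
  note l1 = M.form_lin1[OF \<omega>(1)] and l2 = M.form_lin2[OF \<omega>(1)]
  have bil: "\<omega> P (\<Sum>b\<in>B. s b *\<^sub>R F b) (\<Sum>c\<in>B'. t c *\<^sub>R G c) = (\<Sum>b\<in>B. \<Sum>c\<in>B'. s b * t c * \<omega> P (F b) (G c))"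
    if "\<And>b. b \<in> B \<Longrightarrow> F b \<in> M.\<T> P" "\<And>c. c \<in> B' \<Longrightarrow> G c \<in> M.\<T> P"
    for P s t and F :: "'a \<Rightarrow> 'm tvec" and G :: "'a \<Rightarrow> 'm tvec" and B B'
  proof -
    have "(\<Sum>c\<in>B'. t c *\<^sub>R G c) \<in> M.\<T> P"
      using that(2) by (intro subspace_sum[OF M.T_subspace] subspace_scale[OF M.T_subspace])
    then show ?thesis
      using lin_on_sum[OF l1 M.T_subspace, of "\<Sum>c\<in>B'. t c *\<^sub>R G c" P B F s] that
        lin_on_sum[OF l2[OF that(1)] M.T_subspace, of _ B' G t]
      by (simp add: sum_distrib_left mult.assoc)
  qed
  have "\<forall>\<^sub>F q in nhds p. \<omega> (h q) (dh q (Y q)) (dh q (Z q)) = (\<Sum>b\<in>Basis. \<Sum>c\<in>Basis. y b q * z c q * w b c (h q))"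
    using dh_X_expand[OF f Y] dh_X_expand[OF f Z] h_eventually[OF M.frame_eventually[OF f]]
    by eventually_elim (simp add: bil M.frame_T y_def z_def w_def)
  note e = this
  have C: "(\<lambda>q. \<Sum>b\<in>Basis. \<Sum>c\<in>Basis. y b q * z c q * w b c (h q)) \<in> N.\<C> p"
    by (intro N.C_sum N.C_mult yC whC)
  show "(\<lambda>q. \<omega> (h q) (dh q (Y q)) (dh q (Z q))) \<in> N.\<C> p"
    by (rule N.C_cong[OF C]) (use e in \<open>auto elim: eventually_mono\<close>)
  let ?d = "\<lambda>b. D (h p) (dh p v) (E b)"
  have vw: "v (\<lambda>q. w b c (h q)) = \<omega> (h p) (?d b) (E c (h p)) + \<omega> (h p) (E b (h p)) (?d c)" if "b \<in> Basis" "c \<in> Basis" for b c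
    using M.preserves_form_derivative[OF \<omega> dh_T[OF v] M.frame_X[OF f that(1)] M.frame_X[OF f that(2)]]
      dh_app[OF wC[OF that], of v] unfolding w_def by simp
  have dT: "?d b \<in> M.\<T> (h p)" if "b \<in> Basis" for b using M.D_T[OF D dh_T[OF v] M.frame_X[OF f that]] .
  note ET = M.frame_T[OF f]
  have dY: "dh p (Y p) = (\<Sum>b\<in>Basis. y b p *\<^sub>R E b (h p))" and dZ: "dh p (Z p) = (\<Sum>b\<in>Basis. z b p *\<^sub>R E b (h p))"
    unfolding y_def z_def using dh_expand[OF f N.X_T[OF Y]] dh_expand[OF f N.X_T[OF Z]] by simp_all
  have nY: "nabla D p v (\<lambda>q. dh q (Y q)) = (\<Sum>b\<in>Basis. v (y b) *\<^sub>R E b (h p)) + (\<Sum>b\<in>Basis. y b p *\<^sub>R ?d b)"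
    and nZ: "nabla D p v (\<lambda>q. dh q (Z q)) = (\<Sum>b\<in>Basis. v (z b) *\<^sub>R E b (h p)) + (\<Sum>b\<in>Basis. z b p *\<^sub>R ?d b)"
    using nabla_frame[OF f v Y] nabla_frame[OF f v Z] unfolding y_def[abs_def] z_def[abs_def] by (simp_all add: sum.distrib)
  have sT: "(\<Sum>b\<in>Basis. s b *\<^sub>R E b (h p)) \<in> M.\<T> (h p)" "(\<Sum>b\<in>Basis. s b *\<^sub>R ?d b) \<in> M.\<T> (h p)" for s
    by (rule subspace_sum[OF M.T_subspace], rule subspace_scale[OF M.T_subspace], use ET dT in blast)+
  have "v (\<lambda>q. \<omega> (h q) (dh q (Y q)) (dh q (Z q))) = v (\<lambda>q. \<Sum>b\<in>Basis. \<Sum>c\<in>Basis. y b q * z c q * w b c (h q))"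
    by (rule N.T_cong[OF v e])
  also have "\<dots> = (\<Sum>b\<in>Basis. \<Sum>c\<in>Basis. v (\<lambda>q. y b q * z c q * w b c (h q)))"
    using N.T_sum[OF v, of Basis "\<lambda>b q. \<Sum>c\<in>Basis. y b q * z c q * w b c (h q)"]
      N.T_sum[OF v, of Basis "\<lambda>c q. y _ q * z c q * w _ c (h q)"]
    by (simp add: N.C_sum N.C_mult yC whC)
  also have "\<dots> = (\<Sum>b\<in>Basis. \<Sum>c\<in>Basis. v (y b) * z c p * w b c (h p) + y b p * v (z c) * w b c (h p)
      + y b p * z c p * (\<omega> (h p) (?d b) (E c (h p)) + \<omega> (h p) (E b (h p)) (?d c)))"
    by (intro sum.cong refl)
      (simp add: N.T_mult[OF v] N.C_mult yC whC vw algebra_simps)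
  also have "\<dots> = \<omega> (h p) (nabla D p v (\<lambda>q. dh q (Y q))) (dh p (Z p)) + \<omega> (h p) (dh p (Y p)) (nabla D p v (\<lambda>q. dh q (Z q)))"
    unfolding nY nZ dY dZ
    by (simp add: lin_on_add[OF l1] lin_on_add[OF l2] sT bil ET dT w_def sum.distrib algebra_simps)
  finally show "v (\<lambda>q. \<omega> (h q) (dh q (Y q)) (dh q (Z q))) =
      \<omega> (h p) (nabla D p v (\<lambda>q. dh q (Y q))) (dh p (Z p)) + \<omega> (h p) (dh p (Y p)) (nabla D p v (\<lambda>q. dh q (Z q)))" .
qed

end

end

section \<open>Almost quaternionic submanifolds\<close>

locale quaternionic_immersion = immersion AM AN h
  for AM :: "('m::{t2_space,second_countable_topology}, 'a::euclidean_space) atlas"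
    and AN :: "('n::{t2_space,second_countable_topology}, 'b::euclidean_space) atlas"
    and h :: "'n \<Rightarrow> 'm" +
  fixes Q :: "'m \<Rightarrow> 'm endo set" and \<omega> :: "'m form2" and D :: "'m conn"
  assumes qsH: "almost_qsH AM Q \<omega>"
    and invariant: "J \<in> Q (h p) \<Longrightarrow> (\<And>v. v \<in> tangent_space AM (h p) \<Longrightarrow> J (J v) = - v) \<Longrightarrow>
      J ` (differential AM h p ` tangent_space AN p) = differential AM h p ` tangent_space AN p"
    and nd: "nondegenerate AN (pullback_form2 AM h \<omega>)"
    and D: "connection AM D" "preserves_Q AM Q D" "preserves_form2 AM \<omega> D" "torsion_free AM D"
begin

abbreviation "L p \<equiv> dh p ` N.\<T> p"
abbreviation "Qh \<equiv> induced_Q AN AM h Q"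
abbreviation "\<omega>h \<equiv> pullback_form2 AM h \<omega>"

lemma L_subspace: "subspace (L p)"
proof (rule subspaceI)
  show "0 \<in> L p" using dh_zero subspace_0[OF N.T_subspace] by (metis imageI)
  show "u + v \<in> L p" if "u \<in> L p" "v \<in> L p" for u v
    using that subspace_add[OF N.T_subspace] by (auto simp: dh_add[symmetric])
  show "c *\<^sub>R u \<in> L p" if "u \<in> L p" for c u
    using that subspace_scale[OF N.T_subspace] by (auto simp: dh_scale[symmetric])
qed

lemma L_T: "u \<in> L p \<Longrightarrow> u \<in> M.\<T> (h p)"
  using dh_T by blast

lemma adm_L:
  assumes adm: "admissible_basis AM Q W J" "h p \<in> W" "a \<in> {1,2,3}" and u: "u \<in> L p"
  shows "J a (h p) u \<in> L p"
proof -
  have "J a (h p) ` L p = L p"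
  proof (rule invariant)
    show "J a (h p) \<in> Q (h p)" by (rule M.adm_J_Q[OF adm])
    show "J a (h p) (J a (h p) v) = - v" if "v \<in> M.\<T> (h p)" for v
      using adm that unfolding admissible_basis_def by blast
  qed
  then show ?thesis using u by blast
qed

text \<open>Invariance is assumed for almost complex structures alone; they span \<open>Q\<close>,
  and the image of the differential is a subspace.\<close>

lemma Q_L:
  assumes F: "F \<in> Q (h p)" and u: "u \<in> L p"
  shows "F u \<in> L p"
proof -
  obtain W J where adm: "h p \<in> W" "admissible_basis AM Q W J" by (rule M.qsH_basis[OF qsH])
  obtain a b c where F: "\<And>w. F w = a *\<^sub>R J 1 (h p) w + b *\<^sub>R J 2 (h p) w + c *\<^sub>R J 3 (h p) w"
    by (rule M.adm_Q_app[OF adm(2,1) F]) blast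
  show ?thesis
    unfolding F using adm_L[OF adm(2,1) _ u]
    by (auto intro!: subspace_add[OF L_subspace] subspace_scale[OF L_subspace])
qed

text \<open>The restriction of \<open>F\<close> to the submanifold, transported by the injective
  differential. The value 0 elsewhere is what \<open>tangent_endos\<close> demands.\<close>

definition pull :: "('m \<Rightarrow> 'm endo) \<Rightarrow> 'n \<Rightarrow> 'n endo" where
  "pull F q v = (if v \<in> N.\<T> q then SOME u. u \<in> N.\<T> q \<and> dh q u = F (h q) (dh q v) else 0)"

lemma assumes "F (h q) \<in> Q (h q)" "v \<in> N.\<T> q"
  shows pull_T: "pull F q v \<in> N.\<T> q" and dh_pull: "dh q (pull F q v) = F (h q) (dh q v)"
proof -
  have "F (h q) (dh q v) \<in> L q" by (rule Q_L[OF assms(1) imageI[OF assms(2)]])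
  then have "\<exists>u. u \<in> N.\<T> q \<and> dh q u = F (h q) (dh q v)" by fastforce
  then have "(SOME u. u \<in> N.\<T> q \<and> dh q u = F (h q) (dh q v)) \<in> N.\<T> q \<and>
      dh q (SOME u. u \<in> N.\<T> q \<and> dh q u = F (h q) (dh q v)) = F (h q) (dh q v)" by (rule someI_ex)
  moreover have "pull F q v = (SOME u. u \<in> N.\<T> q \<and> dh q u = F (h q) (dh q v))"
    unfolding pull_def using assms(2) by (rule if_P)
  ultimately show "pull F q v \<in> N.\<T> q" "dh q (pull F q v) = F (h q) (dh q v)" by simp_all
qed

lemma pull_endo:
  assumes F: "F (h q) \<in> Q (h q)"
  shows "pull F q \<in> tangent_endos AN q"
proof -
  have "pull F q (v + w) = pull F q v + pull F q w" if "v \<in> N.\<T> q" "w \<in> N.\<T> q" for v w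
    using that subspace_add[OF N.T_subspace] pull_T[of F, OF F] dh_pull[of F, OF F]
    by (intro dh_inj[of _ q]) (simp_all add: dh_add lin_on_add[OF M.Q_lin[OF qsH F]] dh_T)
  moreover have "pull F q (c *\<^sub>R v) = c *\<^sub>R pull F q v" if "v \<in> N.\<T> q" for v c
    using that subspace_scale[OF N.T_subspace] pull_T[of F, OF F] dh_pull[of F, OF F]
    by (intro dh_inj[of _ q]) (simp_all add: dh_scale lin_on_scale[OF M.Q_lin[OF qsH F]] dh_T)
  ultimately show ?thesis
    unfolding tangent_endos_def using pull_T[of F, OF F] by (simp add: pull_def)
qed

lemma open_vimage_h: "open W \<Longrightarrow> open (h -` W)"
  using smooth unfolding smooth_map_def by (simp add: continuous_on_open_vimage)

text \<open>By \<open>X_immersion\<close>, smoothness may be tested after the differential is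
  applied, where \<open>pull F\<close> turns into \<open>F\<close> acting on the ambient
  frame.\<close>

lemma pull_field:
  assumes F: "endo_field_on AM W F" and FQ: "\<And>P. P \<in> W \<Longrightarrow> F P \<in> Q P"
  shows "endo_field_on AN (h -` W) (pull F)"
proof (rule N.endo_field_onI)
  have W: "open W" using F unfolding endo_field_on_def by blast
  then show op: "open (h -` W)" by (rule open_vimage_h)
  show "pull F p \<in> tangent_endos AN p" if "p \<in> h -` W" for p
    using that FQ by (intro pull_endo) auto
  fix p X assume p: "p \<in> h -` W" and X: "X \<in> N.\<X> p"
  obtain x E where f: "M.frame (h p) x E" using M.frame_exists by blast
  have near: "\<forall>\<^sub>F q in nhds p. h q \<in> W" using eventually_nhds_in_open[OF op p] by simp
  show "apply_endo (pull F) X \<in> N.\<X> p"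
  proof (rule X_immersion[OF f])
    show "\<forall>\<^sub>F q in nhds p. apply_endo (pull F) X q \<in> N.\<T> q"
      using near N.X_eventually[OF X] by eventually_elim (simp add: apply_endo_def pull_T FQ N.X_T)
    fix b :: 'a assume b: "b \<in> Basis"
    show "(\<lambda>q. dh q (apply_endo (pull F) X q) (x b)) \<in> N.\<C> p"
    proof (rule N.C_cong)
      show "(\<lambda>q. \<Sum>c\<in>Basis. X q (\<lambda>r. x c (h r)) * apply_endo F (E c) (h q) (x b)) \<in> N.\<C> p"
      proof (intro N.C_sum N.C_mult)
        fix c :: 'a assume c: "c \<in> Basis"
        show "(\<lambda>q. X q (\<lambda>r. x c (h r))) \<in> N.\<C> p" by (rule dh_X_C[OF X M.frame_C[OF f c]])
        have "apply_endo F (E c) \<in> M.\<X> (h p)" using M.apply_endo_X[OF F _ M.frame_X[OF f c]] p by simp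
        from h_C[OF M.X_C[OF this M.frame_C[OF f b]]] show "(\<lambda>q. apply_endo F (E c) (h q) (x b)) \<in> N.\<C> p" .
      qed
      show "\<forall>\<^sub>F q in nhds p. (\<Sum>c\<in>Basis. X q (\<lambda>r. x c (h r)) * apply_endo F (E c) (h q) (x b))
          = dh q (apply_endo (pull F) X q) (x b)"
        using near N.X_eventually[OF X] h_eventually[OF M.frame_eventually[OF f]]
      proof eventually_elim
        case (elim q)
        note XT = N.X_T[OF elim(2)] and FQ' = FQ[OF elim(1)]
        have "dh q (apply_endo (pull F) X q) = F (h q) (dh q (X q))"
          using dh_pull[of F, OF FQ' XT] by (simp add: apply_endo_def)
        also have "\<dots> = (\<Sum>c\<in>Basis. X q (\<lambda>r. x c (h r)) *\<^sub>R F (h q) (E c (h q)))"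
          unfolding dh_expand[OF elim(3) XT]
          using M.frame_T[OF elim(3)] by (intro lin_on_sum[OF M.Q_lin[OF qsH FQ'] M.T_subspace])
        finally show ?case by (simp add: M.sum_fun_apply scaleR_fun_apply apply_endo_def)
      qed
    qed
  qed
qed

text \<open>Injectivity of the differential lifts a relation between ambient endomorphisms to
  \<open>N\<close>. Off the tangent space both sides are 0, so they are equal as functions.\<close>

lemma pull_combination:
  assumes adm: "admissible_basis AM Q W J" "h p \<in> W"
  shows "F \<in> Qh p \<longleftrightarrow> (\<exists>a b c. F = a *\<^sub>R pull (J 1) p + b *\<^sub>R pull (J 2) p + c *\<^sub>R pull (J 3) p)"
proof
  have JQ: "J i (h p) \<in> Q (h p)" if "i \<in> {1,2,3}" for i by (rule M.adm_J_Q[OF adm that])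
  note pT = pull_T[of "J _", OF JQ] and dp = dh_pull[of "J _", OF JQ]
  let ?P = "\<lambda>a b c. a *\<^sub>R pull (J 1) p + b *\<^sub>R pull (J 2) p + c *\<^sub>R pull (J 3) p"
  have P_T: "?P a b c v \<in> N.\<T> p" if "v \<in> N.\<T> p" for a b c v
    using that pT by (simp add: scaleR_fun_apply subspace_add[OF N.T_subspace] subspace_scale[OF N.T_subspace])
  have dP: "dh p (?P a b c v) = a *\<^sub>R J 1 (h p) (dh p v) + b *\<^sub>R J 2 (h p) (dh p v) + c *\<^sub>R J 3 (h p) (dh p v)"
    if "v \<in> N.\<T> p" for a b c v
    using that dp by (simp add: scaleR_fun_apply dh_add dh_scale)
  {
    assume "F \<in> Qh p"
    then obtain J' where F: "F \<in> tangent_endos AN p" and J': "J' \<in> Q (h p)" "\<And>v. v \<in> N.\<T> p \<Longrightarrow> dh p (F v) = J' (dh p v)"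
      unfolding induced_Q_def by blast
    obtain a b c where abc: "\<And>w. J' w = a *\<^sub>R J 1 (h p) w + b *\<^sub>R J 2 (h p) w + c *\<^sub>R J 3 (h p) w"
      by (rule M.adm_Q_app[OF adm J'(1)]) blast
    have "F v = ?P a b c v" for v
    proof (cases "v \<in> N.\<T> p")
      case True
      then show ?thesis
        using dP[OF True] J'(2)[OF True] abc by (intro dh_inj[OF N.tangent_endo_T[OF F True] P_T[OF True]]) simp
    next
      case False
      then show ?thesis using F unfolding tangent_endos_def by (simp add: scaleR_fun_apply pull_def)
    qed
    then show "\<exists>a b c. F = ?P a b c" by blast
  next
    assume "\<exists>a b c. F = ?P a b c"
    then obtain a b c where F: "F = ?P a b c" by blast
    have e: "pull (J i) p \<in> tangent_endos AN p" if "i \<in> {1,2,3}" for i by (rule pull_endo[of "J i", OF JQ[OF that]])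
    have l: "lin_on (N.\<T> p) (pull (J i) p)" if "i \<in> {1,2,3}" for i by (rule N.tangent_endo_lin[OF e[OF that]])
    have "F \<in> tangent_endos AN p"
      unfolding tangent_endos_def
    proof (intro CollectI conjI ballI allI impI)
      show "F v \<in> N.\<T> p" if "v \<in> N.\<T> p" for v unfolding F by (rule P_T[OF that])
      show "F (v + w) = F v + F w" if "v \<in> N.\<T> p" "w \<in> N.\<T> p" for v w
        unfolding F using that by (simp add: scaleR_fun_apply lin_on_add[OF l] algebra_simps)
      show "F (r *\<^sub>R v) = r *\<^sub>R F v" if "v \<in> N.\<T> p" for v r
        unfolding F using that by (simp add: scaleR_fun_apply lin_on_scale[OF l] algebra_simps)
      show "F v = 0" if "v \<notin> N.\<T> p" for v unfolding F using that by (simp add: scaleR_fun_apply pull_def)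
    qed
    moreover have "a *\<^sub>R J 1 (h p) + b *\<^sub>R J 2 (h p) + c *\<^sub>R J 3 (h p) \<in> Q (h p)"
      unfolding M.adm_Q[OF adm] by blast
    moreover have "\<forall>v\<in>N.\<T> p. dh p (F v) = (a *\<^sub>R J 1 (h p) + b *\<^sub>R J 2 (h p) + c *\<^sub>R J 3 (h p)) (dh p v)"
      unfolding F using dP by (simp add: scaleR_fun_apply)
    ultimately show "F \<in> Qh p" unfolding induced_Q_def by blast
  }
qed

lemma pull_admissible:
  assumes adm: "admissible_basis AM Q W J"
  shows "admissible_basis AN Qh (h -` W) (\<lambda>a. pull (J a))"
  unfolding admissible_basis_def
proof (intro conjI ballI)
  show "endo_field_on AN (h -` W) (pull (J a))" if "a \<in> {1,2,3}" for a
    by (rule pull_field[OF M.adm_endo[OF adm that]]) (rule M.adm_J_Q[OF adm _ that])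
  fix p assume "p \<in> h -` W"
  then have p: "h p \<in> W" by simp
  have "F \<in> span {pull (J 1) p, pull (J 2) p, pull (J 3) p} \<longleftrightarrow> F \<in> Qh p" for F
    unfolding pull_combination[OF adm p] by (simp add: span_breakdown_eq algebra_simps)
  then show "Qh p = span {pull (J 1) p, pull (J 2) p, pull (J 3) p}" by blast
  have JQ: "J i (h p) \<in> Q (h p)" if "i \<in> {1,2,3}" for i by (rule M.adm_J_Q[OF adm p that])
  note pT = pull_T[of "J _", OF JQ] and dp = dh_pull[of "J _", OF JQ]
  fix v assume v: "v \<in> N.\<T> p"
  have rel: "\<forall>v\<in>M.\<T> (h p). (\<forall>a\<in>{1,2,3}. J a (h p) (J a (h p) v) = - v) \<and>
      J 1 (h p) (J 2 (h p) v) = J 3 (h p) v \<and> J 2 (h p) (J 1 (h p) v) = - J 3 (h p) v"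
    using adm p unfolding admissible_basis_def by blast
  note r = bspec[OF rel dh_T[OF v]]
  have neg: "- u \<in> N.\<T> p" if "u \<in> N.\<T> p" for u using subspace_neg[OF N.T_subspace that] .
  show "pull (J a) p (pull (J a) p v) = - v" if a: "a \<in> {1,2,3}" for a
  proof (rule dh_inj[OF pT[OF a pT[OF a v]] neg[OF v]])
    have "J a (h p) (J a (h p) (dh p v)) = - dh p v" using r a by blast
    then show "dh p (pull (J a) p (pull (J a) p v)) = dh p (- v)"
      by (simp only: dp[OF a pT[OF a v]] dp[OF a v] dh_minus)
  qed
  have 1: "1 \<in> {1,2,3::nat}" "2 \<in> {1,2,3::nat}" "3 \<in> {1,2,3::nat}" by simp_all
  show "pull (J 1) p (pull (J 2) p v) = pull (J 3) p v"
    using r by (intro dh_inj[OF pT[OF 1(1) pT[OF 1(2) v]] pT[OF 1(3) v]]) (simp add: dp pT v)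
  show "pull (J 2) p (pull (J 1) p v) = - pull (J 3) p v"
    using r by (intro dh_inj[OF pT[OF 1(2) pT[OF 1(1) v]] neg[OF pT[OF 1(3) v]]]) (simp add: dp pT v dh_minus)
qed

text \<open>Compatibility is required for every admissible basis of the induced structure, pulled
  back or not; hence the argument uses only membership in \<open>Qh p\<close>.\<close>

lemma induced_qsH: "almost_qsH AN Qh \<omega>h"
  unfolding almost_qsH_def
proof (intro conjI allI impI ballI)
  note two = M.qsH_two_form[OF qsH]
  note l1 = M.form_lin1[OF two] and l2 = M.form_lin2[OF two]
  show "almost_quaternionic AN Qh"
    unfolding almost_quaternionic_def
  proof
    fix p
    obtain W J where "h p \<in> W" "admissible_basis AM Q W J" by (rule M.qsH_basis[OF qsH])
    then have "p \<in> h -` W \<and> admissible_basis AN Qh (h -` W) (\<lambda>a. pull (J a))" using pull_admissible by simp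
    then show "\<exists>W J. p \<in> W \<and> admissible_basis AN Qh W J" by blast
  qed
  show "two_form AN \<omega>h"
    unfolding two_form_def
  proof (rule conjI)
    show "\<forall>p. \<forall>u\<in>N.\<T> p. \<forall>v\<in>N.\<T> p. \<forall>w\<in>N.\<T> p. \<forall>c. \<omega>h p (u + v) w = \<omega>h p u w + \<omega>h p v w \<and>
        \<omega>h p (c *\<^sub>R v) w = c * \<omega>h p v w \<and> \<omega>h p v w = - \<omega>h p w v"
    proof (intro allI ballI conjI)
      fix p u v w c assume u: "u \<in> N.\<T> p" "v \<in> N.\<T> p" "w \<in> N.\<T> p"
      note T = u[THEN dh_T]
      show "\<omega>h p (u + v) w = \<omega>h p u w + \<omega>h p v w"
        using lin_on_add[OF l1[OF T(3)] T(1,2)] by (simp add: pullback_form2_def dh_add)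
      show "\<omega>h p (c *\<^sub>R v) w = c * \<omega>h p v w"
        using lin_on_scale[OF l1[OF T(3)] T(2)] by (simp add: pullback_form2_def dh_scale)
      show "\<omega>h p v w = - \<omega>h p w v"
        using M.form_swap[OF two T(2,3)] by (simp add: pullback_form2_def)
    qed
    show "\<forall>W X Y. vector_field_on AN W X \<longrightarrow> vector_field_on AN W Y \<longrightarrow> smooth_fun_on AN W (\<lambda>p. \<omega>h p (X p) (Y p))"
    proof (intro allI impI)
      fix W X Y assume X: "vector_field_on AN W X" "vector_field_on AN W Y"
      have "(\<lambda>p. \<omega>h p (X p) (Y p)) \<in> N.\<C> p" if "p \<in> W" for p
        unfolding pullback_form2_def using X that subspace_0[OF N.T_subspace]
        by (intro nabla_form(1)[OF D(1) two D(3)]) (auto simp: N.vector_field_on_iff)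
      then show "smooth_fun_on AN W (\<lambda>p. \<omega>h p (X p) (Y p))"
        using X unfolding N.smooth_fun_on_iff N.vector_field_on_iff by blast
    qed
  qed
  show "nondegenerate AN \<omega>h" by (rule nd)
  fix W K p v w a
  assume adm: "admissible_basis AN Qh W K" and p: "p \<in> W" and v: "v \<in> N.\<T> p" and w: "w \<in> N.\<T> p"
    and a: "a \<in> {1,2,3::nat}"
  obtain W' J where J: "h p \<in> W'" "admissible_basis AM Q W' J" by (rule M.qsH_basis[OF qsH])
  interpret quat_space "M.\<T> (h p)" "J 1 (h p)" "J 2 (h p)" "J 3 (h p)" using M.adm_quat[OF J(2,1)] .
  have "K a p \<in> Qh p" by (rule N.adm_J_Q[OF adm p a])
  then obtain F where F: "F \<in> Q (h p)" "\<And>v. v \<in> N.\<T> p \<Longrightarrow> dh p (K a p v) = F (dh p v)"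
    unfolding induced_Q_def by blast
  obtain x y z where xyz: "\<And>w. F w = x *\<^sub>R J 1 (h p) w + y *\<^sub>R J 2 (h p) w + z *\<^sub>R J 3 (h p) w"
    by (rule M.adm_Q_app[OF J(2,1) F(1)]) blast
  have KT: "K a p u \<in> N.\<T> p" if "u \<in> N.\<T> p" for u
    using N.tangent_endo_T[OF N.endo_field_at[OF N.adm_endo[OF adm a] p] that] .
  \<comment> \<open>\<open>F\<close> is known to square to -1 on the image of the differential;
    together with skewness this gives invariance of \<omega> there.\<close>
  have FF: "F (F (dh p u)) = - dh p u" if "u \<in> N.\<T> p" for u
  proof -
    have "K a p (K a p u) = - u" using adm p a that unfolding admissible_basis_def by blast
    then show ?thesis using F(2)[OF KT[OF that]] F(2)[OF that] dh_minus by metis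
  qed
  have "\<omega> (h p) (F (dh p v)) (F (dh p w)) = - \<omega> (h p) (dh p v) (F (F (dh p w)))"
    by (rule M.Q_skew[OF qsH F(1) dh_T[OF v] M.Q_T[OF qsH F(1) dh_T[OF w]]])
  also have "\<dots> = \<omega> (h p) (dh p v) (dh p w)"
    using lin_on_minus[OF l2[OF dh_T[OF v]] dh_T[OF w]] unfolding FF[OF w] by simp
  finally show "\<omega>h p (K a p v) (K a p w) = \<omega>h p v w"
    unfolding pullback_form2_def F(2)[OF v] F(2)[OF w] .
qed

text \<open>The product rule for a field given only along \<open>N\<close>. The field is expanded in
  an ambient frame, \<open>cov_endo_eq\<close> is applied to the frame fields, and linearity
  recombines the terms.\<close>

lemma nabla_J:
  assumes adm: "admissible_basis AM Q W J" "h p \<in> W" "a \<in> {1,2,3}" and v: "v \<in> N.\<T> p" and Y: "Y \<in> N.\<X> p"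
  shows "nabla D p v (\<lambda>q. dh q (apply_endo (pull (J a)) Y q)) =
    J a (h p) (nabla D p v (\<lambda>q. dh q (Y q))) + M.cov_endo D (J a) (h p) (dh p v) (dh p (Y p))"
proof -
  obtain x E where f: "M.frame (h p) x E" using M.frame_exists by blast
  let ?y = "\<lambda>b q. Y q (\<lambda>r. x b (h r))"
  let ?K = "M.cov_endo D (J a) (h p) (dh p v)"
  interpret quat_space "M.\<T> (h p)" "J 1 (h p)" "J 2 (h p)" "J 3 (h p)" using M.adm_quat[OF adm(1,2)] .
  note dv = dh_T[OF v]
  have Jl: "lin_on (M.\<T> (h p)) (J a (h p))" by (rule M.tangent_endo_lin[OF M.endo_field_at[OF M.adm_endo[OF adm(1,3)] adm(2)]])
  obtain c1 c2 c3 where K: "\<And>w. w \<in> M.\<T> (h p) \<Longrightarrow> ?K w = c1 *\<^sub>R J 1 (h p) w + c2 *\<^sub>R J 2 (h p) w + c3 *\<^sub>R J 3 (h p) w"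
    by (rule M.cov_endo_Q[OF adm(1) D(1,2) adm(2,3) dv]) blast
  have Kl: "lin_on (M.\<T> (h p)) ?K"
    unfolding lin_on_def by (simp add: K Scl Jlin algebra_simps)
  have near: "\<forall>\<^sub>F q in nhds p. h q \<in> W" by (rule h_eventually[OF M.adm_near[OF adm(1,2)]])
  have "\<forall>\<^sub>F q in nhds p. dh q (apply_endo (pull (J a)) Y q) = (\<Sum>b\<in>Basis. ?y b q *\<^sub>R apply_endo (J a) (E b) (h q))"
    using near N.X_eventually[OF Y] h_eventually[OF M.frame_eventually[OF f]]
  proof eventually_elim
    case (elim q)
    note YT = N.X_T[OF elim(2)] and JQ = M.adm_J_Q[OF adm(1) elim(1) adm(3)]
    have "dh q (apply_endo (pull (J a)) Y q) = J a (h q) (dh q (Y q))"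
      using dh_pull[of "J a", OF JQ YT] by (simp add: apply_endo_def)
    also have "\<dots> = (\<Sum>b\<in>Basis. ?y b q *\<^sub>R J a (h q) (E b (h q)))"
      unfolding dh_expand[OF elim(3) YT]
      using M.frame_T[OF elim(3)] by (intro lin_on_sum[OF M.Q_lin[OF qsH JQ] M.T_subspace])
    finally show ?case by (simp add: apply_endo_def)
  qed
  from nabla_expansion[OF D(1) v _ _ this]
  have "nabla D p v (\<lambda>q. dh q (apply_endo (pull (J a)) Y q)) = (\<Sum>b\<in>Basis. v (?y b) *\<^sub>R J a (h p) (E b (h p))
      + ?y b p *\<^sub>R D (h p) (dh p v) (apply_endo (J a) (E b)))"
    using dh_X_C[OF Y M.frame_C[OF f]] M.adm_apply[OF adm(1,3,2) M.frame_X[OF f]] by (simp add: apply_endo_def)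
  also have "\<dots> = (\<Sum>b\<in>Basis. v (?y b) *\<^sub>R J a (h p) (E b (h p))) + (\<Sum>b\<in>Basis. ?y b p *\<^sub>R J a (h p) (D (h p) (dh p v) (E b)))
      + (\<Sum>b\<in>Basis. ?y b p *\<^sub>R ?K (E b (h p)))"
    using M.cov_endo_eq[OF adm(1) D(1,2) adm(2,3) dv M.frame_X[OF f]]
    by (simp add: sum.distrib scaleR_add_right add.assoc)
  also have "(\<Sum>b\<in>Basis. ?y b p *\<^sub>R ?K (E b (h p))) = ?K (dh p (Y p))"
    unfolding dh_expand[OF f N.X_T[OF Y]]
    using M.frame_T[OF f] by (intro lin_on_sum[OF Kl M.T_subspace, symmetric])
  also have "(\<Sum>b\<in>Basis. v (?y b) *\<^sub>R J a (h p) (E b (h p))) + (\<Sum>b\<in>Basis. ?y b p *\<^sub>R J a (h p) (D (h p) (dh p v) (E b)))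
      = J a (h p) (nabla D p v (\<lambda>q. dh q (Y q)))"
  proof -
    have ET: "E b (h p) \<in> M.\<T> (h p)" "D (h p) (dh p v) (E b) \<in> M.\<T> (h p)" if "b \<in> Basis" for b
      using M.frame_T[OF f that] M.D_T[OF D(1) dv M.frame_X[OF f that]] by auto
    have s: "(\<Sum>b\<in>Basis. s b *\<^sub>R E b (h p)) \<in> M.\<T> (h p)" "(\<Sum>b\<in>Basis. s b *\<^sub>R D (h p) (dh p v) (E b)) \<in> M.\<T> (h p)" for s
      by (rule subspace_sum[OF M.T_subspace], rule subspace_scale[OF M.T_subspace], use ET in blast)+
    have "J a (h p) (\<Sum>b\<in>Basis. v (?y b) *\<^sub>R E b (h p)) = (\<Sum>b\<in>Basis. v (?y b) *\<^sub>R J a (h p) (E b (h p)))"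
      "J a (h p) (\<Sum>b\<in>Basis. ?y b p *\<^sub>R D (h p) (dh p v) (E b)) = (\<Sum>b\<in>Basis. ?y b p *\<^sub>R J a (h p) (D (h p) (dh p v) (E b)))"
      using ET by (intro lin_on_sum[OF Jl M.T_subspace]; blast)+
    then show ?thesis
      unfolding nabla_frame[OF D(1) f v Y] sum.distrib lin_on_add[OF Jl s] by simp
  qed
  finally show ?thesis .
qed

text \<open>The second fundamental form \<open>s\<close> modulo \<open>L\<close> is symmetric and commutes with each
  \<open>J = J\<^sub>1, J\<^sub>2, J\<^sub>3\<close>, so \<open>s (J X) (J Y) = - s X Y\<close>; as \<open>J\<^sub>3 = J\<^sub>1 J\<^sub>2\<close>, it vanishes.\<close>

lemma nabla_L:
  assumes v: "v \<in> N.\<T> p" and Y: "Y \<in> N.\<X> p"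
  shows "nabla D p v (\<lambda>q. dh q (Y q)) \<in> L p"
proof -
  obtain W J where J: "h p \<in> W" "admissible_basis AM Q W J" by (rule M.qsH_basis[OF qsH])
  note admN = pull_admissible[OF J(2)]
  have p: "p \<in> h -` W" using J(1) by simp
  \<comment> \<open>Arguments are fields and values are ambient vectors; the second fundamental form
    is the class of \<open>s X Y\<close> modulo \<open>L p\<close>, and all relations below are
    congruences modulo this subspace.\<close>
  define s where "s X Y = nabla D p (X p) (\<lambda>q. dh q (Y q))" for X Y
  define \<J> where "\<J> a = apply_endo (pull (J a))" for a
  have sT: "s X Y \<in> M.\<T> (h p)" if "X \<in> N.\<X> p" "Y \<in> N.\<X> p" for X Y
    unfolding s_def by (rule nabla_T[OF D(1) N.X_T[OF that(1)] that(2)])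
  have JX: "\<J> a X \<in> N.\<X> p" if "a \<in> {1,2,3}" "X \<in> N.\<X> p" for a X
    unfolding \<J>_def by (rule N.adm_apply[OF admN that(1) p that(2)])
  have sym: "s X Y - s Y X \<in> L p" if "X \<in> N.\<X> p" "Y \<in> N.\<X> p" for X Y
    unfolding s_def nabla_torsion_free[OF D(1,4) that] using N.lie_bracket_T[OF that] by blast
  have com: "s X (\<J> a Y) - J a (h p) (s X Y) \<in> L p" if a: "a \<in> {1,2,3}" and X: "X \<in> N.\<X> p" "Y \<in> N.\<X> p" for a X Y
  proof -
    have YL: "dh p (Y p) \<in> L p" using N.X_T[OF X(2)] by blast
    obtain c1 c2 c3 where K: "\<And>w. w \<in> M.\<T> (h p) \<Longrightarrow> M.cov_endo D (J a) (h p) (dh p (X p)) w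
        = c1 *\<^sub>R J 1 (h p) w + c2 *\<^sub>R J 2 (h p) w + c3 *\<^sub>R J 3 (h p) w"
      by (rule M.cov_endo_Q[OF J(2) D(1,2) J(1) a dh_T[OF N.X_T[OF X(1)]]]) blast
    have "c1 *\<^sub>R J 1 (h p) (dh p (Y p)) + c2 *\<^sub>R J 2 (h p) (dh p (Y p)) + c3 *\<^sub>R J 3 (h p) (dh p (Y p)) \<in> L p"
      using adm_L[OF J(2,1) _ YL] by (intro subspace_add[OF L_subspace] subspace_scale[OF L_subspace]) simp_all
    then show ?thesis
      unfolding s_def \<J>_def nabla_J[OF J(2,1) a N.X_T[OF X(1)] X(2)] K[OF L_T[OF YL]] by simp
  qed
  have anti: "s (\<J> a X) (\<J> a Y) + s X Y \<in> L p" if a: "a \<in> {1,2,3}" and X: "X \<in> N.\<X> p" "Y \<in> N.\<X> p" for a X Y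
  proof -
    have l: "lin_on (M.\<T> (h p)) (J a (h p))" by (rule M.tangent_endo_lin[OF M.endo_field_at[OF M.adm_endo[OF J(2) a] J(1)]])
    have sq: "J a (h p) (J a (h p) u) = - u" if "u \<in> M.\<T> (h p)" for u
      using J a that unfolding admissible_basis_def by blast
    have JT: "J a (h p) u \<in> M.\<T> (h p)" if "u \<in> M.\<T> (h p)" for u
      using M.tangent_endo_T[OF M.endo_field_at[OF M.adm_endo[OF J(2) a] J(1)] that] .
    note JX' = JX[OF a]
    have 1: "s (\<J> a X) (\<J> a Y) - J a (h p) (s (\<J> a X) Y) \<in> L p" by (rule com[OF a JX'[OF X(1)] X(2)])
    have "J a (h p) (s (\<J> a X) Y - s Y (\<J> a X)) \<in> L p" by (rule adm_L[OF J(2,1) a sym[OF JX'[OF X(1)] X(2)]])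
    then have 2: "J a (h p) (s (\<J> a X) Y) - J a (h p) (s Y (\<J> a X)) \<in> L p"
      by (simp add: lin_on_diff[OF l M.T_subspace] sT JX' X)
    have "J a (h p) (s Y (\<J> a X) - J a (h p) (s Y X)) \<in> L p" by (rule adm_L[OF J(2,1) a com[OF a X(2,1)]])
    then have 3: "J a (h p) (s Y (\<J> a X)) + s Y X \<in> L p"
      by (simp add: lin_on_diff[OF l M.T_subspace] sT JX' X JT sq)
    have 4: "s X Y - s Y X \<in> L p" by (rule sym[OF X])
    \<comment> \<open>Modulo \<open>L p\<close>: \<open>s (J X) (J Y)\<close> is
      \<open>J (s (J X) Y)\<close>, then \<open>J (s Y (J X))\<close> by symmetry, then
      \<open>- s Y X\<close> as \<open>J\<close> squares to -1, and finally
      \<open>- s X Y\<close>.\<close>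
    have eq: "s (\<J> a X) (\<J> a Y) + s X Y = (s (\<J> a X) (\<J> a Y) - J a (h p) (s (\<J> a X) Y))
        + (J a (h p) (s (\<J> a X) Y) - J a (h p) (s Y (\<J> a X))) + (J a (h p) (s Y (\<J> a X)) + s Y X) + (s X Y - s Y X)"
      by simp
    show ?thesis
      using subspace_add[OF L_subspace subspace_add[OF L_subspace subspace_add[OF L_subspace 1 2] 3] 4]
      unfolding eq[symmetric] .
  qed
  have s3: "s (\<J> 3 X) (\<J> 3 Y) = s (\<J> 1 (\<J> 2 X)) (\<J> 1 (\<J> 2 Y))" if X: "X \<in> N.\<X> p" "Y \<in> N.\<X> p" for X Y
  proof -
    have e: "\<J> 3 Z q = \<J> 1 (\<J> 2 Z) q" if "q \<in> h -` W" "Z q \<in> N.\<T> q" for Z q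
      using admN that unfolding admissible_basis_def \<J>_def apply_endo_def by simp
    have "\<forall>\<^sub>F q in nhds p. \<J> 3 Y q = \<J> 1 (\<J> 2 Y) q"
      using N.adm_near[OF admN p] N.X_eventually[OF X(2)] by eventually_elim (rule e, auto dest: N.X_T)
    from nabla_cong[OF D(1) _ _ this, of "\<J> 3 X p"] show ?thesis
      unfolding s_def e[of p X, OF p N.X_T[OF X(1)], symmetric] using N.X_T[OF JX[OF _ X(1)]] JX[OF _ X(2)] by simp
  qed
  define X where "X = N.extend p v"
  have X: "X \<in> N.\<X> p" "X p = v" unfolding X_def using N.extend v by auto
  have 1: "s (\<J> 3 X) (\<J> 3 Y) + s X Y \<in> L p" by (rule anti[OF _ X(1) Y]) simp
  have 2: "s (\<J> 1 (\<J> 2 X)) (\<J> 1 (\<J> 2 Y)) + s (\<J> 2 X) (\<J> 2 Y) \<in> L p"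
    by (rule anti[OF _ JX[OF _ X(1)] JX[OF _ Y]]) simp_all
  have 3: "s (\<J> 2 X) (\<J> 2 Y) + s X Y \<in> L p" by (rule anti[OF _ X(1) Y]) simp
  \<comment> \<open>Modulo \<open>L p\<close>, \<open>s (\<J> 3 X) (\<J> 3 Y)\<close> is
    \<open>- s X Y\<close> by \<open>1\<close>, and it is \<open>s X Y\<close> by \<open>2\<close>
    and \<open>3\<close>. The combination isolates twice \<open>s X Y\<close>.\<close>
  have "(1 / 2) *\<^sub>R ((s (\<J> 3 X) (\<J> 3 Y) + s X Y) - (s (\<J> 1 (\<J> 2 X)) (\<J> 1 (\<J> 2 Y)) + s (\<J> 2 X) (\<J> 2 Y))
      + (s (\<J> 2 X) (\<J> 2 Y) + s X Y)) \<in> L p"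
    by (rule subspace_scale[OF L_subspace subspace_add[OF L_subspace subspace_diff[OF L_subspace 1 2] 3]])
  also have "(1 / 2) *\<^sub>R ((s (\<J> 3 X) (\<J> 3 Y) + s X Y) - (s (\<J> 1 (\<J> 2 X)) (\<J> 1 (\<J> 2 Y)) + s (\<J> 2 X) (\<J> 2 Y))
      + (s (\<J> 2 X) (\<J> 2 Y) + s X Y)) = (1 / 2) *\<^sub>R (s X Y + s X Y)"
    unfolding s3[OF X(1) Y] by simp
  also have "\<dots> = s X Y" by (rule scaleR_half_double)
  finally show ?thesis unfolding s_def X(2) .
qed

section \<open>The induced connection\<close>

definition Dh :: "'n conn" where
  "Dh p v Y = (SOME u. u \<in> N.\<T> p \<and> dh p u = nabla D p v (\<lambda>q. dh q (Y q)))"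

lemma assumes "v \<in> N.\<T> p" "Y \<in> N.\<X> p"
  shows Dh_T: "Dh p v Y \<in> N.\<T> p" and dh_Dh: "dh p (Dh p v Y) = nabla D p v (\<lambda>q. dh q (Y q))"
proof -
  have "\<exists>u. u \<in> N.\<T> p \<and> dh p u = nabla D p v (\<lambda>q. dh q (Y q))" using nabla_L[OF assms] by fastforce
  from someI_ex[OF this] show "Dh p v Y \<in> N.\<T> p" "dh p (Dh p v Y) = nabla D p v (\<lambda>q. dh q (Y q))"
    unfolding Dh_def by blast+
qed

text \<open>Identities are checked after the injective differential is applied, where they become
  those of \<open>nabla\<close>; smoothness comes from \<open>nabla_smooth\<close> through
  \<open>X_immersion\<close>.\<close>

lemma Dh_connection: "connection AN Dh"
  unfolding connection_def
proof (intro conjI allI ballI impI)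
  fix p v Y assume v: "v \<in> N.\<T> p" and Y: "Y \<in> N.\<X> p"
  note add = subspace_add[OF N.T_subspace] and scale = subspace_scale[OF N.T_subspace]
  show "Dh p v Y \<in> N.\<T> p" using Dh_T[OF v Y] .
  show "Dh p (v + w) Y = Dh p v Y + Dh p w Y" if w: "w \<in> N.\<T> p" for w
    by (rule dh_inj[of _ p]) (simp_all add: Dh_T dh_Dh add v w Y dh_add nabla_addv[OF D(1)])
  show "Dh p (c *\<^sub>R v) Y = c *\<^sub>R Dh p v Y" for c
    by (rule dh_inj[of _ p]) (simp_all add: Dh_T dh_Dh scale v Y dh_scale nabla_scalev[OF D(1)])
  show "Dh p v (\<lambda>q. Y q + Z q) = Dh p v Y + Dh p v Z" if Z: "Z \<in> N.\<X> p" for Z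
    by (rule dh_inj[OF Dh_T[OF v N.X_add[OF Y Z]] add[OF Dh_T[OF v Y] Dh_T[OF v Z]]])
      (simp only: dh_Dh[OF v N.X_add[OF Y Z]] dh_add dh_Dh[OF v Y] dh_Dh[OF v Z] nabla_add[OF D(1) v Y Z, unfolded dh_add])
  show "Dh p v (\<lambda>q. f q *\<^sub>R Y q) = v f *\<^sub>R Y p + f p *\<^sub>R Dh p v Y" if f: "f \<in> N.\<C> p" for f
    by (rule dh_inj[OF Dh_T[OF v N.X_scale[OF f Y]] add[OF scale[OF N.X_T[OF Y]] scale[OF Dh_T[OF v Y]]]])
      (simp only: dh_Dh[OF v N.X_scale[OF f Y]] dh_add[of p "v f *\<^sub>R Y p"] dh_scale[of p] dh_Dh[OF v Y]
        nabla_leibniz[OF D(1) v Y f])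
next
  fix W X Y assume X: "vector_field_on AN W X" "vector_field_on AN W Y"
  have "(\<lambda>p. Dh p (X p) Y) \<in> N.\<X> p" if p: "p \<in> W" for p
  proof -
    have XY: "X \<in> N.\<X> p" "Y \<in> N.\<X> p" using X p unfolding N.vector_field_on_iff by blast+
    obtain x E where f: "M.frame (h p) x E" using M.frame_exists by blast
    show ?thesis
    proof (rule X_immersion[OF f])
      show "\<forall>\<^sub>F q in nhds p. Dh q (X q) Y \<in> N.\<T> q"
        using XY[THEN N.X_eventually] by eventually_elim (intro Dh_T N.X_T)
      fix b :: 'a assume b: "b \<in> Basis"
      have "\<forall>\<^sub>F q in nhds p. nabla D q (X q) (\<lambda>r. dh r (Y r)) (x b) = dh q (Dh q (X q) Y) (x b)"
        using XY[THEN N.X_eventually] by eventually_elim (simp add: dh_Dh N.X_T)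
      then show "(\<lambda>q. dh q (Dh q (X q) Y) (x b)) \<in> N.\<C> p"
        by (rule N.C_cong[OF nabla_smooth[OF D(1) f XY b]])
    qed
  qed
  then show "vector_field_on AN W (\<lambda>p. Dh p (X p) Y)" using X unfolding N.vector_field_on_iff by blast
qed

lemma Dh_torsion_free: "torsion_free AN Dh"
  unfolding torsion_free_def torsion_def
proof (intro allI ballI)
  fix p X Y assume X: "X \<in> N.\<X> p" "Y \<in> N.\<X> p"
  note T = Dh_T[OF N.X_T[OF X(1)] X(2)] Dh_T[OF N.X_T[OF X(2)] X(1)] N.lie_bracket_T[OF X]
  have "dh p (Dh p (X p) Y - Dh p (Y p) X) = dh p (lie_bracket AN X Y p)"
    using nabla_torsion_free[OF D(1,4) X] by (simp add: dh_diff dh_Dh X N.X_T)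
  then have "Dh p (X p) Y - Dh p (Y p) X = lie_bracket AN X Y p"
    using dh_inj[OF subspace_diff[OF N.T_subspace T(1,2)] T(3)] by simp
  then show "Dh p (X p) Y - Dh p (Y p) X - lie_bracket AN X Y p = 0" by simp
qed

lemma Dh_preserves_form: "preserves_form2 AN \<omega>h Dh"
  unfolding preserves_form2_def cov_deriv_form2_def pullback_form2_def
proof (intro allI ballI)
  fix p v Y Z assume v: "v \<in> N.\<T> p" and Y: "Y \<in> N.\<X> p" and Z: "Z \<in> N.\<X> p"
  show "v (\<lambda>q. \<omega> (h q) (dh q (Y q)) (dh q (Z q))) - \<omega> (h p) (dh p (Dh p v Y)) (dh p (Z p))
      - \<omega> (h p) (dh p (Y p)) (dh p (Dh p v Z)) = 0"
    unfolding nabla_form(2)[OF D(1) M.qsH_two_form[OF qsH] D(3) v Y Z] dh_Dh[OF v Y] dh_Dh[OF v Z] by simp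
qed

text \<open>For a pulled back basis the derivative on \<open>N\<close> has the same coefficients
  \<open>c1\<close>, \<open>c2\<close>, \<open>c3\<close> as the ambient one.\<close>

lemma Dh_preserves_Q: "preserves_Q AN Qh Dh"
proof (rule N.preserves_Q_I[OF Dh_connection])
  fix p
  obtain W J where J: "h p \<in> W" "admissible_basis AM Q W J" by (rule M.qsH_basis[OF qsH])
  note admN = pull_admissible[OF J(2)]
  have p: "p \<in> h -` W" using J(1) by simp
  have "\<exists>K\<in>Qh p. \<forall>Y\<in>N.\<X> p. Dh p v (apply_endo (pull (J a)) Y) - pull (J a) p (Dh p v Y) = K (Y p)"
    if a: "a \<in> {1,2,3}" and v: "v \<in> N.\<T> p" for a v
  proof -
    obtain c1 c2 c3 where K: "\<And>w. w \<in> M.\<T> (h p) \<Longrightarrow> M.cov_endo D (J a) (h p) (dh p v) w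
        = c1 *\<^sub>R J 1 (h p) w + c2 *\<^sub>R J 2 (h p) w + c3 *\<^sub>R J 3 (h p) w"
      by (rule M.cov_endo_Q[OF J(2) D(1,2) J(1) a dh_T[OF v]]) blast
    define K' where "K' = c1 *\<^sub>R pull (J 1) p + c2 *\<^sub>R pull (J 2) p + c3 *\<^sub>R pull (J 3) p"
    have K'Q: "K' \<in> Qh p" unfolding K'_def pull_combination[OF J(2,1)] by blast
    have "Dh p v (apply_endo (pull (J a)) Y) - pull (J a) p (Dh p v Y) = K' (Y p)" if Y: "Y \<in> N.\<X> p" for Y
    proof (rule dh_inj)
      have JQ: "J i (h p) \<in> Q (h p)" if "i \<in> {1,2,3}" for i by (rule M.adm_J_Q[OF J(2,1) that])
      note pT = pull_T[of "J _", OF JQ] and dp = dh_pull[of "J _", OF JQ]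
      have JY: "apply_endo (pull (J a)) Y \<in> N.\<X> p" by (rule N.adm_apply[OF admN a p Y])
      show "Dh p v (apply_endo (pull (J a)) Y) - pull (J a) p (Dh p v Y) \<in> N.\<T> p"
        by (rule subspace_diff[OF N.T_subspace Dh_T[OF v JY] pT[OF a Dh_T[OF v Y]]])
      show "K' (Y p) \<in> N.\<T> p"
        unfolding K'_def using N.X_T[OF Y] pT
        by (simp add: scaleR_fun_apply subspace_add[OF N.T_subspace] subspace_scale[OF N.T_subspace])
      have "dh p (Dh p v (apply_endo (pull (J a)) Y) - pull (J a) p (Dh p v Y)) = M.cov_endo D (J a) (h p) (dh p v) (dh p (Y p))"
        unfolding dh_diff dh_Dh[OF v JY] dp[OF a Dh_T[OF v Y]] dh_Dh[OF v Y] nabla_J[OF J(2,1) a v Y] by simp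
      also have "\<dots> = dh p (K' (Y p))"
        unfolding K[OF dh_T[OF N.X_T[OF Y]]] K'_def using N.X_T[OF Y] dp by (simp add: scaleR_fun_apply dh_add dh_scale)
      finally show "dh p (Dh p v (apply_endo (pull (J a)) Y) - pull (J a) p (Dh p v Y)) = dh p (K' (Y p))" .
    qed
    then show ?thesis using K'Q by blast
  qed
  then show "\<exists>W J. p \<in> W \<and> admissible_basis AN Qh W J \<and> (\<forall>a\<in>{1,2,3}. \<forall>v\<in>N.\<T> p. \<exists>K\<in>Qh p. \<forall>Y\<in>N.\<X> p.
       Dh p v (apply_endo (J a) Y) - J a p (Dh p v Y) = K (Y p))"
    using admN p by blast
qed

text \<open>Stated up to \<open>connection_eq\<close>, so that it serves both minimal adapted and
  Oproiu connections of the ambient manifold.\<close>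

lemma restricts_to_Dh:
  assumes "connection_eq AM D D'"
  shows "restricts_to AN AM h D' Dh"
  unfolding restricts_to_def
proof (intro allI ballI impI)
  fix p v Y Z assume v: "v \<in> N.\<T> p" and Y: "Y \<in> N.\<X> p" and Z: "Z \<in> M.\<X> (h p)"
    and e: "\<forall>\<^sub>F q in nhds p. Z (h q) = dh q (Y q)"
  have "D' (h p) (dh p v) Z = D (h p) (dh p v) Z"
    using assms dh_T[OF v] Z unfolding connection_eq_def by simp
  also have "\<dots> = nabla D p v (\<lambda>q. dh q (Y q))"
    using e by (intro nabla_extension[OF D(1) v Z, symmetric]) (auto elim: eventually_mono)
  also have "\<dots> = dh p (Dh p v Y)" using dh_Dh[OF v Y] by simp
  finally show "D' (h p) (dh p v) Z = dh p (Dh p v Y)" .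
qed

end

theorem theorem2p37:
  fixes AM :: "('m::{t2_space,second_countable_topology}, 'a::euclidean_space) atlas"
    and AN :: "('n::{t2_space,second_countable_topology}, 'b::euclidean_space) atlas"
    and Q :: "'m \<Rightarrow> 'm endo set" and \<omega> :: "'m form2" and \<iota> :: "'n \<Rightarrow> 'm"
    and n k :: nat
  defines "Qh \<equiv> induced_Q AN AM \<iota> Q" and "\<omega>h \<equiv> pullback_form2 AM \<iota> \<omega>"
  assumes "smooth_manifold AM" and "DIM('a) = 4 * n" and "n > 1"
    and "smooth_manifold AN" and "DIM('b) = 4 * k" and "k < n"
    and "qsH_manifold AM Q \<omega>"
    and "almost_quaternionic_submanifold AN AM \<iota> Q"
    and "nondegenerate AN \<omega>h"
  shows "closed_form AN \<omega>h \<and>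
    torsion_free_structure AN Qh \<omega>h \<and>
    qsH_manifold AN Qh \<omega>h \<and>
    (\<exists>Dh. minimal_adapted AN Qh \<omega>h Dh \<and>
       (\<forall>D'. minimal_adapted AN Qh \<omega>h D' \<longrightarrow> connection_eq AN Dh D') \<and>
       (\<forall>D. minimal_adapted AM Q \<omega> D \<longrightarrow> restricts_to AN AM \<iota> D Dh) \<and>
       (\<forall>D. unimodular_oproiu AM Q (vol_form AM \<omega>) D \<longrightarrow> restricts_to AN AM \<iota> D Dh))"
proof -
  interpret M: manifold AM using assms(3) by unfold_locales
  interpret N: manifold AN using assms(6) by unfold_locales
  obtain D where qsH: "almost_qsH AM Q \<omega>" and min_M: "minimal_adapted AM Q \<omega> D" "torsion_free AM D"
    using assms(9) unfolding qsH_manifold_def by blast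
  have con: "connection AM D" using min_M(1) unfolding minimal_adapted_def by blast
  \<comment> \<open>Preservation of \<open>Q\<close> and \<omega> is not part of
    \<open>minimal_adapted\<close>; it follows from the shape of the correction term.\<close>
  note pres = M.minimal_adapted_preserves_Q[OF qsH min_M(1)] M.minimal_adapted_preserves_form[OF qsH min_M(1)]
  have sub: "submanifold AN AM \<iota>"
    and inv: "\<forall>p. \<forall>J\<in>Q (\<iota> p). (\<forall>v\<in>tangent_space AM (\<iota> p). J (J v) = - v) \<longrightarrow>
        J ` (differential AM \<iota> p ` tangent_space AN p) = differential AM \<iota> p ` tangent_space AN p"
    using assms(10) unfolding almost_quaternionic_submanifold_def by blast+
  interpret quaternionic_immersion AM AN \<iota> Q \<omega> D
  proof unfold_locales
    show "smooth_map AN AM \<iota>" "\<And>p. inj_on (differential AM \<iota> p) (tangent_space AN p)"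
      using sub unfolding submanifold_def by blast+
    show "almost_qsH AM Q \<omega>" by (rule qsH)
    show "nondegenerate AN (pullback_form2 AM \<iota> \<omega>)" using assms(11) unfolding \<omega>h_def .
    show "J ` (differential AM \<iota> p ` tangent_space AN p) = differential AM \<iota> p ` tangent_space AN p"
      if "J \<in> Q (\<iota> p)" "\<And>v. v \<in> tangent_space AM (\<iota> p) \<Longrightarrow> J (J v) = - v" for J p
      using inv that by blast
  qed (use con pres min_M(2) in auto)
  note qN = induced_qsH and Dh = Dh_connection Dh_preserves_Q Dh_preserves_form Dh_torsion_free
  note min = N.adapted_minimal[OF qN assms(7) Dh]
  have uniq: "\<forall>D'. minimal_adapted AN Qh \<omega>h D' \<longrightarrow> connection_eq AN Dh D'"
    unfolding Qh_def \<omega>h_def using N.adapted_minimal_unique[OF qN assms(7) Dh] by blast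
  \<comment> \<open>Uniqueness on the ambient manifold reduces every minimal adapted connection, and
    below every unimodular Oproiu connection, to the one connection \<open>D\<close> from which
    \<open>Dh\<close> was built.\<close>
  have r1: "\<forall>D'. minimal_adapted AM Q \<omega> D' \<longrightarrow> restricts_to AN AM \<iota> D' Dh"
    using M.adapted_minimal_unique[OF qsH assms(4) con pres min_M(2)] restricts_to_Dh by blast
  have r2: "\<forall>D'. unimodular_oproiu AM Q (vol_form AM \<omega>) D' \<longrightarrow> restricts_to AN AM \<iota> D' Dh"
    using M.adapted_unimodular_unique[OF qsH assms(4) con pres min_M(2)] restricts_to_Dh by blast
  have "closed_form AN \<omega>h"
    unfolding \<omega>h_def by (rule N.preserves_form_closed[OF N.qsH_two_form[OF qN] Dh(1,3,4)])
  moreover have "torsion_free_structure AN Qh \<omega>h"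
    unfolding torsion_free_structure_def Qh_def \<omega>h_def using qN Dh by blast
  moreover have "qsH_manifold AN Qh \<omega>h"
    unfolding qsH_manifold_def Qh_def \<omega>h_def using qN min Dh(4) by blast
  moreover have "minimal_adapted AN Qh \<omega>h Dh" unfolding Qh_def \<omega>h_def by (rule min)
  ultimately show ?thesis using uniq r1 r2 by blast
qed

end
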